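(* Let $\pi:(M,\varphi,\xi,\eta,g)\to(M',J,g')$ be a contact-complex Riemannian submersion with $\dim M=2m+1\ge5$, $\dim M'=2n\ge2$, and let $(F,\hat\varphi,\hat\xi,\hat\eta,\hat g)$ be a fibre of $\pi$ with the induced almost contact metric structure, $\dim F=2r+1\ge3$. Let $\omega$ be the Lee form of $M$ and assume $d\phi=-2\omega\wedge\phi$. Then: (1) $\hat\delta\hat\eta=0$, where $\hat\delta$ is the codifferential of $(F,\hat g)$; (2) if $r\ge2$, the fundamental form $\hat\phi$ of $F$ satisfies $d\hat\phi=-2\hat\omega\wedge\hat\phi$, where $\hat\omega=\omega|_{TF}$, and $\hat\omega$ is the Lee form of $F$; if $r=1$, the Lee form $\hat\omega$ of $F$ is given by $\hat\omega(U)=(\nabla_\xi\eta)U$ for every $U$ tangent to $F$.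
   Context: All objects are smooth. An almost contact metric (ACM) manifold $(M,\varphi,\xi,\eta,g)$ is a $(2m+1)$-dimensional Riemannian manifold with a $(1,1)$-tensor field $\varphi$, a vector field $\xi$ and a 1-form $\eta$ such that $\varphi^2=-I+\eta\otimes\xi$, $\eta(\xi)=1$, $g(\varphi X,\varphi Y)=g(X,Y)-\eta(X)\eta(Y)$. Its fundamental form is $\phi(X,Y)=g(X,\varphi Y)$. $\nabla$ is the Levi-Civita connection and $\delta$ the codifferential: for a local orthonormal frame $\{e_i\}$, $\delta\eta=-\sum_i(\nabla_{e_i}\eta)(e_i)$ and $\delta\phi(X)=-\sum_i(\nabla_{e_i}\phi)(e_i,X)$. The Lee form of a $(2m+1)$-dimensional ACM manifold is \[\omega=-\tfrac{1}{2(m-1)}\big(\delta\phi\circ\varphi+\nabla_\xi\eta\big)+\tfrac{\delta\eta}{2m}\,\eta\ \ (m\ge2),\qquad \omega=\nabla_\xi\eta+\tfrac{\delta\eta}{2}\,\eta\ \ (m=1).\] A contact-complex Riemannian submersion $\pi:(M,\varphi,\xi,\eta,g)\to(M',J,g')$ is a Riemannian submersion from an ACM manifold onto an almost Hermitian manifold ($J^2=-I$, $g'(J\cdot,J\cdot)=g'$) with $J\circ\pi_*=\pi_*\circ\varphi$. Then $\xi$ is vertical, $\varphi$ preserves $\ker\pi_*$, and writing $m=n+r$ with $r\ge1$, every fibre $F$ is an ACM manifold of dimension $2r+1$ with $\hat\varphi=\varphi|_{TF}$, $\hat\xi=\xi|_F$, $\hat\eta=\eta|_{TF}$, $\hat g=g|_{TF\times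 TF}$. *)

theory Defs
  imports "HOL-Analysis.Analysis"
begin

section \<open>Smooth maps between open subsets of Euclidean spaces\<close>

primrec Ck_on :: "nat \<Rightarrow> 'a::euclidean_space set \<Rightarrow> ('a \<Rightarrow> 'b::real_normed_vector) \<Rightarrow> bool" where
  "Ck_on 0 S f \<longleftrightarrow> continuous_on S f"
| "Ck_on (Suc k) S f \<longleftrightarrow>
     (\<forall>x\<in>S. f differentiable (at x)) \<and> (\<forall>v. Ck_on k S (\<lambda>x. frechet_derivative f (at x) v))"

text \<open>Only used for open sets.\<close>

definition smooth_on :: "'a::euclidean_space set \<Rightarrow> ('a \<Rightarrow> 'b::real_normed_vector) \<Rightarrow> bool" where
  "smooth_on S f \<longleftrightarrow> (\<forall>k. Ck_on k S f)"

section \<open>Smooth manifolds\<close>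

text \<open>A chart is a pair of its domain and its coordinate map; the manifold is modelled on the
  Euclidean space \<^typ>\<open>'e\<close>, so its dimension is \<open>DIM('e)\<close>. The point set is the
  carrier of the topology. The atlas need not be maximal.\<close>

record ('a, 'e) mfd =
  mtop :: "'a topology"
  atlas :: "('a set \<times> ('a \<Rightarrow> 'e)) set"

definition points :: "('a, 'e, 'x) mfd_scheme \<Rightarrow> 'a set" where
  "points M = topspace (mtop M)"

definition chart_inv :: "'a set \<times> ('a \<Rightarrow> 'e) \<Rightarrow> 'e \<Rightarrow> 'a" where
  "chart_inv c = inv_into (fst c) (snd c)"

definition smooth_manifold :: "('a, 'e::euclidean_space, 'x) mfd_scheme \<Rightarrow> bool" where
  "smooth_manifold M \<longleftrightarrow>
     Hausdorff_space (mtop M) \<and> second_countable (mtop M) \<and>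
     (\<forall>c\<in>atlas M. openin (mtop M) (fst c) \<and> open (snd c ` fst c) \<and>
        homeomorphic_map (subtopology (mtop M) (fst c)) (top_of_set (snd c ` fst c)) (snd c)) \<and>
     (\<Union>c\<in>atlas M. fst c) = points M \<and>
     (\<forall>c\<in>atlas M. \<forall>d\<in>atlas M. smooth_on (snd c ` (fst c \<inter> fst d)) (snd d \<circ> chart_inv c))"

text \<open>A preferred chart is fixed around every point \<open>p\<close>. The tangent space at
  \<open>p\<close> is the model space \<^typ>\<open>'e\<close>: a vector stands for the tangent vector
  having these components in the preferred chart at \<open>p\<close>. Components in any other
  chart are obtained through the Jacobian of the transition map, and all notions below that
  compare different points (smoothness, derivatives, brackets) pass to components in one chart.\<close>

definition chart_at :: "('a, 'e, 'x) mfd_scheme \<Rightarrow> 'a \<Rightarrow> 'a set \<times> ('a \<Rightarrow> 'e)" where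
  "chart_at M p = (SOME c. c \<in> atlas M \<and> p \<in> fst c)"

definition coords_at :: "('a, 'e, 'x) mfd_scheme \<Rightarrow> 'a \<Rightarrow> 'e" where
  "coords_at M p = snd (chart_at M p) p"

definition smooth_map ::
  "('a, 'e::euclidean_space, 'x) mfd_scheme \<Rightarrow> ('b, 'f::euclidean_space, 'y) mfd_scheme \<Rightarrow> ('a \<Rightarrow> 'b) \<Rightarrow> bool"
  where
  "smooth_map M N f \<longleftrightarrow> continuous_map (mtop M) (mtop N) f \<and>
     (\<forall>c\<in>atlas M. \<forall>d\<in>atlas N. smooth_on (snd c ` (fst c \<inter> f -` fst d)) (snd d \<circ> f \<circ> chart_inv c))"

text \<open>The differential \<open>T\<^sub>pM \<rightarrow> T\<^sub>f\<^sub>pN\<close>, and for real functions the derivative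
  \<open>v(f)\<close> along a tangent vector \<open>v\<close> at \<open>p\<close>.\<close>

definition differential ::
  "('a, 'e::euclidean_space, 'x) mfd_scheme \<Rightarrow> ('b, 'f::euclidean_space, 'y) mfd_scheme \<Rightarrow> ('a \<Rightarrow> 'b)
     \<Rightarrow> 'a \<Rightarrow> 'e \<Rightarrow> 'f" where
  "differential M N f p =
     frechet_derivative (snd (chart_at N (f p)) \<circ> f \<circ> chart_inv (chart_at M p)) (at (coords_at M p))"

definition deriv_along :: "('a, 'e::euclidean_space, 'x) mfd_scheme \<Rightarrow> 'a \<Rightarrow> 'e \<Rightarrow> ('a \<Rightarrow> real) \<Rightarrow> real" where
  "deriv_along M p v f = frechet_derivative (f \<circ> chart_inv (chart_at M p)) (at (coords_at M p)) v"

definition smooth_fun_on :: "('a, 'e::euclidean_space, 'x) mfd_scheme \<Rightarrow> 'a set \<Rightarrow> ('a \<Rightarrow> real) \<Rightarrow> bool" where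
  "smooth_fun_on M W f \<longleftrightarrow> (\<forall>c\<in>atlas M. smooth_on (snd c ` (fst c \<inter> W)) (f \<circ> chart_inv c))"

definition smooth_fun_near :: "('a, 'e::euclidean_space, 'x) mfd_scheme \<Rightarrow> 'a \<Rightarrow> ('a \<Rightarrow> real) \<Rightarrow> bool" where
  "smooth_fun_near M p f \<longleftrightarrow> (\<exists>W. openin (mtop M) W \<and> p \<in> W \<and> smooth_fun_on M W f)"

section \<open>Vector fields and tensor fields\<close>

definition components ::
  "('a, 'e::euclidean_space, 'x) mfd_scheme \<Rightarrow> 'a set \<times> ('a \<Rightarrow> 'e) \<Rightarrow> 'a \<Rightarrow> 'e \<Rightarrow> 'e" where
  "components M c p v = frechet_derivative (snd c \<circ> chart_inv (chart_at M p)) (at (coords_at M p)) v"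

definition local_rep ::
  "('a, 'e::euclidean_space, 'x) mfd_scheme \<Rightarrow> 'a set \<times> ('a \<Rightarrow> 'e) \<Rightarrow> ('a \<Rightarrow> 'e) \<Rightarrow> 'e \<Rightarrow> 'e" where
  "local_rep M c X x = components M c (chart_inv c x) (X (chart_inv c x))"

definition smooth_vf_on :: "('a, 'e::euclidean_space, 'x) mfd_scheme \<Rightarrow> 'a set \<Rightarrow> ('a \<Rightarrow> 'e) \<Rightarrow> bool" where
  "smooth_vf_on M W X \<longleftrightarrow> (\<forall>c\<in>atlas M. smooth_on (snd c ` (fst c \<inter> W)) (local_rep M c X))"

definition smooth_vf_near :: "('a, 'e::euclidean_space, 'x) mfd_scheme \<Rightarrow> 'a \<Rightarrow> ('a \<Rightarrow> 'e) \<Rightarrow> bool" where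
  "smooth_vf_near M p X \<longleftrightarrow> (\<exists>W. openin (mtop M) W \<and> p \<in> W \<and> smooth_vf_on M W X)"

text \<open>\<open>[X,Y]\<^sup>i = X\<^sup>j \<partial>\<^sub>j Y\<^sup>i - Y\<^sup>j \<partial>\<^sub>j X\<^sup>i\<close>, evaluated in the preferred chart at \<open>p\<close>.\<close>

definition lie_bracket ::
  "('a, 'e::euclidean_space, 'x) mfd_scheme \<Rightarrow> ('a \<Rightarrow> 'e) \<Rightarrow> ('a \<Rightarrow> 'e) \<Rightarrow> 'a \<Rightarrow> 'e" where
  "lie_bracket M X Y p =
     frechet_derivative (local_rep M (chart_at M p) Y) (at (coords_at M p)) (X p)
   - frechet_derivative (local_rep M (chart_at M p) X) (at (coords_at M p)) (Y p)"

text \<open>The local vector field with constant components \<open>w\<close> in the preferred chart at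
  \<open>p\<close>. It takes the value \<open>w\<close> at \<open>p\<close>, and serves to evaluate tensorial expressions on
  tangent vectors.\<close>

definition extend_vf :: "('a, 'e::euclidean_space, 'x) mfd_scheme \<Rightarrow> 'a \<Rightarrow> 'e \<Rightarrow> 'a \<Rightarrow> 'e" where
  "extend_vf M p w q =
     frechet_derivative (snd (chart_at M q) \<circ> chart_inv (chart_at M p)) (at (snd (chart_at M p) q)) w"

definition smooth_one_form :: "('a, 'e::euclidean_space, 'x) mfd_scheme \<Rightarrow> ('a \<Rightarrow> 'e \<Rightarrow> real) \<Rightarrow> bool" where
  "smooth_one_form M \<alpha> \<longleftrightarrow> (\<forall>p\<in>points M. linear (\<alpha> p)) \<and>
     (\<forall>W X. openin (mtop M) W \<longrightarrow> smooth_vf_on M W X \<longrightarrow> smooth_fun_on M W (\<lambda>p. \<alpha> p (X p)))"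

definition smooth_endo :: "('a, 'e::euclidean_space, 'x) mfd_scheme \<Rightarrow> ('a \<Rightarrow> 'e \<Rightarrow> 'e) \<Rightarrow> bool" where
  "smooth_endo M T \<longleftrightarrow> (\<forall>p\<in>points M. linear (T p)) \<and>
     (\<forall>W X. openin (mtop M) W \<longrightarrow> smooth_vf_on M W X \<longrightarrow> smooth_vf_on M W (\<lambda>p. T p (X p)))"

text \<open>Exterior calculus convention: no numerical factors, i.e.
  \<open>(\<alpha> \<and> \<beta>)(u,v,w) = \<alpha>(u)\<beta>(v,w) + \<alpha>(v)\<beta>(w,u) + \<alpha>(w)\<beta>(u,v)\<close>
  and the corresponding \<open>d\<close>. In the convention with factors \<open>1/3\<close> both sides of
  \<open>d\<beta> = c \<alpha> \<and> \<beta>\<close> are rescaled equally.\<close>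

definition wedge12 ::
  "('a \<Rightarrow> 'e \<Rightarrow> real) \<Rightarrow> ('a \<Rightarrow> 'e \<Rightarrow> 'e \<Rightarrow> real) \<Rightarrow> 'a \<Rightarrow> 'e \<Rightarrow> 'e \<Rightarrow> 'e \<Rightarrow> real" where
  "wedge12 \<alpha> \<beta> p u v w = \<alpha> p u * \<beta> p v w + \<alpha> p v * \<beta> p w u + \<alpha> p w * \<beta> p u v"

definition ext_deriv2 ::
  "('a, 'e::euclidean_space, 'x) mfd_scheme \<Rightarrow> ('a \<Rightarrow> 'e \<Rightarrow> 'e \<Rightarrow> real)
     \<Rightarrow> ('a \<Rightarrow> 'e) \<Rightarrow> ('a \<Rightarrow> 'e) \<Rightarrow> ('a \<Rightarrow> 'e) \<Rightarrow> 'a \<Rightarrow> real" where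
  "ext_deriv2 M \<beta> X Y Z p =
     deriv_along M p (X p) (\<lambda>q. \<beta> q (Y q) (Z q))
   + deriv_along M p (Y p) (\<lambda>q. \<beta> q (Z q) (X q))
   + deriv_along M p (Z p) (\<lambda>q. \<beta> q (X q) (Y q))
   - \<beta> p (lie_bracket M X Y p) (Z p)
   - \<beta> p (lie_bracket M Y Z p) (X p)
   - \<beta> p (lie_bracket M Z X p) (Y p)"

text \<open>\<open>d\<beta> = \<tau>\<close> for a 2-form \<open>\<beta>\<close> and a 3-form \<open>\<tau>\<close>.\<close>

definition ext_deriv2_eq ::
  "('a, 'e::euclidean_space, 'x) mfd_scheme \<Rightarrow> ('a \<Rightarrow> 'e \<Rightarrow> 'e \<Rightarrow> real)
     \<Rightarrow> ('a \<Rightarrow> 'e \<Rightarrow> 'e \<Rightarrow> 'e \<Rightarrow> real) \<Rightarrow> bool" where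
  "ext_deriv2_eq M \<beta> \<tau> \<longleftrightarrow>
     (\<forall>p\<in>points M. \<forall>X Y Z. smooth_vf_near M p X \<longrightarrow> smooth_vf_near M p Y \<longrightarrow> smooth_vf_near M p Z \<longrightarrow>
        ext_deriv2 M \<beta> X Y Z p = \<tau> p (X p) (Y p) (Z p))"

section \<open>Riemannian manifolds and the Levi-Civita connection\<close>

record ('a, 'e) riem = "('a, 'e) mfd" +
  met :: "'a \<Rightarrow> 'e \<Rightarrow> 'e \<Rightarrow> real"

definition riemannian_manifold :: "('a, 'e::euclidean_space, 'x) riem_scheme \<Rightarrow> bool" where
  "riemannian_manifold M \<longleftrightarrow> smooth_manifold M \<and>
     (\<forall>p\<in>points M. (\<forall>u. linear (met M p u)) \<and> (\<forall>u v. met M p u v = met M p v u) \<and>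
        (\<forall>u. u \<noteq> 0 \<longrightarrow> met M p u u > 0)) \<and>
     (\<forall>W X Y. openin (mtop M) W \<longrightarrow> smooth_vf_on M W X \<longrightarrow> smooth_vf_on M W Y \<longrightarrow>
        smooth_fun_on M W (\<lambda>p. met M p (X p) (Y p)))"

text \<open>\<open>D p v Y\<close> is the covariant derivative at \<open>p\<close> along the tangent vector \<open>v\<close> of a vector
  field \<open>Y\<close> that is smooth near \<open>p\<close>. Nothing is said about other arguments. The Leibniz rule is
  required for functions that are smooth merely near \<open>p\<close>, which makes \<open>D p v Y\<close> depend
  only on the germ of \<open>Y\<close> at \<open>p\<close>.\<close>

definition affine_connection ::
  "('a, 'e::euclidean_space, 'x) mfd_scheme \<Rightarrow> ('a \<Rightarrow> 'e \<Rightarrow> ('a \<Rightarrow> 'e) \<Rightarrow> 'e) \<Rightarrow> bool" where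
  "affine_connection M D \<longleftrightarrow>
     (\<forall>p\<in>points M. \<forall>Y. smooth_vf_near M p Y \<longrightarrow> linear (\<lambda>v. D p v Y)) \<and>
     (\<forall>p\<in>points M. \<forall>v Y Z. smooth_vf_near M p Y \<longrightarrow> smooth_vf_near M p Z \<longrightarrow>
        D p v (\<lambda>q. Y q + Z q) = D p v Y + D p v Z) \<and>
     (\<forall>p\<in>points M. \<forall>v f Y. smooth_fun_near M p f \<longrightarrow> smooth_vf_near M p Y \<longrightarrow>
        D p v (\<lambda>q. f q *\<^sub>R Y q) = deriv_along M p v f *\<^sub>R Y p + f p *\<^sub>R D p v Y) \<and>
     (\<forall>W X Y. openin (mtop M) W \<longrightarrow> smooth_vf_on M W X \<longrightarrow> smooth_vf_on M W Y \<longrightarrow>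
        smooth_vf_on M W (\<lambda>p. D p (X p) Y))"

definition levi_civita ::
  "('a, 'e::euclidean_space, 'x) riem_scheme \<Rightarrow> ('a \<Rightarrow> 'e \<Rightarrow> ('a \<Rightarrow> 'e) \<Rightarrow> 'e) \<Rightarrow> bool" where
  "levi_civita M D \<longleftrightarrow> affine_connection M D \<and>
     (\<forall>p\<in>points M. \<forall>v Y Z. smooth_vf_near M p Y \<longrightarrow> smooth_vf_near M p Z \<longrightarrow>
        deriv_along M p v (\<lambda>q. met M q (Y q) (Z q)) = met M p (D p v Y) (Z p) + met M p (Y p) (D p v Z)) \<and>
     (\<forall>p\<in>points M. \<forall>X Y. smooth_vf_near M p X \<longrightarrow> smooth_vf_near M p Y \<longrightarrow>
        D p (X p) Y - D p (Y p) X = lie_bracket M X Y p)"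

text \<open>\<open>(\<nabla>\<^sub>v\<alpha>)(w)\<close> and \<open>(\<nabla>\<^sub>v\<beta>)(w,z)\<close> for tangent vectors at \<open>p\<close>; the values do not depend
  on the vector fields used to extend \<open>w\<close> and \<open>z\<close>.\<close>

definition nabla_form1 ::
  "('a, 'e::euclidean_space, 'x) mfd_scheme \<Rightarrow> ('a \<Rightarrow> 'e \<Rightarrow> ('a \<Rightarrow> 'e) \<Rightarrow> 'e)
     \<Rightarrow> ('a \<Rightarrow> 'e \<Rightarrow> real) \<Rightarrow> 'a \<Rightarrow> 'e \<Rightarrow> 'e \<Rightarrow> real" where
  "nabla_form1 M D \<alpha> p v w =
     (let Y = extend_vf M p w in deriv_along M p v (\<lambda>q. \<alpha> q (Y q)) - \<alpha> p (D p v Y))"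

definition nabla_form2 ::
  "('a, 'e::euclidean_space, 'x) mfd_scheme \<Rightarrow> ('a \<Rightarrow> 'e \<Rightarrow> ('a \<Rightarrow> 'e) \<Rightarrow> 'e)
     \<Rightarrow> ('a \<Rightarrow> 'e \<Rightarrow> 'e \<Rightarrow> real) \<Rightarrow> 'a \<Rightarrow> 'e \<Rightarrow> 'e \<Rightarrow> 'e \<Rightarrow> real" where
  "nabla_form2 M D \<beta> p v w z =
     (let Y = extend_vf M p w; Z = extend_vf M p z in
        deriv_along M p v (\<lambda>q. \<beta> q (Y q) (Z q)) - \<beta> p (D p v Y) z - \<beta> p w (D p v Z))"

definition orthonormal_basis :: "('e::euclidean_space \<Rightarrow> 'e \<Rightarrow> real) \<Rightarrow> 'e set \<Rightarrow> bool" where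
  "orthonormal_basis g B \<longleftrightarrow> span B = UNIV \<and> (\<forall>u\<in>B. \<forall>v\<in>B. g u v = (if u = v then 1 else 0))"

text \<open>As \<open>\<nabla>\<alpha>\<close> and \<open>\<nabla>\<beta>\<close> are tensors, only the values at \<open>p\<close> of a local orthonormal
  frame enter the codifferentials, i.e. an orthonormal basis of the tangent space at \<open>p\<close>.\<close>

definition frame_at :: "('a, 'e::euclidean_space, 'x) riem_scheme \<Rightarrow> 'a \<Rightarrow> 'e set" where
  "frame_at M p = (SOME B. orthonormal_basis (met M p) B)"

definition codiff1 ::
  "('a, 'e::euclidean_space, 'x) riem_scheme \<Rightarrow> ('a \<Rightarrow> 'e \<Rightarrow> ('a \<Rightarrow> 'e) \<Rightarrow> 'e)
     \<Rightarrow> ('a \<Rightarrow> 'e \<Rightarrow> real) \<Rightarrow> 'a \<Rightarrow> real" where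
  "codiff1 M D \<alpha> p = - (\<Sum>e\<in>frame_at M p. nabla_form1 M D \<alpha> p e e)"

definition codiff2 ::
  "('a, 'e::euclidean_space, 'x) riem_scheme \<Rightarrow> ('a \<Rightarrow> 'e \<Rightarrow> ('a \<Rightarrow> 'e) \<Rightarrow> 'e)
     \<Rightarrow> ('a \<Rightarrow> 'e \<Rightarrow> 'e \<Rightarrow> real) \<Rightarrow> 'a \<Rightarrow> 'e \<Rightarrow> real" where
  "codiff2 M D \<beta> p u = - (\<Sum>e\<in>frame_at M p. nabla_form2 M D \<beta> p e e u)"

section \<open>Almost contact metric and almost Hermitian manifolds\<close>

record ('a, 'e) acm = "('a, 'e) riem" +
  acm_phi :: "'a \<Rightarrow> 'e \<Rightarrow> 'e"
  acm_xi :: "'a \<Rightarrow> 'e"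
  acm_eta :: "'a \<Rightarrow> 'e \<Rightarrow> real"

definition acm_manifold :: "('a, 'e::euclidean_space, 'x) acm_scheme \<Rightarrow> bool" where
  "acm_manifold M \<longleftrightarrow> odd DIM('e) \<and> riemannian_manifold M \<and>
     smooth_endo M (acm_phi M) \<and> smooth_vf_on M (points M) (acm_xi M) \<and> smooth_one_form M (acm_eta M) \<and>
     (\<forall>p\<in>points M.
        (\<forall>u. acm_phi M p (acm_phi M p u) = - u + acm_eta M p u *\<^sub>R acm_xi M p) \<and>
        acm_eta M p (acm_xi M p) = 1 \<and>
        (\<forall>u v. met M p (acm_phi M p u) (acm_phi M p v) = met M p u v - acm_eta M p u * acm_eta M p v))"

definition fundamental_form :: "('a, 'e, 'x) acm_scheme \<Rightarrow> 'a \<Rightarrow> 'e \<Rightarrow> 'e \<Rightarrow> real" where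
  "fundamental_form M p u v = met M p u (acm_phi M p v)"

text \<open>The Lee form with respect to the Levi-Civita connection \<open>D\<close>, for \<open>DIM('e) = 2 * m + 1\<close>.\<close>

definition lee_form ::
  "('a, 'e::euclidean_space, 'x) acm_scheme \<Rightarrow> ('a \<Rightarrow> 'e \<Rightarrow> ('a \<Rightarrow> 'e) \<Rightarrow> 'e) \<Rightarrow> 'a \<Rightarrow> 'e \<Rightarrow> real" where
  "lee_form M D p u =
     (let m = (DIM('e) - 1) div 2;
          \<delta>\<eta> = codiff1 M D (acm_eta M) p;
          nabla_\<xi>_\<eta> = nabla_form1 M D (acm_eta M) p (acm_xi M p) in
      if m = 1 then nabla_\<xi>_\<eta> u + \<delta>\<eta> / 2 * acm_eta M p u
      else - 1 / (2 * (real m - 1)) * (codiff2 M D (fundamental_form M) p (acm_phi M p u) + nabla_\<xi>_\<eta> u)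
           + \<delta>\<eta> / (2 * real m) * acm_eta M p u)"

record ('a, 'e) hermitian = "('a, 'e) riem" +
  cplx :: "'a \<Rightarrow> 'e \<Rightarrow> 'e"

definition almost_hermitian_manifold :: "('a, 'e::euclidean_space, 'x) hermitian_scheme \<Rightarrow> bool" where
  "almost_hermitian_manifold N \<longleftrightarrow> riemannian_manifold N \<and> smooth_endo N (cplx N) \<and>
     (\<forall>p\<in>points N. (\<forall>u. cplx N p (cplx N p u) = - u) \<and>
        (\<forall>u v. met N p (cplx N p u) (cplx N p v) = met N p u v))"

section \<open>Submersions and their fibres\<close>

definition riemannian_submersion ::
  "('a, 'e::euclidean_space, 'x) riem_scheme \<Rightarrow> ('b, 'f::euclidean_space, 'y) riem_scheme \<Rightarrow> ('a \<Rightarrow> 'b) \<Rightarrow> bool"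
  where
  "riemannian_submersion M N f \<longleftrightarrow>
     riemannian_manifold M \<and> riemannian_manifold N \<and> smooth_map M N f \<and> f ` points M = points N \<and>
     (\<forall>p\<in>points M. surj (differential M N f p) \<and>
        (let vert = {u. differential M N f p u = 0}; hor = {u. \<forall>v\<in>vert. met M p u v = 0} in
         \<forall>u\<in>hor. \<forall>v\<in>hor. met N (f p) (differential M N f p u) (differential M N f p v) = met M p u v))"

definition contact_complex_submersion ::
  "('a, 'e::euclidean_space, 'x) acm_scheme \<Rightarrow> ('b, 'f::euclidean_space, 'y) hermitian_scheme \<Rightarrow> ('a \<Rightarrow> 'b) \<Rightarrow> bool"
  where
  "contact_complex_submersion M N f \<longleftrightarrow>
     acm_manifold M \<and> almost_hermitian_manifold N \<and> riemannian_submersion M N f \<and>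
     (\<forall>p\<in>points M. \<forall>u. cplx N (f p) (differential M N f p u) = differential M N f p (acm_phi M p u))"

definition embedded_submanifold ::
  "('a, 'h::euclidean_space, 'x) mfd_scheme \<Rightarrow> ('a, 'e::euclidean_space, 'y) mfd_scheme \<Rightarrow> bool" where
  "embedded_submanifold F M \<longleftrightarrow> smooth_manifold F \<and>
     points F \<subseteq> points M \<and> mtop F = subtopology (mtop M) (points F) \<and>
     smooth_map F M (\<lambda>p. p) \<and> (\<forall>p\<in>points F. inj (differential F M (\<lambda>p. p) p))"

text \<open>\<open>F\<close> is the fibre over \<open>q\<close>, as an embedded submanifold. By the regular value theorem
  and uniqueness of embedded submanifold structures, \<open>F\<close> is determined by \<open>f\<close> and \<open>q\<close>
  up to the choice of an atlas (within the maximal one).\<close>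

definition is_fibre ::
  "('a, 'e::euclidean_space, 'x) mfd_scheme \<Rightarrow> ('b, 'f, 'y) mfd_scheme \<Rightarrow> ('a \<Rightarrow> 'b) \<Rightarrow> 'b
     \<Rightarrow> ('a, 'h::euclidean_space, 'z) mfd_scheme \<Rightarrow> bool" where
  "is_fibre M N f q F \<longleftrightarrow>
     q \<in> points N \<and> points F = {p \<in> points M. f p = q} \<and> embedded_submanifold F M"

definition restrict_form1 ::
  "('a, 'h::euclidean_space, 'x) mfd_scheme \<Rightarrow> ('a, 'e::euclidean_space, 'y) mfd_scheme
     \<Rightarrow> ('a \<Rightarrow> 'e \<Rightarrow> real) \<Rightarrow> 'a \<Rightarrow> 'h \<Rightarrow> real" where
  "restrict_form1 F M \<alpha> p u = \<alpha> p (differential F M (\<lambda>p. p) p u)"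

text \<open>The structure induced by \<open>M\<close> on a submanifold \<open>F\<close> to which \<open>\<xi>\<close> is tangent and whose
  tangent spaces are preserved by \<open>\<phi>\<close>. Tangent vectors of \<open>F\<close> are viewed as tangent vectors
  of \<open>M\<close> through the differential of the inclusion.\<close>

definition induced_acm ::
  "('a, 'e::euclidean_space, 'x) acm_scheme \<Rightarrow> ('a, 'h::euclidean_space) mfd \<Rightarrow> ('a, 'h) acm" where
  "induced_acm M F =
     (let \<iota> = differential F M (\<lambda>p. p) in
      \<lparr> mtop = mtop F, atlas = atlas F,
        met = (\<lambda>p u v. met M p (\<iota> p u) (\<iota> p v)),
        acm_phi = (\<lambda>p u. THE w. \<iota> p w = acm_phi M p (\<iota> p u)),
        acm_xi = (\<lambda>p. THE w. \<iota> p w = acm_xi M p),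
        acm_eta = restrict_form1 F M (acm_eta M) \<rparr>)"

end

theory Submission
  imports Defs
begin

text \<open>
  The proof rests on a fact about a single almost contact metric manifold: if \<open>d\<phi> = - 2 \<alpha> \<and> \<phi>\<close> for
  a 1-form \<open>\<alpha>\<close> in dimension \<open>2m + 1\<close>, then \<open>\<delta>\<eta> = 2m \<alpha>(\<xi>)\<close>, and for \<open>m \<ge> 2\<close> the form \<open>\<alpha>\<close> is the Lee form.
  Here \<open>d\<phi>\<close> is the cyclic sum of \<open>\<nabla>\<phi>\<close>. Contracting the equation over pairs \<open>(e, \<phi> e)\<close> of an orthonormal
  basis, and using the derivative of \<open>\<phi>\<^sup>2 = - I + \<eta> \<otimes> \<xi>\<close>, gives
  \<open>2 (m - 1) \<alpha>(X) + 2 \<eta>(X) \<alpha>(\<xi>) = - \<delta>\<phi>(\<phi> X) - (\<nabla>\<^sub>\<xi>\<eta>) X + \<eta>(X) \<delta>\<eta>\<close>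
  (\<open>contraction_of_fundamental_equation\<close>, \<open>lee_contraction\<close>); \<open>X = \<xi>\<close> gives the first claim and the rest follows
  (\<open>codiff_\<eta>\<close>, \<open>lee_form_eq\<close>).

  On a fibre the equation holds with \<open>\<alpha> = \<omega>|\<^sub>T\<^sub>F\<close>, since the exterior derivative commutes with pull-back
  (\<open>coord_ext_deriv2_pullback\<close>). So everything reduces to \<open>\<omega>(\<xi>) = 0\<close>. For this the fundamental form is
  compared with the pull-back of the 2-form \<open>g'(\<cdot>, J \<cdot>)\<close> of the base. Their difference depends on vertical
  parts only, hence vanishes to second order on horizontal vectors and on \<open>\<xi>\<close>
  (\<open>abs_fundamental_diff_le\<close>, \<open>deriv_fundamental_form_eq\<close>). As \<open>\<xi>\<close> is vertical, \<open>d\<phi>(\<xi>, v, w) = 0\<close> for horizontal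
  \<open>v\<close> and \<open>w\<close>, that is \<open>\<omega>(\<xi>) \<phi>(v, w) = 0\<close>, and \<open>\<phi>(v, w) \<noteq> 0\<close> for a suitable pair
  (\<open>factor_of_fundamental_form_\<xi>\<close>). For \<open>r = 1\<close> the Lee form of the fibre is then \<open>\<nabla>\<^sub>\<xi>\<eta>\<close>, which equals
  \<open>d\<eta>(\<xi>, \<cdot>)\<close> and is therefore compatible with restriction (\<open>nabla_\<xi>_\<eta>_induced\<close>).

  Two devices keep the analysis elementary. All derivatives at \<open>p\<close> are taken along the fields \<open>extend_vf M p v\<close>
  with constant coordinates, whose brackets vanish. And the pointwise identities of the structure
  are never differentiated through \<open>\<phi>\<close> or \<open>\<xi>\<close> themselves, but by observing that some squared length,
  expressed by the forms \<open>g\<close>, \<open>\<phi>\<close> and \<open>\<eta>\<close>, attains the minimum \<open>0\<close> at \<open>p\<close>, so that its derivative vanishes.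
\<close>

section \<open>Calculus of \<open>C\<^sup>k\<close> maps\<close>

lemma Ck_on_subset: "Ck_on k S f \<Longrightarrow> T \<subseteq> S \<Longrightarrow> Ck_on k T f"
  by (induction k arbitrary: f) (auto intro: continuous_on_subset)

lemma Ck_on_cong:
  assumes "open S" "\<And>x. x \<in> S \<Longrightarrow> f x = g x"
  shows "Ck_on k S f \<longleftrightarrow> Ck_on k S g"
  using assms(2)
proof (induction k arbitrary: f g)
  case 0
  then show ?case by (simp cong: continuous_on_cong)
next
  case (Suc k)
  have D: "(f has_derivative L) (at x) \<longleftrightarrow> (g has_derivative L) (at x)" if "x \<in> S" for x L
    using that Suc.prems has_derivative_transform_within_open[OF _ assms(1) that, of _ L] by metis
  then have "frechet_derivative f (at x) = frechet_derivative g (at x)" if "x \<in> S" for x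
    using that by (simp add: frechet_derivative_def)
  then have "Ck_on k S (\<lambda>x. frechet_derivative f (at x) v) \<longleftrightarrow> Ck_on k S (\<lambda>x. frechet_derivative g (at x) v)" for v
    by (intro Suc.IH) simp
  then show ?case
    using D by (auto simp: differentiable_def)
qed

lemma Ck_on_Suc_lower: "Ck_on (Suc k) S f \<Longrightarrow> Ck_on k S f"
proof (induction k arbitrary: f)
  case 0
  then show ?case
    by (auto intro!: continuous_at_imp_continuous_on differentiable_imp_continuous_within)
next
  case (Suc k)
  then show ?case by (metis Ck_on.simps(2))
qed

lemma Ck_on_const: "Ck_on k S (\<lambda>_. c)"
  by (induction k arbitrary: c) auto

lemma Ck_on_Suc_intro:
  assumes "open S"
    and D: "\<And>x. x \<in> S \<Longrightarrow> (f has_derivative f' x) (at x)"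
    and C: "\<And>v. Ck_on k S (\<lambda>x. f' x v)"
  shows "Ck_on (Suc k) S f"
proof -
  have "frechet_derivative f (at x) = f' x" if "x \<in> S" for x
    using frechet_derivative_at[OF D[OF that]] by simp
  then have "Ck_on k S (\<lambda>x. frechet_derivative f (at x) v)" for v
    using C[of v] by (subst Ck_on_cong[OF assms(1), where g = "\<lambda>x. f' x v"]) auto
  then show ?thesis
    using D by (auto simp: differentiable_def)
qed

lemma Ck_on_SucD:
  assumes "Ck_on (Suc k) S f" 
  shows "x \<in> S \<Longrightarrow> (f has_derivative frechet_derivative f (at x)) (at x)"
    and "Ck_on k S (\<lambda>x. frechet_derivative f (at x) v)"
  using assms by (auto dest: frechet_derivative_works[THEN iffD1])

lemma Ck_on_add:
  assumes "open S" "Ck_on k S f" "Ck_on k S g"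
  shows "Ck_on k S (\<lambda>x. f x + g x)"
  using assms(2,3)
proof (induction k arbitrary: f g)
  case 0
  then show ?case by (auto intro: continuous_intros)
next
  case (Suc k)
  show ?case
    by (rule Ck_on_Suc_intro[OF assms(1) has_derivative_add[OF Ck_on_SucD(1)[OF Suc.prems(1)] Ck_on_SucD(1)[OF Suc.prems(2)]]])
      (auto intro!: Suc.IH Ck_on_SucD(2) Suc.prems)
qed

lemma Ck_on_sum:
  assumes "open S" "finite I" "\<And>i. i \<in> I \<Longrightarrow> Ck_on k S (f i)"
  shows "Ck_on k S (\<lambda>x. \<Sum>i\<in>I. f i x)"
  using assms(2,3)
  by (induction I) (auto intro!: Ck_on_const Ck_on_add[OF assms(1)])

lemma Ck_on_scaleR:
  assumes "open S" "Ck_on k S f" "Ck_on k S g"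
  shows "Ck_on k S (\<lambda>x. f x *\<^sub>R g x)"
  using assms(2,3)
proof (induction k arbitrary: f g)
  case 0
  then show ?case by (auto intro: continuous_intros)
next
  case (Suc k)
  show ?case
    by (rule Ck_on_Suc_intro[OF assms(1) has_derivative_scaleR[OF Ck_on_SucD(1)[OF Suc.prems(1)] Ck_on_SucD(1)[OF Suc.prems(2)]]])
      (assumption, assumption, intro Ck_on_add[OF assms(1)] Suc.IH Ck_on_SucD(2)[OF Suc.prems(1)] Ck_on_SucD(2)[OF Suc.prems(2)]
        Ck_on_Suc_lower[OF Suc.prems(1)] Ck_on_Suc_lower[OF Suc.prems(2)])
qed

lemma Ck_on_bounded_linear:
  assumes "open S" "bounded_linear L" "Ck_on k S f"
  shows "Ck_on k S (\<lambda>x. L (f x))"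
  using assms(3)
proof (induction k arbitrary: f)
  case 0
  then show ?case using assms(2) by (simp add: bounded_linear.continuous_on)
next
  case (Suc k)
  show ?case
    by (rule Ck_on_Suc_intro[OF assms(1) bounded_linear.has_derivative[OF assms(2) Ck_on_SucD(1)[OF Suc.prems(1)]]])
      (auto intro!: Suc.IH Ck_on_SucD(2) Suc.prems)
qed

text \<open>The chain rule writes the derivative of the composition as a sum of products of directional
  derivatives, to which the induction hypothesis applies.\<close>

lemma Ck_on_compose:
  fixes f :: "'b::euclidean_space \<Rightarrow> 'c::real_normed_vector"
  assumes "open S" "open T" "g ` S \<subseteq> T" "Ck_on k T f" "Ck_on k S g"
  shows "Ck_on k S (\<lambda>x. f (g x))"
  using assms(4,5)
proof (induction k arbitrary: f)
  case 0
  then show ?case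
    using assms(3) by (auto intro: continuous_on_compose2)
next
  case (Suc k)
  let ?f' = "\<lambda>x. frechet_derivative f (at x)" and ?g' = "\<lambda>x. frechet_derivative g (at x)"
  have gT: "g x \<in> T" if "x \<in> S" for x using that assms(3) by auto
  have chain: "((\<lambda>x. f (g x)) has_derivative (\<lambda>v. \<Sum>i\<in>Basis. (?g' x v \<bullet> i) *\<^sub>R ?f' (g x) i)) (at x)"
    if "x \<in> S" for x
  proof -
    have f: "(f has_derivative ?f' (g x)) (at (g x))"
      using Ck_on_SucD(1)[OF Suc.prems(1) gT[OF that]] .
    have 1: "((\<lambda>x. f (g x)) has_derivative (\<lambda>v. ?f' (g x) (?g' x v))) (at x)"
      using has_derivative_compose[OF Ck_on_SucD(1)[OF Suc.prems(2) that] f] .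
    have 2: "?f' (g x) w = (\<Sum>i\<in>Basis. (w \<bullet> i) *\<^sub>R ?f' (g x) i)" for w
    proof -
      have lin: "linear (?f' (g x))" using f by (rule has_derivative_linear)
      have "?f' (g x) w = ?f' (g x) (\<Sum>i\<in>Basis. (w \<bullet> i) *\<^sub>R i)"
        by (simp only: euclidean_representation)
      then show ?thesis
        by (simp only: linear_sum[OF lin] linear_scale[OF lin])
    qed
    show ?thesis by (rule has_derivative_eq_rhs[OF 1]) (rule ext, rule 2)
  qed
  have f': "Ck_on k S (\<lambda>x. ?f' (g x) i)" for i
    by (rule Suc.IH[OF Ck_on_SucD(2)[OF Suc.prems(1)] Ck_on_Suc_lower[OF Suc.prems(2)]])
  have g': "Ck_on k S (\<lambda>x. ?g' x v \<bullet> i)" for v i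
    by (rule Ck_on_bounded_linear[OF assms(1) bounded_linear_inner_left Ck_on_SucD(2)[OF Suc.prems(2)]])
  show ?case
    by (rule Ck_on_Suc_intro[OF assms(1) chain]) (assumption, intro Ck_on_sum assms(1) finite_Basis Ck_on_scaleR[OF assms(1) g' f'])
qed

lemma smooth_on_subset: "smooth_on S f \<Longrightarrow> T \<subseteq> S \<Longrightarrow> smooth_on T f"
  by (auto simp: smooth_on_def intro: Ck_on_subset)

lemma smooth_on_cong:
  assumes "open S" "\<And>x. x \<in> S \<Longrightarrow> f x = g x"
  shows "smooth_on S f \<longleftrightarrow> smooth_on S g"
  unfolding smooth_on_def using Ck_on_cong[of S f g, OF assms] by simp

lemma smooth_on_compose:
  fixes f :: "'b::euclidean_space \<Rightarrow> 'c::real_normed_vector"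
  assumes "open S" "open T" "g ` S \<subseteq> T" "smooth_on T f" "smooth_on S g"
  shows "smooth_on S (\<lambda>x. f (g x))"
  using assms Ck_on_compose unfolding smooth_on_def by blast

lemma smooth_on_frechet_derivative:
  "smooth_on S f \<Longrightarrow> smooth_on S (\<lambda>x. frechet_derivative f (at x) v)"
  unfolding smooth_on_def using Ck_on_SucD(2) by blast

lemma smooth_on_has_derivative:
  "smooth_on S f \<Longrightarrow> x \<in> S \<Longrightarrow> (f has_derivative frechet_derivative f (at x)) (at x)"
  unfolding smooth_on_def using Ck_on_SucD(1) by blast

lemma frechet_derivative_eqI: "(f has_derivative f') (at x) \<Longrightarrow> frechet_derivative f (at x) = f'"
  using frechet_derivative_at by metis

lemma frechet_derivative_cong_open:
  assumes "open S" "x \<in> S" "\<And>y. y \<in> S \<Longrightarrow> f y = g y"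
  shows "frechet_derivative f (at x) = frechet_derivative g (at x)"
proof -
  have "(f has_derivative L) (at x) \<longleftrightarrow> (g has_derivative L) (at x)" for L
    using assms has_derivative_transform_within_open[OF _ assms(1,2), of _ L] by metis
  then show ?thesis by (simp add: frechet_derivative_def)
qed

text \<open>The second difference of \<open>f\<close> along \<open>u\<close> and \<open>v\<close> is symmetric in \<open>u\<close> and \<open>v\<close>, and by the
  mean value theorem it equals \<open>t\<^sup>2\<close> times the iterated derivative up to \<open>o(t\<^sup>2)\<close>.\<close>

lemma second_difference_limit:
  fixes f :: "'a::euclidean_space \<Rightarrow> real"
  assumes "open S" "x \<in> S"
    and f: "\<And>y. y \<in> S \<Longrightarrow> (f has_derivative f' y) (at y)"
    and D: "((\<lambda>y. f' y u) has_derivative L) (at x)"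
  shows "((\<lambda>t. (f (x + t *\<^sub>R u + t *\<^sub>R v) - f (x + t *\<^sub>R u) - f (x + t *\<^sub>R v) + f x) / t\<^sup>2)
           \<longlongrightarrow> L v) (at_right 0)"
proof (rule tendstoI)
  fix e :: real assume "e > 0"
  define K where "K = 2 * norm u + norm v + 1"
  have "K > 0" by (simp add: K_def add_nonneg_pos)
  define e' where "e' = e / (2 * K)"
  have "e' > 0" using \<open>e > 0\<close> \<open>K > 0\<close> by (simp add: e'_def)
  obtain d where "d > 0" and d: "\<And>y. norm (y - x) < d \<Longrightarrow> \<bar>f' y u - f' x u - L (y - x)\<bar> \<le> e' * norm (y - x)"
    using D \<open>e' > 0\<close> unfolding has_derivative_at_alt by (metis real_norm_def)
  obtain r where "r > 0" and r: "ball x r \<subseteq> S"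
    using assms(1,2) openE by blast
  define T where "T = min d r / K"
  have "T > 0" using \<open>d > 0\<close> \<open>r > 0\<close> \<open>K > 0\<close> by (simp add: T_def)
  interpret L: linear L using D has_derivative_linear by blast
  have "dist ((f (x + t *\<^sub>R u + t *\<^sub>R v) - f (x + t *\<^sub>R u) - f (x + t *\<^sub>R v) + f x) / t\<^sup>2) (L v) < e"
    if t: "0 < t" "t < T" for t
  proof -
    have near: "norm (s *\<^sub>R u + c *\<^sub>R v) \<le> t * (norm u + norm v)" "norm (s *\<^sub>R u + c *\<^sub>R v) < min d r"
      if "0 \<le> s" "s \<le> t" "c = 0 \<or> c = t" for s c
    proof -
      have "norm (s *\<^sub>R u + c *\<^sub>R v) \<le> s * norm u + c * norm v"
        using that t norm_triangle_ineq[of "s *\<^sub>R u" "c *\<^sub>R v"] by auto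
      also have "\<dots> \<le> t * (norm u + norm v)"
        using that t by (auto simp: distrib_left intro!: add_mono mult_right_mono)
      finally show 1: "norm (s *\<^sub>R u + c *\<^sub>R v) \<le> t * (norm u + norm v)" .
      also have "\<dots> \<le> t * K" using t by (simp add: K_def)
      also have "\<dots> < min d r" using t \<open>K > 0\<close> by (simp add: T_def field_simps)
      finally show "norm (s *\<^sub>R u + c *\<^sub>R v) < min d r" .
    qed
    have inS: "x + s *\<^sub>R u + c *\<^sub>R v \<in> S" if "0 \<le> s" "s \<le> t" "c = 0 \<or> c = t" for s c
      using near(2)[OF that] r by (auto simp: dist_norm ball_def add.assoc norm_minus_commute)
    let ?g = "\<lambda>s. f (x + s *\<^sub>R u + t *\<^sub>R v) - f (x + s *\<^sub>R u + 0 *\<^sub>R v)"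
    let ?g' = "\<lambda>s. f' (x + s *\<^sub>R u + t *\<^sub>R v) u - f' (x + s *\<^sub>R u + 0 *\<^sub>R v) u"
    have "DERIV ?g s :> ?g' s" if "0 \<le> s" "s \<le> t" for s
    proof -
      have *: "DERIV (\<lambda>s. f (x + s *\<^sub>R u + c *\<^sub>R v)) s :> f' (x + s *\<^sub>R u + c *\<^sub>R v) u"
        if "c = 0 \<or> c = t" for c
      proof -
        have fc: "(f has_derivative f' (x + s *\<^sub>R u + c *\<^sub>R v)) (at (x + s *\<^sub>R u + c *\<^sub>R v))"
          using f inS \<open>0 \<le> s\<close> \<open>s \<le> t\<close> that by blast
        interpret F: linear "f' (x + s *\<^sub>R u + c *\<^sub>R v)" using fc has_derivative_linear by blast
        have "((\<lambda>s. f (x + s *\<^sub>R u + c *\<^sub>R v)) has_derivative (\<lambda>h. f' (x + s *\<^sub>R u + c *\<^sub>R v) (h *\<^sub>R u))) (at s)"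
          by (rule has_derivative_compose[where f = "\<lambda>s. x + s *\<^sub>R u + c *\<^sub>R v" and g = f, OF _ fc])
            (auto intro!: derivative_eq_intros)
        moreover have "(\<lambda>h. f' (x + s *\<^sub>R u + c *\<^sub>R v) (h *\<^sub>R u)) = (*) (f' (x + s *\<^sub>R u + c *\<^sub>R v) u)"
          by (simp add: F.scale fun_eq_iff)
        ultimately show ?thesis by (simp add: has_field_derivative_def)
      qed
      show ?thesis by (intro DERIV_diff * ) auto
    qed
    then obtain s where s: "0 < s" "s < t" "?g t - ?g 0 = (t - 0) * ?g' s"
      using MVT2[OF t(1), of ?g ?g'] by blast
    have b: "\<bar>f' (x + s *\<^sub>R u + c *\<^sub>R v) u - f' x u - L (s *\<^sub>R u + c *\<^sub>R v)\<bar> \<le> e' * (t * (norm u + norm v))"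
      if c: "c = 0 \<or> c = t" for c
    proof -
      have n: "norm (s *\<^sub>R u + c *\<^sub>R v) < d" "norm (s *\<^sub>R u + c *\<^sub>R v) \<le> t * (norm u + norm v)"
        using near[of s c] s c by auto
      show ?thesis
        using d[of "x + s *\<^sub>R u + c *\<^sub>R v"] n \<open>e' > 0\<close>
        by (smt (verit, best) add.assoc add_diff_cancel_left' mult_left_mono)
    qed
    have "L (s *\<^sub>R u + t *\<^sub>R v) - L (s *\<^sub>R u + 0 *\<^sub>R v) = t * L v"
      by (simp add: L.add L.scale)
    then have "\<bar>?g' s - t * L v\<bar> \<le> 2 * (e' * (t * (norm u + norm v)))"
      using b[of t] b[of 0] by linarith
    moreover have "(f (x + t *\<^sub>R u + t *\<^sub>R v) - f (x + t *\<^sub>R u) - f (x + t *\<^sub>R v) + f x) / t\<^sup>2 = ?g' s / t"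
    proof -
      have "f (x + t *\<^sub>R u + t *\<^sub>R v) - f (x + t *\<^sub>R u) - f (x + t *\<^sub>R v) + f x = t * ?g' s"
        using s(3) by simp
      then show ?thesis using t by (simp only: power2_eq_square) simp
    qed
    ultimately have "\<bar>(f (x + t *\<^sub>R u + t *\<^sub>R v) - f (x + t *\<^sub>R u) - f (x + t *\<^sub>R v) + f x) / t\<^sup>2 - L v\<bar>
        \<le> 2 * (e' * (norm u + norm v))"
    proof -
      assume 1: "\<bar>?g' s - t * L v\<bar> \<le> 2 * (e' * (t * (norm u + norm v)))"
        and 2: "(f (x + t *\<^sub>R u + t *\<^sub>R v) - f (x + t *\<^sub>R u) - f (x + t *\<^sub>R v) + f x) / t\<^sup>2 = ?g' s / t"
      have "?g' s / t - L v = (?g' s - t * L v) / t" using t by (simp add: field_simps)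
      then have "\<bar>?g' s / t - L v\<bar> = \<bar>?g' s - t * L v\<bar> / t" using t by simp
      also have "\<dots> \<le> 2 * (e' * (t * (norm u + norm v))) / t"
        by (rule divide_right_mono[OF 1]) (use t in simp)
      finally show ?thesis using t 2 by simp
    qed
    also have "\<dots> < 2 * (e' * K)"
      using \<open>e' > 0\<close> by (simp add: K_def add_nonneg_pos)
    also have "\<dots> = e" using \<open>K > 0\<close> by (simp add: e'_def)
    finally show ?thesis by (simp add: dist_norm)
  qed
  then show "\<forall>\<^sub>F t in at_right 0. dist ((f (x + t *\<^sub>R u + t *\<^sub>R v) - f (x + t *\<^sub>R u) - f (x + t *\<^sub>R v) + f x) / t\<^sup>2) (L v) < e"
    using \<open>T > 0\<close> by (auto simp: eventually_at_right)
qed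

lemma second_derivative_symmetric:
  fixes f :: "'a::euclidean_space \<Rightarrow> 'b::euclidean_space"
  assumes "open S" "x \<in> S" "smooth_on S f"
  shows "frechet_derivative (\<lambda>y. frechet_derivative f (at y) u) (at x) v
       = frechet_derivative (\<lambda>y. frechet_derivative f (at y) v) (at x) u" (is "?L u v = ?L v u")
proof (rule euclidean_eqI)
  fix b :: 'b assume "b \<in> Basis"
  let ?f = "\<lambda>y. f y \<bullet> b" and ?f' = "\<lambda>y w. frechet_derivative f (at y) w \<bullet> b"
  let ?q = "\<lambda>u v t. (?f (x + t *\<^sub>R u + t *\<^sub>R v) - ?f (x + t *\<^sub>R u) - ?f (x + t *\<^sub>R v) + ?f x) / t\<^sup>2"
  have lim: "(?q u v \<longlongrightarrow> ?L u v \<bullet> b) (at_right 0)" for u v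
  proof (rule second_difference_limit[where f' = ?f' and S = S])
    show "(?f has_derivative ?f' y) (at y)" if "y \<in> S" for y
      using smooth_on_has_derivative[OF assms(3) that] by (rule has_derivative_inner_left)
    show "((\<lambda>y. ?f' y u) has_derivative (\<lambda>v. ?L u v \<bullet> b)) (at x)"
      using smooth_on_has_derivative[OF smooth_on_frechet_derivative[OF assms(3)] assms(2)]
      by (rule has_derivative_inner_left)
  qed (rule assms)+
  have eq: "?q u v = ?q v u"
    by (simp add: add.commute add.left_commute diff_diff_eq)
  show "?L u v \<bullet> b = ?L v u \<bullet> b"
    by (rule tendsto_unique[OF _ lim[of u v, unfolded eq] lim[of v u]]) simp
qed

text \<open>Expanding both arguments in a basis reduces the product rule for a bilinear map that varies
  with the point to the ordinary product rule.\<close>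

lemma has_derivative_varying_bilinear:
  fixes \<beta> :: "'c::euclidean_space \<Rightarrow> 'a::euclidean_space \<Rightarrow> 'b::euclidean_space \<Rightarrow> real"
    and y :: "'d::euclidean_space \<Rightarrow> 'c"
  assumes "open T" "y0 \<in> T" and bil: "\<And>z. z \<in> T \<Longrightarrow> bilinear (\<beta> z)"
    and \<beta>: "\<And>v w. ((\<lambda>z. \<beta> z v w) has_derivative \<beta>' v w) (at y0)"
    and y: "(y has_derivative y') (at x0)" "y x0 = y0"
    and a: "(a has_derivative a') (at x0)" and b: "(b has_derivative b') (at x0)"
  shows "((\<lambda>x. \<beta> (y x) (a x) (b x)) has_derivative
           (\<lambda>h. \<beta>' (a x0) (b x0) (y' h) + \<beta> y0 (a' h) (b x0) + \<beta> y0 (a x0) (b' h))) (at x0)"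
proof -
  have expand: "\<beta> z v w = (\<Sum>i\<in>Basis. \<Sum>j\<in>Basis. (v \<bullet> i) * (w \<bullet> j) * \<beta> z i j)" if "z \<in> T" for z v w
  proof -
    have "\<beta> z v w = \<beta> z (\<Sum>i\<in>Basis. (v \<bullet> i) *\<^sub>R i) (\<Sum>j\<in>Basis. (w \<bullet> j) *\<^sub>R j)"
      by (simp add: euclidean_representation)
    also have "\<dots> = (\<Sum>(i,j)\<in>Basis \<times> Basis. (v \<bullet> i) * (w \<bullet> j) * \<beta> z i j)"
      using bil[OF that]
      by (subst bilinear_sum) (auto simp: bilinear_lmul bilinear_rmul algebra_simps intro!: sum.cong)
    finally show ?thesis by (simp add: sum.cartesian_product)
  qed
  have expand': "\<beta>' v w h = (\<Sum>i\<in>Basis. \<Sum>j\<in>Basis. (v \<bullet> i) * (w \<bullet> j) * \<beta>' i j h)" for v w h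
  proof -
    have "((\<lambda>z. \<Sum>i\<in>Basis. \<Sum>j\<in>Basis. (v \<bullet> i) * (w \<bullet> j) * \<beta> z i j) has_derivative
           (\<lambda>h. \<Sum>i\<in>Basis. \<Sum>j\<in>Basis. (v \<bullet> i) * (w \<bullet> j) * \<beta>' i j h)) (at y0)"
      by (intro has_derivative_sum has_derivative_mult_right \<beta>)
    then have "((\<lambda>z. \<beta> z v w) has_derivative
           (\<lambda>h. \<Sum>i\<in>Basis. \<Sum>j\<in>Basis. (v \<bullet> i) * (w \<bullet> j) * \<beta>' i j h)) (at y0)"
      by (rule has_derivative_transform_within_open[OF _ assms(1,2)]) (simp add: expand)
    then show ?thesis using has_derivative_unique[OF \<beta>] by (auto simp: fun_eq_iff)
  qed
  have comp: "((\<lambda>x. \<beta> (y x) i j) has_derivative (\<lambda>h. \<beta>' i j (y' h))) (at x0)" for i j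
    by (rule has_derivative_compose[OF y(1)]) (simp add: y(2) \<beta>)
  have cont: "\<forall>\<^sub>F x in at x0. y x \<in> T"
    using has_derivative_continuous[OF y(1)] assms(1,2) y(2)
    by (metis continuous_at topological_tendstoD)
  have "((\<lambda>x. \<Sum>i\<in>Basis. \<Sum>j\<in>Basis. (a x \<bullet> i) * (b x \<bullet> j) * \<beta> (y x) i j) has_derivative
          (\<lambda>h. \<Sum>i\<in>Basis. \<Sum>j\<in>Basis. (a x0 \<bullet> i) * (b x0 \<bullet> j) * \<beta>' i j (y' h)
             + ((a x0 \<bullet> i) * (b' h \<bullet> j) + (a' h \<bullet> i) * (b x0 \<bullet> j)) * \<beta> (y x0) i j)) (at x0)"
    by (intro has_derivative_sum has_derivative_mult comp has_derivative_inner_left a b)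
  moreover have "(\<Sum>i\<in>Basis. \<Sum>j\<in>Basis. (a x0 \<bullet> i) * (b x0 \<bullet> j) * \<beta>' i j (y' h)
             + ((a x0 \<bullet> i) * (b' h \<bullet> j) + (a' h \<bullet> i) * (b x0 \<bullet> j)) * \<beta> (y x0) i j)
        = \<beta>' (a x0) (b x0) (y' h) + \<beta> y0 (a' h) (b x0) + \<beta> y0 (a x0) (b' h)" for h
    unfolding expand'[of "a x0" "b x0" "y' h"] expand[OF assms(2), of "a' h" "b x0"]
      expand[OF assms(2), of "a x0" "b' h"] y(2)
    by (simp add: sum.distrib algebra_simps)
  ultimately have "((\<lambda>x. \<Sum>i\<in>Basis. \<Sum>j\<in>Basis. (a x \<bullet> i) * (b x \<bullet> j) * \<beta> (y x) i j) has_derivative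
          (\<lambda>h. \<beta>' (a x0) (b x0) (y' h) + \<beta> y0 (a' h) (b x0) + \<beta> y0 (a x0) (b' h))) (at x0)"
    by simp
  then show ?thesis
    by (rule has_derivative_transform_eventually) (use cont expand y(2) assms(2) in \<open>auto elim: eventually_mono\<close>)
qed

section \<open>Charts and coordinate vector fields\<close>

text \<open>A tangent vector at \<open>q\<close> is given by its components in the preferred chart of \<open>q\<close>, which changes
  with \<open>q\<close>. Every comparison of tangent vectors goes through these Jacobians of transition maps and
  their cocycle rule.\<close>

definition jac :: "'a set \<times> ('a \<Rightarrow> 'e::euclidean_space) \<Rightarrow> 'a set \<times> ('a \<Rightarrow> 'e) \<Rightarrow> 'a \<Rightarrow> 'e \<Rightarrow> 'e" where
  "jac c d q = frechet_derivative (snd d \<circ> chart_inv c) (at (snd c q))"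

lemma components_eq_jac: "components M c p v = jac (chart_at M p) c p v"
  by (simp add: components_def jac_def coords_at_def)

lemma extend_vf_eq_jac: "extend_vf M p w q = jac (chart_at M p) (chart_at M q) q w"
  by (simp add: extend_vf_def jac_def)

context
  fixes M :: "('a, 'e::euclidean_space, 'x) mfd_scheme"
  assumes M: "smooth_manifold M"
begin

lemma chart_openin: "c \<in> atlas M \<Longrightarrow> openin (mtop M) (fst c)"
  using M by (simp add: smooth_manifold_def)

lemma chart_subset_points: "c \<in> atlas M \<Longrightarrow> fst c \<subseteq> points M"
  using chart_openin openin_subset unfolding points_def by blast

lemma chart_homeomorphic:
  "c \<in> atlas M \<Longrightarrow> homeomorphic_map (subtopology (mtop M) (fst c)) (top_of_set (snd c ` fst c)) (snd c)"
  using M by (simp add: smooth_manifold_def)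

lemma chart_inj: "c \<in> atlas M \<Longrightarrow> inj_on (snd c) (fst c)"
  using chart_homeomorphic[of c] chart_subset_points[of c]
  by (auto dest!: homeomorphic_imp_injective_map simp: points_def Int_absorb1)

lemma chart_inv_left: "c \<in> atlas M \<Longrightarrow> q \<in> fst c \<Longrightarrow> chart_inv c (snd c q) = q"
  by (simp add: chart_inv_def chart_inj)

lemma chart_image_open:
  assumes "c \<in> atlas M" "openin (mtop M) W"
  shows "open (snd c ` (fst c \<inter> W))"
proof -
  have "openin (subtopology (mtop M) (fst c)) (fst c \<inter> W)"
    using assms by (metis openin_subtopology_Int2)
  then have "openin (top_of_set (snd c ` fst c)) (snd c ` (fst c \<inter> W))"
    using homeomorphic_imp_open_map[OF chart_homeomorphic[OF assms(1)]] open_map_def by blast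
  moreover have "open (snd c ` fst c)"
    using M assms(1) by (simp add: smooth_manifold_def)
  ultimately show ?thesis
    by (metis openin_open_trans)
qed

lemma chart_at_atlas: "p \<in> points M \<Longrightarrow> chart_at M p \<in> atlas M"
  and chart_at_mem: "p \<in> points M \<Longrightarrow> p \<in> fst (chart_at M p)"
proof -
  assume "p \<in> points M"
  then have "p \<in> (\<Union>c\<in>atlas M. fst c)"
    using M by (simp add: smooth_manifold_def)
  then have "\<exists>c. c \<in> atlas M \<and> p \<in> fst c" by blast
  from someI_ex[OF this] show "chart_at M p \<in> atlas M" "p \<in> fst (chart_at M p)"
    by (auto simp: chart_at_def)
qed

lemma transition_has_derivative:
  assumes "c \<in> atlas M" "d \<in> atlas M" "q \<in> fst c" "q \<in> fst d"
  shows "((snd d \<circ> chart_inv c) has_derivative jac c d q) (at (snd c q))"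
proof -
  have "smooth_on (snd c ` (fst c \<inter> fst d)) (snd d \<circ> chart_inv c)"
    using M assms by (simp add: smooth_manifold_def)
  then show ?thesis
    unfolding jac_def using assms by (intro smooth_on_has_derivative) auto
qed

lemma linear_jac:
  assumes "c \<in> atlas M" "d \<in> atlas M" "q \<in> fst c" "q \<in> fst d"
  shows "linear (jac c d q)"
  using transition_has_derivative[OF assms] by (rule has_derivative_linear)

lemma jac_self:
  assumes "c \<in> atlas M" "q \<in> fst c"
  shows "jac c c q v = v"
proof -
  have "jac c c q = frechet_derivative (\<lambda>x. x) (at (snd c q))"
    unfolding jac_def
    by (rule frechet_derivative_cong_open[OF chart_image_open[OF assms(1) chart_openin[OF assms(1)]]])
      (use assms in \<open>auto simp: chart_inv_left[OF assms(1)]\<close>)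
  then show ?thesis by (simp add: frechet_derivative_eqI[OF has_derivative_ident])
qed

lemma jac_cocycle:
  assumes "c \<in> atlas M" "d \<in> atlas M" "e \<in> atlas M" "q \<in> fst c" "q \<in> fst d" "q \<in> fst e"
  shows "jac d e q (jac c d q v) = jac c e q v"
proof -
  have eq: "(snd d \<circ> chart_inv c) (snd c q) = snd d q"
    using assms chart_inv_left by simp
  have "((\<lambda>x. (snd e \<circ> chart_inv d) ((snd d \<circ> chart_inv c) x)) has_derivative (\<lambda>v. jac d e q (jac c d q v))) (at (snd c q))"
    by (rule has_derivative_compose[OF transition_has_derivative[OF assms(1,2,4,5)]])
      (simp only: eq transition_has_derivative assms)
  then have "((snd e \<circ> chart_inv c) has_derivative (\<lambda>v. jac d e q (jac c d q v))) (at (snd c q))"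
    by (rule has_derivative_transform_within_open[OF _ chart_image_open[OF assms(1) chart_openin[OF assms(2)]]])
      (use assms in \<open>auto simp: chart_inv_left\<close>)
  then show ?thesis
    unfolding jac_def[of c e] by (simp add: frechet_derivative_eqI)
qed

lemma local_rep_eq_jac:
  "c \<in> atlas M \<Longrightarrow> q \<in> fst c \<Longrightarrow> local_rep M c X (snd c q) = jac (chart_at M q) c q (X q)"
  by (simp add: local_rep_def components_eq_jac chart_inv_left)

lemma local_rep_extend_vf:
  assumes "c \<in> atlas M" "p \<in> points M" "q \<in> fst c" "q \<in> fst (chart_at M p)"
  shows "local_rep M c (extend_vf M p w) (snd c q) = jac (chart_at M p) c q w"
proof -
  have "q \<in> points M" using assms chart_subset_points by blast
  then show ?thesis
    using assms by (simp add: local_rep_eq_jac extend_vf_eq_jac jac_cocycle chart_at_atlas chart_at_mem)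
qed

lemma local_rep_extend_vf_const:
  assumes "p \<in> points M" "q \<in> fst (chart_at M p)"
  shows "local_rep M (chart_at M p) (extend_vf M p w) (snd (chart_at M p) q) = w"
  using assms by (simp add: local_rep_extend_vf chart_at_atlas jac_self)

lemma extend_vf_local_rep:
  assumes "p \<in> points M" "q \<in> fst (chart_at M p)"
  shows "extend_vf M p (local_rep M (chart_at M p) X (snd (chart_at M p) q)) q = X q"
proof -
  have "q \<in> points M" using assms chart_subset_points chart_at_atlas by blast
  then show ?thesis
    using assms by (simp add: local_rep_eq_jac extend_vf_eq_jac jac_cocycle jac_self chart_at_atlas chart_at_mem)
qed

lemma extend_vf_self: "p \<in> points M \<Longrightarrow> extend_vf M p w p = w"
  by (simp add: extend_vf_eq_jac jac_self chart_at_atlas chart_at_mem)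

lemma local_rep_self: "p \<in> points M \<Longrightarrow> local_rep M (chart_at M p) X (coords_at M p) = X p"
  by (simp add: coords_at_def local_rep_eq_jac jac_self chart_at_atlas chart_at_mem)

lemma linear_extend_vf:
  assumes "p \<in> points M" "q \<in> fst (chart_at M p)"
  shows "linear (\<lambda>w. extend_vf M p w q)"
proof -
  have "q \<in> points M" using assms chart_subset_points chart_at_atlas by blast
  then show ?thesis
    using assms by (simp add: extend_vf_eq_jac linear_jac chart_at_atlas chart_at_mem)
qed

text \<open>In any chart the components are a directional derivative of a transition map, evaluated at the
  point given by the inverse transition.\<close>

lemma extend_vf_smooth_on:
  assumes "p \<in> points M"
  shows "smooth_vf_on M (fst (chart_at M p)) (extend_vf M p w)"
  unfolding smooth_vf_on_def
proof
  fix c assume c: "c \<in> atlas M"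
  let ?d = "chart_at M p"
  have d: "?d \<in> atlas M" using assms by (rule chart_at_atlas)
  let ?S = "snd c ` (fst c \<inter> fst ?d)" and ?T = "snd ?d ` (fst ?d \<inter> fst c)"
  have S: "open ?S" and T: "open ?T"
    using c d by (auto intro: chart_image_open chart_openin)
  have trans: "smooth_on ?S (snd ?d \<circ> chart_inv c)" "smooth_on ?T (snd c \<circ> chart_inv ?d)"
    using M c d by (auto simp: smooth_manifold_def)
  have "smooth_on ?S (\<lambda>x. frechet_derivative (snd c \<circ> chart_inv ?d) (at ((snd ?d \<circ> chart_inv c) x)) w)"
    by (rule smooth_on_compose[OF S T _ smooth_on_frechet_derivative[OF trans(2)] trans(1)])
      (use c in \<open>auto simp: chart_inv_left\<close>)
  moreover have "local_rep M c (extend_vf M p w) x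
      = frechet_derivative (snd c \<circ> chart_inv ?d) (at ((snd ?d \<circ> chart_inv c) x)) w" if "x \<in> ?S" for x
    using that c assms by (auto simp: local_rep_extend_vf chart_inv_left jac_def)
  ultimately show "smooth_on ?S (local_rep M c (extend_vf M p w))"
    by (subst smooth_on_cong[OF S]) auto
qed

lemma extend_vf_smooth_near: "p \<in> points M \<Longrightarrow> smooth_vf_near M p (extend_vf M p w)"
  unfolding smooth_vf_near_def
  by (intro exI[of _ "fst (chart_at M p)"] conjI extend_vf_smooth_on chart_openin chart_at_atlas chart_at_mem)

lemma coords_at_mem_image:
  "p \<in> points M \<Longrightarrow> p \<in> W \<Longrightarrow> coords_at M p \<in> snd (chart_at M p) ` (fst (chart_at M p) \<inter> W)"
  unfolding coords_at_def using chart_at_mem by blast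

lemma local_rep_has_derivative:
  assumes "p \<in> points M" "smooth_vf_near M p X"
  shows "(local_rep M (chart_at M p) X has_derivative
    frechet_derivative (local_rep M (chart_at M p) X) (at (coords_at M p))) (at (coords_at M p))"
  using assms coords_at_mem_image chart_at_atlas
  unfolding smooth_vf_near_def smooth_vf_on_def by (blast intro: smooth_on_has_derivative)

lemma local_rep_extend_vf_derivative:
  assumes "p \<in> points M"
  shows "frechet_derivative (local_rep M (chart_at M p) (extend_vf M p w)) (at (coords_at M p)) v = 0"
proof -
  have "frechet_derivative (local_rep M (chart_at M p) (extend_vf M p w)) (at (coords_at M p))
      = frechet_derivative (\<lambda>_. w) (at (coords_at M p))"
    by (rule frechet_derivative_cong_open[OF
          chart_image_open[OF chart_at_atlas[OF assms] chart_openin[OF chart_at_atlas[OF assms]]]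
          coords_at_mem_image[OF assms chart_at_mem[OF assms]]])
      (use assms in \<open>auto simp: local_rep_extend_vf_const\<close>)
  then show ?thesis by simp
qed

lemma lie_bracket_extend_vf: "p \<in> points M \<Longrightarrow> lie_bracket M (extend_vf M p v) (extend_vf M p w) p = 0"
  by (simp add: lie_bracket_def local_rep_extend_vf_derivative)

end

section \<open>Derivatives of functions at a point\<close>

text \<open>The value of \<open>deriv_along\<close> is meaningful only for functions that are differentiable in
  coordinates; this relation carries that information along.\<close>

definition has_deriv_at ::
  "('a, 'e::euclidean_space, 'x) mfd_scheme \<Rightarrow> 'a \<Rightarrow> ('a \<Rightarrow> real) \<Rightarrow> ('e \<Rightarrow> real) \<Rightarrow> bool" where
  "has_deriv_at M p f L \<longleftrightarrow> ((f \<circ> chart_inv (chart_at M p)) has_derivative L) (at (coords_at M p))"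

lemma deriv_along_eqI: "has_deriv_at M p f L \<Longrightarrow> deriv_along M p v f = L v"
  by (simp add: has_deriv_at_def deriv_along_def frechet_derivative_eqI)

lemma has_deriv_at_deriv_along: "has_deriv_at M p f L \<Longrightarrow> has_deriv_at M p f (\<lambda>v. deriv_along M p v f)"
  using deriv_along_eqI[of M p f L] by (simp add: has_deriv_at_def)

lemma has_deriv_at_linear: "has_deriv_at M p f L \<Longrightarrow> linear L"
  unfolding has_deriv_at_def by (rule has_derivative_linear)

lemma has_deriv_at_add:
  "has_deriv_at M p f L \<Longrightarrow> has_deriv_at M p g K \<Longrightarrow> has_deriv_at M p (\<lambda>q. f q + g q) (\<lambda>v. L v + K v)"
  unfolding has_deriv_at_def o_def by (rule has_derivative_add)

lemma has_deriv_at_diff: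
  "has_deriv_at M p f L \<Longrightarrow> has_deriv_at M p g K \<Longrightarrow> has_deriv_at M p (\<lambda>q. f q - g q) (\<lambda>v. L v - K v)"
  unfolding has_deriv_at_def o_def by (rule has_derivative_diff)

lemma has_deriv_at_minus:
  "has_deriv_at M p f L \<Longrightarrow> has_deriv_at M p (\<lambda>q. - f q) (\<lambda>v. - L v)"
  unfolding has_deriv_at_def o_def by (rule has_derivative_minus)

lemma has_deriv_at_cmult:
  "has_deriv_at M p f L \<Longrightarrow> has_deriv_at M p (\<lambda>q. c * f q) (\<lambda>v. c * L v)"
  unfolding has_deriv_at_def o_def by (rule has_derivative_mult_right)

lemma has_deriv_at_const: "has_deriv_at M p (\<lambda>q. c) (\<lambda>v. 0)"
  unfolding has_deriv_at_def o_def by (rule has_derivative_const)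

lemma has_deriv_at_mult:
  assumes "smooth_manifold M" "p \<in> points M"
  shows "has_deriv_at M p f L \<Longrightarrow> has_deriv_at M p g K \<Longrightarrow> has_deriv_at M p (\<lambda>q. f q * g q) (\<lambda>v. f p * K v + L v * g p)"
  unfolding has_deriv_at_def o_def
  using has_derivative_mult[of "\<lambda>x. f (chart_inv (chart_at M p) x)" L "coords_at M p" UNIV
      "\<lambda>x. g (chart_inv (chart_at M p) x)" K] chart_inv_left[OF assms(1) chart_at_atlas[OF assms] chart_at_mem[OF assms]]
  by (simp add: coords_at_def)

context
  fixes M :: "('a, 'e::euclidean_space, 'x) mfd_scheme" and p :: 'a
  assumes M: "smooth_manifold M" and p: "p \<in> points M"
begin

lemma coordinate_neighbourhood:
  assumes "openin (mtop M) W" "p \<in> W"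
  shows "\<exists>S. open S \<and> coords_at M p \<in> S \<and>
    (\<forall>x\<in>S. chart_inv (chart_at M p) x \<in> W \<and> chart_inv (chart_at M p) x \<in> fst (chart_at M p) \<and>
       snd (chart_at M p) (chart_inv (chart_at M p) x) = x)"
proof (intro exI conjI)
  let ?c = "chart_at M p"
  show "open (snd ?c ` (fst ?c \<inter> W))" 
    by (rule chart_image_open[OF M chart_at_atlas[OF M p] assms(1)])
  show "coords_at M p \<in> snd ?c ` (fst ?c \<inter> W)" 
    by (rule coords_at_mem_image[OF M p assms(2)])
  show "\<forall>x\<in>snd ?c ` (fst ?c \<inter> W). chart_inv ?c x \<in> W \<and> chart_inv ?c x \<in> fst ?c \<and> snd ?c (chart_inv ?c x) = x"
    using M p by (auto simp: chart_inv_left chart_at_atlas)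
qed

lemma chart_inv_coords_at: "chart_inv (chart_at M p) (coords_at M p) = p"
  using chart_inv_left[OF M chart_at_atlas[OF M p] chart_at_mem[OF M p]] by (simp add: coords_at_def)

lemma has_deriv_at_cong:
  assumes "openin (mtop M) W" "p \<in> W" "\<And>q. q \<in> W \<Longrightarrow> f q = g q" "has_deriv_at M p f L"
  shows "has_deriv_at M p g L"
proof -
  obtain S where "open S" "coords_at M p \<in> S" "\<forall>x\<in>S. chart_inv (chart_at M p) x \<in> W"
    using coordinate_neighbourhood[OF assms(1,2)] by blast
  then show ?thesis
    using assms(3) unfolding has_deriv_at_def
    by (intro has_derivative_transform_within_open[OF assms(4)[unfolded has_deriv_at_def]]) auto
qed

text \<open>The device by which the structure equations are differentiated below.\<close>

lemma has_deriv_at_minimum: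
  assumes "openin (mtop M) W" "p \<in> W" "\<And>q. q \<in> W \<Longrightarrow> f p \<le> f q" "has_deriv_at M p f L"
  shows "L v = 0"
proof -
  obtain S where "open S" "coords_at M p \<in> S" "\<forall>x\<in>S. chart_inv (chart_at M p) x \<in> W"
    using coordinate_neighbourhood[OF assms(1,2)] by blast
  then have "L = (\<lambda>_. 0)"
    using assms(3,4) chart_inv_coords_at unfolding has_deriv_at_def
    by (intro differential_zero_maxmin[of "coords_at M p" S]) auto
  then show ?thesis by simp
qed

lemma smooth_fun_has_deriv_at:
  assumes "smooth_fun_near M p f"
  shows "has_deriv_at M p f (\<lambda>v. deriv_along M p v f)"
  using assms chart_at_atlas[OF M p] coords_at_mem_image[OF M p]
  unfolding smooth_fun_near_def smooth_fun_on_def has_deriv_at_def deriv_along_def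
  by (blast intro: smooth_on_has_derivative)

end

section \<open>The exterior derivative in coordinates\<close>

text \<open>The exterior derivative on the coordinate fields through \<open>u\<close>, \<open>v\<close>, \<open>w\<close>, whose brackets are zero.\<close>

definition coord_ext_deriv2 ::
  "('a, 'e::euclidean_space, 'x) mfd_scheme \<Rightarrow> ('a \<Rightarrow> 'e \<Rightarrow> 'e \<Rightarrow> real) \<Rightarrow> 'a \<Rightarrow> 'e \<Rightarrow> 'e \<Rightarrow> 'e \<Rightarrow> real" where
  "coord_ext_deriv2 M \<beta> p u v w =
     deriv_along M p u (\<lambda>q. \<beta> q (extend_vf M p v q) (extend_vf M p w q))
   + deriv_along M p v (\<lambda>q. \<beta> q (extend_vf M p w q) (extend_vf M p u q))
   + deriv_along M p w (\<lambda>q. \<beta> q (extend_vf M p u q) (extend_vf M p v q))"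

text \<open>The exterior and the covariant derivative involve only first derivatives of the components. This
  regularity passes easily to pull-backs, in particular to the induced structure of a fibre, whose
  \<open>\<phi>\<close> and \<open>\<xi>\<close> are definite descriptions.\<close>

definition differentiable_form2 ::
  "('a, 'e::euclidean_space, 'x) mfd_scheme \<Rightarrow> ('a \<Rightarrow> 'e \<Rightarrow> 'e \<Rightarrow> real) \<Rightarrow> bool" where
  "differentiable_form2 M \<beta> \<longleftrightarrow> (\<forall>p\<in>points M. bilinear (\<beta> p) \<and>
     (\<forall>v w. \<exists>L. has_deriv_at M p (\<lambda>q. \<beta> q (extend_vf M p v q) (extend_vf M p w q)) L))"

definition differentiable_form1 ::
  "('a, 'e::euclidean_space, 'x) mfd_scheme \<Rightarrow> ('a \<Rightarrow> 'e \<Rightarrow> real) \<Rightarrow> bool" where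
  "differentiable_form1 M \<alpha> \<longleftrightarrow> (\<forall>p\<in>points M. linear (\<alpha> p) \<and>
     (\<forall>v. \<exists>L. has_deriv_at M p (\<lambda>q. \<alpha> q (extend_vf M p v q)) L))"

lemma differentiable_form2D:
  assumes "differentiable_form2 M \<beta>" "p \<in> points M"
  shows "bilinear (\<beta> p)"
    and "has_deriv_at M p (\<lambda>q. \<beta> q (extend_vf M p v q) (extend_vf M p w q))
           (\<lambda>u. deriv_along M p u (\<lambda>q. \<beta> q (extend_vf M p v q) (extend_vf M p w q)))"
proof -
  show "bilinear (\<beta> p)" using assms by (simp add: differentiable_form2_def)
  obtain L where "has_deriv_at M p (\<lambda>q. \<beta> q (extend_vf M p v q) (extend_vf M p w q)) L"
    using assms unfolding differentiable_form2_def by blast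
  then show "has_deriv_at M p (\<lambda>q. \<beta> q (extend_vf M p v q) (extend_vf M p w q))
           (\<lambda>u. deriv_along M p u (\<lambda>q. \<beta> q (extend_vf M p v q) (extend_vf M p w q)))"
    by (rule has_deriv_at_deriv_along)
qed

lemma differentiable_form1D:
  assumes "differentiable_form1 M \<alpha>" "p \<in> points M"
  shows "linear (\<alpha> p)"
    and "has_deriv_at M p (\<lambda>q. \<alpha> q (extend_vf M p v q))
           (\<lambda>u. deriv_along M p u (\<lambda>q. \<alpha> q (extend_vf M p v q)))"
proof -
  show "linear (\<alpha> p)" using assms by (simp add: differentiable_form1_def)
  obtain L where "has_deriv_at M p (\<lambda>q. \<alpha> q (extend_vf M p v q)) L"
    using assms unfolding differentiable_form1_def by blast
  then show "has_deriv_at M p (\<lambda>q. \<alpha> q (extend_vf M p v q))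
           (\<lambda>u. deriv_along M p u (\<lambda>q. \<alpha> q (extend_vf M p v q)))"
    by (rule has_deriv_at_deriv_along)
qed

lemma openin_points: "openin (mtop M) (points M)"
  by (simp add: points_def)

context
  fixes M :: "('a, 'e::euclidean_space, 'x) mfd_scheme" and p :: 'a
    and \<beta> :: "'a \<Rightarrow> 'e \<Rightarrow> 'e \<Rightarrow> real"
  assumes M: "smooth_manifold M" and p: "p \<in> points M" and \<beta>: "differentiable_form2 M \<beta>"
begin

lemma bilinear_coordinate_form2:
  assumes q: "q \<in> fst (chart_at M p)"
  shows "bilinear (\<lambda>a b. \<beta> q (extend_vf M p a q) (extend_vf M p b q))"
proof -
  have "q \<in> points M" using q chart_subset_points[OF M chart_at_atlas[OF M p]] by auto
  then have B: "bilinear (\<beta> q)" using differentiable_form2D(1)[OF \<beta>] by blast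
  have E: "linear (\<lambda>a. extend_vf M p a q)" using linear_extend_vf[OF M p q] .
  show ?thesis
    unfolding bilinear_def
  proof (intro conjI allI)
    fix a
    show "linear (\<lambda>b. \<beta> q (extend_vf M p a q) (extend_vf M p b q))"
      using linear_compose[OF E, of "\<beta> q (extend_vf M p a q)"] B by (simp add: bilinear_def o_def)
    show "linear (\<lambda>b. \<beta> q (extend_vf M p b q) (extend_vf M p a q))"
      using linear_compose[OF E, of "\<lambda>u. \<beta> q u (extend_vf M p a q)"] B by (simp add: bilinear_def o_def)
  qed
qed

lemma has_deriv_at_form2_fields:
  assumes X: "smooth_vf_near M p X" and Y: "smooth_vf_near M p Y"
  shows "has_deriv_at M p (\<lambda>q. \<beta> q (X q) (Y q))
    (\<lambda>u. deriv_along M p u (\<lambda>q. \<beta> q (extend_vf M p (X p) q) (extend_vf M p (Y p) q))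
       + \<beta> p (frechet_derivative (local_rep M (chart_at M p) X) (at (coords_at M p)) u) (Y p)
       + \<beta> p (X p) (frechet_derivative (local_rep M (chart_at M p) Y) (at (coords_at M p)) u))"
proof -
  let ?c = "chart_at M p"
  let ?b = "\<lambda>z a b. \<beta> (chart_inv ?c z) (extend_vf M p a (chart_inv ?c z)) (extend_vf M p b (chart_inv ?c z))"
  obtain S where S: "open S" "coords_at M p \<in> S"
    and inS: "\<And>x. x \<in> S \<Longrightarrow> chart_inv ?c x \<in> fst ?c" "\<And>x. x \<in> S \<Longrightarrow> snd ?c (chart_inv ?c x) = x"
    using coordinate_neighbourhood[OF M p openin_points p] by blast
  have "((\<lambda>x. ?b x (local_rep M ?c X x) (local_rep M ?c Y x)) has_derivative
     (\<lambda>u. deriv_along M p u (\<lambda>q. \<beta> q (extend_vf M p (local_rep M ?c X (coords_at M p)) q) (extend_vf M p (local_rep M ?c Y (coords_at M p)) q))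
       + ?b (coords_at M p) (frechet_derivative (local_rep M ?c X) (at (coords_at M p)) u) (local_rep M ?c Y (coords_at M p))
       + ?b (coords_at M p) (local_rep M ?c X (coords_at M p)) (frechet_derivative (local_rep M ?c Y) (at (coords_at M p)) u)))
     (at (coords_at M p))"
  proof (rule has_derivative_varying_bilinear[where \<beta> = ?b and y = "\<lambda>x. x", OF S])
    show "bilinear (?b z)" if "z \<in> S" for z
      by (rule bilinear_coordinate_form2[OF inS(1)[OF that]])
    show "((\<lambda>z. ?b z v w) has_derivative (\<lambda>u. deriv_along M p u (\<lambda>q. \<beta> q (extend_vf M p v q) (extend_vf M p w q))))
            (at (coords_at M p))" for v w
      using differentiable_form2D(2)[OF \<beta> p, of v w] by (simp add: has_deriv_at_def o_def)
  qed (use local_rep_has_derivative[OF M p] X Y in auto)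
  then have "((\<lambda>x. ?b x (local_rep M ?c X x) (local_rep M ?c Y x)) has_derivative
     (\<lambda>u. deriv_along M p u (\<lambda>q. \<beta> q (extend_vf M p (X p) q) (extend_vf M p (Y p) q))
       + \<beta> p (frechet_derivative (local_rep M ?c X) (at (coords_at M p)) u) (Y p)
       + \<beta> p (X p) (frechet_derivative (local_rep M ?c Y) (at (coords_at M p)) u)))
     (at (coords_at M p))"
    by (simp add: local_rep_self[OF M p] chart_inv_coords_at[OF M p] extend_vf_self[OF M p])
  then show ?thesis
    unfolding has_deriv_at_def
  proof (rule has_derivative_transform_within_open[OF _ S])
    fix x assume x: "x \<in> S"
    show "?b x (local_rep M ?c X x) (local_rep M ?c Y x) = ((\<lambda>q. \<beta> q (X q) (Y q)) \<circ> chart_inv ?c) x"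
      using extend_vf_local_rep[OF M p inS(1)[OF x]] inS(2)[OF x] by simp
  qed
qed

text \<open>The derivatives of the components of the fields cancel against the bracket terms, so the
  exterior derivative may be computed with fields that are constant in coordinates.\<close>

lemma ext_deriv2_eq_coord:
  assumes skew: "\<And>u v. \<beta> p u v = - \<beta> p v u"
    and "smooth_vf_near M p X" "smooth_vf_near M p Y" "smooth_vf_near M p Z"
  shows "ext_deriv2 M \<beta> X Y Z p = coord_ext_deriv2 M \<beta> p (X p) (Y p) (Z p)"
proof -
  have B: "\<beta> p (u - v) w = \<beta> p u w - \<beta> p v w" for u v w
    using differentiable_form2D(1)[OF \<beta> p] by (simp add: bilinear_lsub)
  note D = deriv_along_eqI[OF has_deriv_at_form2_fields]
  show ?thesis
    unfolding ext_deriv2_def coord_ext_deriv2_def lie_bracket_def B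
    using skew[of "X p"] skew[of "Y p"] skew[of "Z p"]
    by (simp add: D assms(2-))
qed

lemma ext_deriv2_extend_vf:
  "ext_deriv2 M \<beta> (extend_vf M p u) (extend_vf M p v) (extend_vf M p w) p = coord_ext_deriv2 M \<beta> p u v w"
  using differentiable_form2D(1)[OF \<beta> p] M p
  by (simp add: ext_deriv2_def coord_ext_deriv2_def lie_bracket_extend_vf extend_vf_self bilinear_lzero)

end

section \<open>Pulling forms back along a smooth map\<close>

definition coord_map ::
  "('a, 'e::euclidean_space, 'x) mfd_scheme \<Rightarrow> ('b, 'f::euclidean_space, 'y) mfd_scheme \<Rightarrow> ('a \<Rightarrow> 'b) \<Rightarrow> 'a \<Rightarrow> 'e \<Rightarrow> 'f" where
  "coord_map M N f p = snd (chart_at N (f p)) \<circ> f \<circ> chart_inv (chart_at M p)"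

text \<open>The second derivative of the coordinate expression of \<open>f\<close>. It depends on the charts, but only its symmetry
  matters: it cancels from exterior derivatives.\<close>

definition coord_hessian ::
  "('a, 'e::euclidean_space, 'x) mfd_scheme \<Rightarrow> ('b, 'f::euclidean_space, 'y) mfd_scheme \<Rightarrow> ('a \<Rightarrow> 'b)
     \<Rightarrow> 'a \<Rightarrow> 'e \<Rightarrow> 'e \<Rightarrow> 'f" where
  "coord_hessian M N f p u v =
     frechet_derivative (\<lambda>x. frechet_derivative (coord_map M N f p) (at x) v) (at (coords_at M p)) u"

lemma differential_eq_coord_map:
  "differential M N f p = frechet_derivative (coord_map M N f p) (at (coords_at M p))"
  by (simp add: differential_def coord_map_def)

lemma smooth_map_point: "smooth_map M N f \<Longrightarrow> q \<in> points M \<Longrightarrow> f q \<in> points N"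
  unfolding smooth_map_def points_def continuous_map_def by blast

context
  fixes M :: "('a, 'e::euclidean_space, 'x) mfd_scheme" and N :: "('b, 'f::euclidean_space, 'y) mfd_scheme"
    and f :: "'a \<Rightarrow> 'b" and p :: 'a
  assumes M: "smooth_manifold M" and N: "smooth_manifold N" and f: "smooth_map M N f" and p: "p \<in> points M"
begin

text \<open>The part of \<open>M\<close> that \<open>f\<close> maps into the preferred chart of \<open>f p\<close>, where the coordinate expression makes sense.\<close>

definition chart_preimage :: "'a set" where
  "chart_preimage = {q \<in> topspace (mtop M). f q \<in> fst (chart_at N (f p))}"

lemma chart_preimage_openin: "openin (mtop M) chart_preimage"
  unfolding chart_preimage_def
  using f chart_openin[OF N chart_at_atlas[OF N smooth_map_point[OF f p]]]
  by (auto simp: smooth_map_def intro: openin_continuous_map_preimage)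

lemma chart_preimage_mem: "p \<in> chart_preimage"
  unfolding chart_preimage_def using p chart_at_mem[OF N smooth_map_point[OF f p]] by (simp add: points_def)

lemma chart_preimageD: "q \<in> chart_preimage \<Longrightarrow> q \<in> points M \<and> f q \<in> fst (chart_at N (f p))"
  by (simp add: chart_preimage_def points_def)

lemma coord_domain_open: "open (snd (chart_at M p) ` (fst (chart_at M p) \<inter> chart_preimage))"
  by (rule chart_image_open[OF M chart_at_atlas[OF M p] chart_preimage_openin])

lemma coords_at_mem_coord_domain:
  "coords_at M p \<in> snd (chart_at M p) ` (fst (chart_at M p) \<inter> chart_preimage)"
  by (rule coords_at_mem_image[OF M p chart_preimage_mem])

lemma coord_map_smooth: "smooth_on (snd (chart_at M p) ` (fst (chart_at M p) \<inter> chart_preimage)) (coord_map M N f p)"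
proof -
  have "smooth_on (snd (chart_at M p) ` (fst (chart_at M p) \<inter> f -` fst (chart_at N (f p)))) (coord_map M N f p)"
    using f chart_at_atlas[OF M p] chart_at_atlas[OF N smooth_map_point[OF f p]]
    unfolding smooth_map_def coord_map_def by blast
  then show ?thesis
    by (rule smooth_on_subset) (auto simp: chart_preimage_def)
qed

lemma coord_map_has_derivative:
  assumes "x \<in> snd (chart_at M p) ` (fst (chart_at M p) \<inter> chart_preimage)"
  shows "(coord_map M N f p has_derivative frechet_derivative (coord_map M N f p) (at x)) (at x)"
  using coord_map_smooth assms by (rule smooth_on_has_derivative)

lemma linear_differential: "linear (differential M N f p)"
  unfolding differential_eq_coord_map
  using coord_map_has_derivative[OF coords_at_mem_coord_domain] by (rule has_derivative_linear)

lemma coord_hessian_has_derivative: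
  "((\<lambda>x. frechet_derivative (coord_map M N f p) (at x) v) has_derivative (\<lambda>u. coord_hessian M N f p u v)) (at (coords_at M p))"
  unfolding coord_hessian_def
  by (rule smooth_on_has_derivative[OF smooth_on_frechet_derivative[OF coord_map_smooth] coords_at_mem_coord_domain])

lemma coord_hessian_symmetric: "coord_hessian M N f p u v = coord_hessian M N f p v u"
  unfolding coord_hessian_def
  by (rule second_derivative_symmetric[OF coord_domain_open coords_at_mem_coord_domain coord_map_smooth])

lemma coord_map_eq: "q \<in> fst (chart_at M p) \<Longrightarrow> coord_map M N f p (snd (chart_at M p) q) = snd (chart_at N (f p)) (f q)"
  by (simp add: coord_map_def chart_inv_left[OF M chart_at_atlas[OF M p]])

text \<open>The differential at \<open>q\<close> refers to the preferred charts of \<open>q\<close> and \<open>f q\<close>. On coordinate fields it becomes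
  the derivative of one fixed coordinate expression, which can be differentiated in \<open>q\<close>.\<close>

lemma differential_extend_vf:
  assumes q: "q \<in> fst (chart_at M p)" "q \<in> chart_preimage"
  shows "differential M N f q (extend_vf M p v q)
       = extend_vf N (f p) (frechet_derivative (coord_map M N f p) (at (snd (chart_at M p) q)) v) (f q)"
proof -
  let ?c = "chart_at M p" and ?d = "chart_at N (f p)" and ?c' = "chart_at M q" and ?d' = "chart_at N (f q)"
  let ?h = "coord_map M N f p"
  let ?Dh = "frechet_derivative ?h (at (snd ?c q))"
  have qM: "q \<in> points M" and fq: "f q \<in> fst ?d" using chart_preimageD[OF q(2)] by auto
  have fqN: "f q \<in> points N" using smooth_map_point[OF f qM] .
  have c: "?c \<in> atlas M" "?c' \<in> atlas M" "q \<in> fst ?c'"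
    using chart_at_atlas[OF M p] chart_at_atlas[OF M qM] chart_at_mem[OF M qM] by auto
  have d: "?d \<in> atlas N" "?d' \<in> atlas N" "f q \<in> fst ?d'"
    using chart_at_atlas[OF N smooth_map_point[OF f p]] chart_at_atlas[OF N fqN] chart_at_mem[OF N fqN] by auto
  have h: "(?h has_derivative ?Dh) (at (snd ?c q))"
    using coord_map_has_derivative q by blast
  have t: "((snd ?c \<circ> chart_inv ?c') has_derivative jac ?c' ?c q) (at (snd ?c' q))"
    using transition_has_derivative[OF M c(2,1,3) q(1)] .
  have tq: "(snd ?c \<circ> chart_inv ?c') (snd ?c' q) = snd ?c q"
    using chart_inv_left[OF M c(2,3)] by simp
  have s: "((snd ?d' \<circ> chart_inv ?d) has_derivative jac ?d ?d' (f q)) (at (?h (snd ?c q)))"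
    using transition_has_derivative[OF N d(1,2) fq d(3)] coord_map_eq[OF q(1)] by simp
  have 1: "((\<lambda>x. ?h ((snd ?c \<circ> chart_inv ?c') x)) has_derivative (\<lambda>u. ?Dh (jac ?c' ?c q u))) (at (snd ?c' q))"
    by (rule has_derivative_compose[OF t]) (simp only: tq h)
  have 2: "((\<lambda>x. (snd ?d' \<circ> chart_inv ?d) (?h ((snd ?c \<circ> chart_inv ?c') x))) has_derivative
      (\<lambda>u. jac ?d ?d' (f q) (?Dh (jac ?c' ?c q u)))) (at (snd ?c' q))"
    by (rule has_derivative_compose[OF 1]) (simp only: tq s)
  have "((snd ?d' \<circ> f \<circ> chart_inv ?c') has_derivative
      (\<lambda>u. jac ?d ?d' (f q) (?Dh (jac ?c' ?c q u)))) (at (snd ?c' q))"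
  proof (rule has_derivative_transform_within_open[OF 2])
    show "open (snd ?c' ` (fst ?c' \<inter> (fst ?c \<inter> chart_preimage)))"
      by (rule chart_image_open[OF M c(2) openin_Int[OF chart_openin[OF M c(1)] chart_preimage_openin]])
    show "snd ?c' q \<in> snd ?c' ` (fst ?c' \<inter> (fst ?c \<inter> chart_preimage))"
      using c(3) q by blast
    fix x assume "x \<in> snd ?c' ` (fst ?c' \<inter> (fst ?c \<inter> chart_preimage))"
    then obtain q' where q': "x = snd ?c' q'" "q' \<in> fst ?c'" "q' \<in> fst ?c" "q' \<in> chart_preimage" by blast
    then show "(snd ?d' \<circ> chart_inv ?d) (?h ((snd ?c \<circ> chart_inv ?c') x)) = (snd ?d' \<circ> f \<circ> chart_inv ?c') x"
      using chart_preimageD[OF q'(4)]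
      by (simp add: chart_inv_left[OF M c(2)] coord_map_eq chart_inv_left[OF N d(1)])
  qed
  then have D: "differential M N f q u = jac ?d ?d' (f q) (?Dh (jac ?c' ?c q u))" for u
    by (simp add: differential_def coords_at_def frechet_derivative_eqI)
  show ?thesis
    unfolding D extend_vf_eq_jac
    by (simp add: jac_cocycle[OF M c(1,2,1) q(1) c(3) q(1)] jac_self[OF M c(1) q(1)])
qed

text \<open>In coordinates the pulled back form is \<open>\<beta>\<close> at \<open>h x\<close> applied to \<open>Dh x v\<close> and \<open>Dh x w\<close>, where \<open>h\<close> is the coordinate
  expression of \<open>f\<close>; this is the product rule for it.\<close>

lemma has_deriv_at_pullback2:
  assumes \<beta>: "differentiable_form2 N \<beta>"
  shows "has_deriv_at M p
    (\<lambda>q. \<beta> (f q) (differential M N f q (extend_vf M p v q)) (differential M N f q (extend_vf M p w q)))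
    (\<lambda>u. deriv_along N (f p) (differential M N f p u)
           (\<lambda>q. \<beta> q (extend_vf N (f p) (differential M N f p v) q) (extend_vf N (f p) (differential M N f p w) q))
       + \<beta> (f p) (coord_hessian M N f p u v) (differential M N f p w)
       + \<beta> (f p) (differential M N f p v) (coord_hessian M N f p u w))"
proof -
  let ?c = "chart_at M p" and ?d = "chart_at N (f p)"
  let ?h = "coord_map M N f p" and ?x0 = "coords_at M p" and ?y0 = "coords_at N (f p)"
  let ?Dh = "\<lambda>v x. frechet_derivative ?h (at x) v"
  let ?b = "\<lambda>z a b. \<beta> (chart_inv ?d z) (extend_vf N (f p) a (chart_inv ?d z)) (extend_vf N (f p) b (chart_inv ?d z))"
  have fp: "f p \<in> points N" using smooth_map_point[OF f p] .
  obtain T where T: "open T" "?y0 \<in> T"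
    and inT: "\<And>z. z \<in> T \<Longrightarrow> chart_inv ?d z \<in> fst ?d"
    using coordinate_neighbourhood[OF N fp openin_points fp] by blast
  have h0: "?h ?x0 = ?y0"
    unfolding coords_at_def by (rule coord_map_eq[OF chart_at_mem[OF M p]])
  have "((\<lambda>x. ?b (?h x) (?Dh v x) (?Dh w x)) has_derivative
     (\<lambda>u. deriv_along N (f p) (?Dh u ?x0) (\<lambda>q. \<beta> q (extend_vf N (f p) (?Dh v ?x0) q) (extend_vf N (f p) (?Dh w ?x0) q))
       + ?b ?y0 (coord_hessian M N f p u v) (?Dh w ?x0)
       + ?b ?y0 (?Dh v ?x0) (coord_hessian M N f p u w))) (at ?x0)"
  proof (rule has_derivative_varying_bilinear[where \<beta> = ?b and y = ?h, OF T])
    show "bilinear (?b z)" if "z \<in> T" for z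
      by (rule bilinear_coordinate_form2[OF N fp \<beta> inT[OF that]])
    show "((\<lambda>z. ?b z v w) has_derivative
        (\<lambda>u. deriv_along N (f p) u (\<lambda>q. \<beta> q (extend_vf N (f p) v q) (extend_vf N (f p) w q)))) (at ?y0)" for v w
      using differentiable_form2D(2)[OF \<beta> fp, of v w] by (simp add: has_deriv_at_def o_def)
    show "(?h has_derivative (\<lambda>u. ?Dh u ?x0)) (at ?x0)"
      by (rule coord_map_has_derivative[OF coords_at_mem_coord_domain])
    show "?h ?x0 = ?y0" by (rule h0)
    show "(?Dh v has_derivative (\<lambda>u. coord_hessian M N f p u v)) (at ?x0)" for v
      by (rule coord_hessian_has_derivative)
    show "(?Dh w has_derivative (\<lambda>u. coord_hessian M N f p u w)) (at ?x0)"
      by (rule coord_hessian_has_derivative)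
  qed
  then have D: "((\<lambda>x. ?b (?h x) (?Dh v x) (?Dh w x)) has_derivative
    (\<lambda>u. deriv_along N (f p) (differential M N f p u)
           (\<lambda>q. \<beta> q (extend_vf N (f p) (differential M N f p v) q) (extend_vf N (f p) (differential M N f p w) q))
       + \<beta> (f p) (coord_hessian M N f p u v) (differential M N f p w)
       + \<beta> (f p) (differential M N f p v) (coord_hessian M N f p u w))) (at ?x0)"
    by (simp add: differential_eq_coord_map chart_inv_coords_at[OF N fp] extend_vf_self[OF N fp])
  show ?thesis
    unfolding has_deriv_at_def
  proof (rule has_derivative_transform_within_open[OF D coord_domain_open coords_at_mem_coord_domain])
    fix x assume "x \<in> snd ?c ` (fst ?c \<inter> chart_preimage)"
    then obtain q where q: "x = snd ?c q" "q \<in> fst ?c" "q \<in> chart_preimage" by blast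
    have "chart_inv ?d (?h x) = f q"
      using q chart_preimageD[OF q(3)] chart_inv_left[OF N chart_at_atlas[OF N fp]] coord_map_eq by simp
    moreover have "chart_inv ?c x = q"
      using q chart_inv_left[OF M chart_at_atlas[OF M p]] by simp
    ultimately show "?b (?h x) (?Dh v x) (?Dh w x) =
      ((\<lambda>q. \<beta> (f q) (differential M N f q (extend_vf M p v q)) (differential M N f q (extend_vf M p w q))) \<circ> chart_inv ?c) x"
      using differential_extend_vf[OF q(2,3)] q(1) by simp
  qed
qed

lemma has_deriv_at_pullback1:
  assumes \<alpha>: "differentiable_form1 N \<alpha>"
  shows "has_deriv_at M p (\<lambda>q. \<alpha> (f q) (differential M N f q (extend_vf M p v q)))
    (\<lambda>u. deriv_along N (f p) (differential M N f p u) (\<lambda>q. \<alpha> q (extend_vf N (f p) (differential M N f p v) q))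
       + \<alpha> (f p) (coord_hessian M N f p u v))"
proof -
  let ?c = "chart_at M p" and ?d = "chart_at N (f p)"
  let ?h = "coord_map M N f p" and ?x0 = "coords_at M p" and ?y0 = "coords_at N (f p)"
  let ?Dh = "\<lambda>v x. frechet_derivative ?h (at x) v"
  \<comment> \<open>a 1-form is treated as a bilinear map whose second argument is a real factor\<close>
  let ?b = "\<lambda>z a (b::real). \<alpha> (chart_inv ?d z) (extend_vf N (f p) a (chart_inv ?d z)) * b"
  have fp: "f p \<in> points N" using smooth_map_point[OF f p] .
  obtain T where T: "open T" "?y0 \<in> T"
    and inT: "\<And>z. z \<in> T \<Longrightarrow> chart_inv ?d z \<in> fst ?d"
    using coordinate_neighbourhood[OF N fp openin_points fp] by blast
  have h0: "?h ?x0 = ?y0"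
    unfolding coords_at_def by (rule coord_map_eq[OF chart_at_mem[OF M p]])
  have "((\<lambda>x. ?b (?h x) (?Dh v x) 1) has_derivative
     (\<lambda>u. deriv_along N (f p) (?Dh u ?x0) (\<lambda>q. \<alpha> q (extend_vf N (f p) (?Dh v ?x0) q)) * 1
       + ?b ?y0 (coord_hessian M N f p u v) 1 + ?b ?y0 (?Dh v ?x0) 0)) (at ?x0)"
  proof (rule has_derivative_varying_bilinear[where \<beta> = ?b and y = ?h, OF T])
    show "bilinear (?b z)" if "z \<in> T" for z
    proof -
      have q: "chart_inv ?d z \<in> points N"
        using inT[OF that] chart_subset_points[OF N chart_at_atlas[OF N fp]] by blast
      have "linear (\<lambda>a. \<alpha> (chart_inv ?d z) (extend_vf N (f p) a (chart_inv ?d z)))"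
        using linear_compose[OF linear_extend_vf[OF N fp inT[OF that]] differentiable_form1D(1)[OF \<alpha> q]]
        by (simp add: o_def)
      then show ?thesis
        by (auto simp: bilinear_def linear_iff algebra_simps)
    qed
    show "((\<lambda>z. ?b z v w) has_derivative
        (\<lambda>u. deriv_along N (f p) u (\<lambda>q. \<alpha> q (extend_vf N (f p) v q)) * w)) (at ?y0)" for v w
      using differentiable_form1D(2)[OF \<alpha> fp, of v] unfolding has_deriv_at_def o_def
      by (rule has_derivative_mult_left)
    show "(?h has_derivative (\<lambda>u. ?Dh u ?x0)) (at ?x0)"
      by (rule coord_map_has_derivative[OF coords_at_mem_coord_domain])
    show "?h ?x0 = ?y0" by (rule h0)
    show "(?Dh v has_derivative (\<lambda>u. coord_hessian M N f p u v)) (at ?x0)"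
      by (rule coord_hessian_has_derivative)
  qed simp
  then have D: "((\<lambda>x. ?b (?h x) (?Dh v x) 1) has_derivative
    (\<lambda>u. deriv_along N (f p) (differential M N f p u) (\<lambda>q. \<alpha> q (extend_vf N (f p) (differential M N f p v) q))
       + \<alpha> (f p) (coord_hessian M N f p u v))) (at ?x0)"
    by (simp add: differential_eq_coord_map chart_inv_coords_at[OF N fp] extend_vf_self[OF N fp])
  show ?thesis
    unfolding has_deriv_at_def
  proof (rule has_derivative_transform_within_open[OF D coord_domain_open coords_at_mem_coord_domain])
    fix x assume "x \<in> snd ?c ` (fst ?c \<inter> chart_preimage)"
    then obtain q where q: "x = snd ?c q" "q \<in> fst ?c" "q \<in> chart_preimage" by blast
    have "chart_inv ?d (?h x) = f q"
      using q chart_preimageD[OF q(3)] chart_inv_left[OF N chart_at_atlas[OF N fp]] coord_map_eq by simp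
    moreover have "chart_inv ?c x = q"
      using q chart_inv_left[OF M chart_at_atlas[OF M p]] by simp
    ultimately show "?b (?h x) (?Dh v x) 1 =
      ((\<lambda>q. \<alpha> (f q) (differential M N f q (extend_vf M p v q))) \<circ> chart_inv ?c) x"
      using differential_extend_vf[OF q(2,3)] q(1) by simp
  qed
qed

text \<open>The terms with the second derivatives of the map cancel because these are symmetric.\<close>

lemma coord_ext_deriv2_pullback:
  assumes \<beta>: "differentiable_form2 N \<beta>" and skew: "\<And>u v. \<beta> (f p) u v = - \<beta> (f p) v u"
  shows "coord_ext_deriv2 M (\<lambda>q u v. \<beta> (f q) (differential M N f q u) (differential M N f q v)) p u v w
       = coord_ext_deriv2 N \<beta> (f p) (differential M N f p u) (differential M N f p v) (differential M N f p w)"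
  unfolding coord_ext_deriv2_def deriv_along_eqI[OF has_deriv_at_pullback2[OF \<beta>]]
  using coord_hessian_symmetric[of u v] coord_hessian_symmetric[of v w] coord_hessian_symmetric[of w u]
    skew[of "coord_hessian M N f p u v"] skew[of "coord_hessian M N f p v w"] skew[of "coord_hessian M N f p w u"]
  by simp

end

section \<open>Linear algebra of a scalar product\<close>

locale scalar_product =
  fixes g :: "'e::euclidean_space \<Rightarrow> 'e \<Rightarrow> real"
  assumes bilinear_g: "bilinear g"
    and g_commute: "g u v = g v u"
    and g_pos: "u \<noteq> 0 \<Longrightarrow> g u u > 0"
begin

lemmas g_simps = bilinear_ladd[OF bilinear_g] bilinear_radd[OF bilinear_g] bilinear_lsub[OF bilinear_g]
  bilinear_rsub[OF bilinear_g] bilinear_lmul[OF bilinear_g] bilinear_rmul[OF bilinear_g]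
  bilinear_lneg[OF bilinear_g] bilinear_rneg[OF bilinear_g] bilinear_lzero[OF bilinear_g] bilinear_rzero[OF bilinear_g]

lemma linear_g_left: "linear (\<lambda>u. g u v)"
  using bilinear_g by (simp add: bilinear_def)

lemma g_nonneg: "g u u \<ge> 0"
  using g_pos[of u] g_simps(9)[of 0] by (cases "u = 0") auto

lemma g_self_eq_0: "g u u = 0 \<longleftrightarrow> u = 0"
  using g_pos[of u] g_simps(9)[of 0] by (cases "u = 0") auto

lemma abs_g_le: "\<bar>g u v\<bar> \<le> (g u u + g v v) / 2"
  using g_nonneg[of "u + v"] g_nonneg[of "u - v"] g_commute[of u v]
  by (simp add: g_simps abs_le_iff)

definition orthonormal :: "'e set \<Rightarrow> bool" where
  "orthonormal B \<longleftrightarrow> (\<forall>u\<in>B. \<forall>v\<in>B. g u v = (if u = v then 1 else 0))"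

lemma orthonormal_independent:
  assumes "orthonormal B"
  shows "independent B"
proof
  assume "dependent B"
  then obtain a where a: "a \<in> B" "a \<in> span (B - {a})" by (auto simp: dependent_def)
  have "span (B - {a}) \<subseteq> {x. g a x = 0}"
    using assms a(1) by (intro span_minimal) (auto simp: subspace_def g_simps orthonormal_def)
  then have "g a a = 0" using a(2) by blast
  then show False using a(1) assms by (auto simp: orthonormal_def)
qed

lemma orthonormal_finite: "orthonormal B \<Longrightarrow> finite B"
  by (rule independent_imp_finite[OF orthonormal_independent])

lemma orthonormal_g_sum:
  assumes "orthonormal B" "b \<in> B"
  shows "g (\<Sum>c\<in>B. f c *\<^sub>R c) b = f b"
proof -
  have "g (\<Sum>c\<in>B. f c *\<^sub>R c) b = (\<Sum>c\<in>B. f c * g c b)"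
    by (simp add: linear_sum[OF linear_g_left] g_simps)
  also have "\<dots> = (\<Sum>c\<in>B. if c = b then f c else 0)"
    using assms by (intro sum.cong) (auto simp: orthonormal_def)
  finally show ?thesis using assms orthonormal_finite by simp
qed

text \<open>An orthonormal subset of \<open>S\<close> of largest size spans \<open>S\<close>, since otherwise the Gram-Schmidt
  step would enlarge it.\<close>

lemma exists_orthonormal_span:
  assumes S: "subspace S"
  shows "\<exists>B. orthonormal B \<and> B \<subseteq> S \<and> span B = S"
proof -
  let ?P = "\<lambda>B. orthonormal B \<and> B \<subseteq> S"
  have "?P {}" by (simp add: orthonormal_def)
  moreover have "card B < DIM('e) + 1" if "?P B" for B
    using that orthonormal_independent independent_bound[of B] by fastforce
  ultimately obtain B where B: "orthonormal B" "B \<subseteq> S" and max: "\<And>C. ?P C \<Longrightarrow> card C \<le> card B"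
    using ex_has_greatest_nat[of ?P "{}" card "DIM('e) + 1"] by (metis (no_types, lifting) less_imp_le)
  have "x \<in> span B" if x: "x \<in> S" for x
  proof (rule ccontr)
    assume nx: "x \<notin> span B"
    define y where "y = x - (\<Sum>b\<in>B. g x b *\<^sub>R b)"
    have sum_in: "(\<Sum>b\<in>B. g x b *\<^sub>R b) \<in> span B" by (intro span_sum span_scale span_base)
    then have "y \<noteq> 0" using nx by (auto simp: y_def)
    have "span B \<subseteq> S" using B S by (simp add: span_minimal)
    then have "y \<in> S" using x sum_in S by (auto simp: y_def intro: subspace_diff)
    have yB: "g y b = 0" if "b \<in> B" for b
      using orthonormal_g_sum[OF B(1) that] by (simp add: y_def g_simps)
    define z where "z = (1 / sqrt (g y y)) *\<^sub>R y"
    have zz: "g z z = 1" using g_pos[OF \<open>y \<noteq> 0\<close>] by (simp add: z_def g_simps)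
    have zB: "g z b = 0" "g b z = 0" if "b \<in> B" for b
      using yB[OF that] g_commute[of b y] by (auto simp: z_def g_simps)
    have "z \<notin> B" using zB zz by force
    moreover have "?P (insert z B)"
      using B zB zz \<open>y \<in> S\<close> S by (auto simp: orthonormal_def z_def intro: subspace_scale)
    ultimately show False
      using max[of "insert z B"] orthonormal_finite[OF B(1)] by simp
  qed
  then show ?thesis using B S span_minimal by blast
qed

lemma orthonormal_expansion:
  assumes B: "orthonormal B" and x: "x \<in> span B"
  shows "x = (\<Sum>b\<in>B. g x b *\<^sub>R b)"
proof -
  define y where "y = x - (\<Sum>b\<in>B. g x b *\<^sub>R b)"
  have "y \<in> span B" unfolding y_def by (rule span_diff[OF x]) (intro span_sum span_scale span_base)
  moreover have "span B \<subseteq> {z. g y z = 0}"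
  proof (rule span_minimal)
    show "B \<subseteq> {z. g y z = 0}"
      using orthonormal_g_sum[OF B] by (auto simp: y_def g_simps)
  qed (auto simp: subspace_def g_simps)
  ultimately have "g y y = 0" by blast
  then show ?thesis using g_self_eq_0 by (simp add: y_def)
qed

text \<open>Used to split tangent vectors into vertical and horizontal parts.\<close>

lemma orthogonal_decomposition:
  assumes S: "subspace S"
  obtains a b where "x = a + b" "a \<in> S" "\<And>s. s \<in> S \<Longrightarrow> g b s = 0"
proof -
  obtain B where B: "orthonormal B" "span B = S" using exists_orthonormal_span[OF S] by blast
  let ?a = "\<Sum>b\<in>B. g x b *\<^sub>R b"
  have "span B \<subseteq> {z. g (x - ?a) z = 0}"
  proof (rule span_minimal)
    show "B \<subseteq> {z. g (x - ?a) z = 0}"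
      using orthonormal_g_sum[OF B(1)] by (auto simp: g_simps)
  qed (auto simp: subspace_def g_simps)
  then have "g (x - ?a) s = 0" if "s \<in> S" for s using that B(2) by blast
  moreover have "?a \<in> S" unfolding B(2)[symmetric] by (intro span_sum span_scale span_base)
  ultimately show thesis using that[of ?a "x - ?a"] by simp
qed

lemma orthonormal_basis_iff: "orthonormal_basis g B \<longleftrightarrow> orthonormal B \<and> span B = UNIV"
  by (auto simp: orthonormal_basis_def orthonormal_def)

lemma exists_orthonormal_basis: "\<exists>B. orthonormal_basis g B"
  using exists_orthonormal_span[OF subspace_UNIV] by (auto simp: orthonormal_basis_iff)

context
  fixes B assumes B: "orthonormal_basis g B"
begin

lemma basis_card: "card B = DIM('e)"
  using B orthonormal_independent dim_eq_card_independent[of B]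
  by (metis dim_UNIV dim_span orthonormal_basis_iff)

lemma basis_expansion: "x = (\<Sum>b\<in>B. g x b *\<^sub>R b)"
  using B orthonormal_expansion orthonormal_basis_iff by auto

lemma basis_sum:
  fixes T :: "'e \<Rightarrow> real"
  assumes "linear T"
  shows "(\<Sum>b\<in>B. g x b * T b) = T x"
proof -
  have "T x = T (\<Sum>b\<in>B. g x b *\<^sub>R b)" using basis_expansion by simp
  then show ?thesis by (simp add: linear_sum[OF assms] linear_scale[OF assms])
qed

end

end

section \<open>Linear algebra of an almost contact metric structure\<close>

locale acm_space = scalar_product g
  for g :: "'e::euclidean_space \<Rightarrow> 'e \<Rightarrow> real" +
  fixes \<phi> :: "'e \<Rightarrow> 'e" and \<xi> :: 'e and \<eta> :: "'e \<Rightarrow> real"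
  assumes linear_\<phi>: "linear \<phi>" and linear_\<eta>: "linear \<eta>"
    and \<phi>_\<phi>: "\<phi> (\<phi> u) = - u + \<eta> u *\<^sub>R \<xi>"
    and \<eta>_\<xi>: "\<eta> \<xi> = 1"
    and g_\<phi>_\<phi>: "g (\<phi> u) (\<phi> v) = g u v - \<eta> u * \<eta> v"
begin

lemmas \<phi>_simps = linear_add[OF linear_\<phi>] linear_diff[OF linear_\<phi>] linear_scale[OF linear_\<phi>] linear_neg[OF linear_\<phi>] linear_0[OF linear_\<phi>]
lemmas \<eta>_simps = linear_add[OF linear_\<eta>] linear_diff[OF linear_\<eta>] linear_scale[OF linear_\<eta>] linear_neg[OF linear_\<eta>] linear_0[OF linear_\<eta>]

lemma \<phi>_\<xi>: "\<phi> \<xi> = 0"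
proof -
  have 0: "\<phi> (\<phi> \<xi>) = 0" by (simp add: \<phi>_\<phi> \<eta>_\<xi>)
  then have 1: "\<phi> \<xi> = \<eta> (\<phi> \<xi>) *\<^sub>R \<xi>" using \<phi>_\<phi>[of "\<phi> \<xi>"] by (simp add: \<phi>_simps)
  then have "\<eta> (\<phi> \<xi>) *\<^sub>R \<phi> \<xi> = 0" using 0 by (metis \<phi>_simps(3))
  then show ?thesis using 1 by auto
qed

lemma \<eta>_\<phi>: "\<eta> (\<phi> u) = 0"
proof -
  have "\<phi> (\<phi> (\<phi> u)) = - \<phi> u" using \<phi>_\<phi>[of u] by (simp add: \<phi>_simps \<phi>_\<xi>)
  then have "\<eta> (\<phi> u) *\<^sub>R \<xi> = 0" using \<phi>_\<phi>[of "\<phi> u"] by simp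
  then show ?thesis using \<eta>_\<xi> \<eta>_simps(5) by auto
qed

lemma g_\<xi>: "g \<xi> u = \<eta> u" "g u \<xi> = \<eta> u"
  using g_\<phi>_\<phi>[of u \<xi>] g_commute[of u \<xi>] by (simp_all add: \<phi>_\<xi> g_simps \<eta>_\<xi>)

lemma g_\<phi>_skew: "g u (\<phi> v) = - g (\<phi> u) v"
  using g_\<phi>_\<phi>[of "\<phi> u" v] by (simp add: \<phi>_\<phi> g_simps \<eta>_\<phi> g_\<xi>)

lemma g_\<phi>_swap: "g u (\<phi> v) = - g v (\<phi> u)"
  using g_\<phi>_skew[of u v] g_commute by simp

context
  fixes B assumes B: "orthonormal_basis g B"
begin

text \<open>Moving \<open>\<phi>\<close> from one slot of a trace to the other changes the sign, because \<open>\<phi>\<close> is skew.\<close>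

lemma trace_\<phi>_swap:
  fixes T :: "'e \<Rightarrow> 'e \<Rightarrow> real"
  assumes T: "bilinear T"
  shows "(\<Sum>b\<in>B. T (\<phi> b) b) = - (\<Sum>b\<in>B. T b (\<phi> b))"
proof -
  have "(\<Sum>b\<in>B. T (\<phi> b) b) = (\<Sum>b\<in>B. \<Sum>c\<in>B. g (\<phi> b) c * T c b)"
    using T by (simp add: basis_sum[OF B, where T = "\<lambda>c. T c _"] bilinear_def)
  also have "\<dots> = (\<Sum>c\<in>B. \<Sum>b\<in>B. g (\<phi> b) c * T c b)"
    by (rule sum.swap)
  also have "\<dots> = (\<Sum>c\<in>B. \<Sum>b\<in>B. - (g (\<phi> c) b * T c b))"
    by (intro sum.cong refl) (metis g_\<phi>_skew g_commute minus_mult_left)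
  also have "\<dots> = - (\<Sum>c\<in>B. T c (\<phi> c))"
    using T by (simp add: sum_negf basis_sum[OF B] bilinear_def)
  finally show ?thesis .
qed

lemma basis_sum_\<eta>:
  fixes T :: "'e \<Rightarrow> real"
  shows "linear T \<Longrightarrow> (\<Sum>b\<in>B. \<eta> b * T b) = T \<xi>"
  using basis_sum[OF B, of T \<xi>] by (simp add: g_\<xi>)

text \<open>Contraction of \<open>d\<phi> = - 2 \<alpha> \<and> \<phi>\<close> over a pair \<open>(e, \<phi> e)\<close>. Here \<open>P\<close> and \<open>E\<close> stand for the covariant
  derivatives of the fundamental form and of \<open>\<eta>\<close>; they are constrained by the derivatives of the
  structure equations. In the cyclic sum the first two terms have the same trace by \<open>trace_\<phi>_swap\<close>, and the trace
  of the third vanishes because \<open>\<phi>\<close> has constant length.\<close>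

lemma contraction_of_fundamental_equation:
  fixes P :: "'e \<Rightarrow> 'e \<Rightarrow> 'e \<Rightarrow> real" and E :: "'e \<Rightarrow> 'e \<Rightarrow> real" and \<alpha> :: "'e \<Rightarrow> real"
  assumes P: "\<And>w. bilinear (\<lambda>u v. P u w v)" and skew: "\<And>u v w. P u v w = - P u w v"
    and E: "bilinear E" and E_\<xi>: "\<And>v. E v \<xi> = 0"
    and PE: "\<And>u v w. P u (\<phi> v) w + P u (\<phi> w) v = - (E u v * \<eta> w + \<eta> v * E u w)"
    and \<alpha>: "linear \<alpha>"
    and eq: "\<And>u v w. P u v w + P v w u + P w u v = - 2 * (\<alpha> u * g v (\<phi> w) + \<alpha> v * g w (\<phi> u) + \<alpha> w * g u (\<phi> v))"
  shows "(\<Sum>b\<in>B. P b b (\<phi> x)) - E \<xi> x - \<eta> x * (\<Sum>b\<in>B. E b b)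
       = (real DIM('e) - 3) * \<alpha> x + 2 * \<eta> x * \<alpha> \<xi>"
proof -
  have Elin: "linear (\<lambda>u. E u v)" "linear (E u)" for u v using E by (auto simp: bilinear_def)
  have third: "(\<Sum>b\<in>B. P x b (\<phi> b)) = 0"
  proof -
    have "P x b (\<phi> b) = \<eta> b * E x b" for b
      using PE[of x b b] skew[of x b "\<phi> b"] by (simp add: mult.commute)
    then show ?thesis using basis_sum_\<eta>[OF Elin(2)] E_\<xi> by simp
  qed
  have second: "(\<Sum>b\<in>B. P (\<phi> b) x b) = (\<Sum>b\<in>B. P b (\<phi> b) x)"
    using trace_\<phi>_swap[OF P[of x]] skew[of _ x] by (simp add: sum_negf)
  have first: "(\<Sum>b\<in>B. P b (\<phi> b) x) = (\<Sum>b\<in>B. P b b (\<phi> x)) - E \<xi> x - \<eta> x * (\<Sum>b\<in>B. E b b)"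
  proof -
    have "P b (\<phi> b) x = P b b (\<phi> x) - \<eta> b * E b x - \<eta> x * E b b" for b
      using PE[of b b x] skew[of b b "\<phi> x"] by (simp add: algebra_simps)
    then show ?thesis
      using basis_sum_\<eta>[OF Elin(1), of x] by (simp add: sum_subtractf sum_distrib_left)
  qed
  have rhs1: "(\<Sum>b\<in>B. \<alpha> b * g (\<phi> b) (\<phi> x)) = \<alpha> x - \<eta> x * \<alpha> \<xi>"
  proof -
    have "(\<Sum>b\<in>B. \<alpha> b * g (\<phi> b) (\<phi> x)) = (\<Sum>b\<in>B. g x b * \<alpha> b) - \<eta> x * (\<Sum>b\<in>B. \<eta> b * \<alpha> b)"
      by (simp add: g_\<phi>_\<phi> sum_distrib_left g_commute[of x] flip: sum_subtractf) (simp add: algebra_simps)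
    then show ?thesis by (simp add: basis_sum[OF B \<alpha>] basis_sum_\<eta>[OF \<alpha>])
  qed
  have rhs2: "(\<Sum>b\<in>B. \<alpha> (\<phi> b) * g x (\<phi> b)) = \<alpha> x - \<eta> x * \<alpha> \<xi>"
  proof -
    have "(\<Sum>b\<in>B. \<alpha> (\<phi> b) * g x (\<phi> b)) = - (\<Sum>b\<in>B. g (\<phi> x) b * (\<alpha> \<circ> \<phi>) b)"
      by (simp add: g_\<phi>_skew sum_negf mult.commute)
    also have "\<dots> = - \<alpha> (\<phi> (\<phi> x))"
      by (subst basis_sum[OF B linear_compose[OF linear_\<phi> \<alpha>]]) simp
    finally show ?thesis
      by (simp add: \<phi>_\<phi> linear_add[OF \<alpha>] linear_diff[OF \<alpha>] linear_neg[OF \<alpha>] linear_scale[OF \<alpha>])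
  qed
  have rhs3: "(\<Sum>b\<in>B. g b (\<phi> (\<phi> b))) = 1 - real DIM('e)"
  proof -
    have "(\<Sum>b\<in>B. g b (\<phi> (\<phi> b))) = (\<Sum>b\<in>B. - 1 + \<eta> b * \<eta> b)"
      using B by (intro sum.cong) (auto simp: \<phi>_\<phi> g_simps g_\<xi> orthonormal_basis_def)
    then show ?thesis
      using basis_sum_\<eta>[OF linear_\<eta>] by (simp only: sum.distrib) (simp add: basis_card[OF B] \<eta>_\<xi>)
  qed
  have "(\<Sum>b\<in>B. P b (\<phi> b) x + P (\<phi> b) x b + P x b (\<phi> b))
      = (\<Sum>b\<in>B. - 2 * (\<alpha> b * g (\<phi> b) (\<phi> x) + \<alpha> (\<phi> b) * g x (\<phi> b) + \<alpha> x * g b (\<phi> (\<phi> b))))"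
    by (simp only: eq)
  then have "2 * (\<Sum>b\<in>B. P b (\<phi> b) x)
      = - 2 * (2 * (\<alpha> x - \<eta> x * \<alpha> \<xi>) + \<alpha> x * (1 - real DIM('e)))"
    unfolding sum_distrib_left[symmetric] sum.distrib rhs1 rhs2 rhs3 second third by simp
  then show ?thesis
    unfolding first by (simp add: algebra_simps)
qed

end

end

section \<open>Almost contact metric structures with a Levi-Civita connection\<close>

lemma linear_deriv_along_family:
  assumes M: "smooth_manifold M" and p: "p \<in> points M" and W: "openin (mtop M) W" "p \<in> W"
    and lin: "\<And>q. q \<in> W \<Longrightarrow> linear (\<lambda>w. h w q)"
    and diff: "\<And>w. \<exists>L. has_deriv_at M p (h w) L"
  shows "linear (\<lambda>w. deriv_along M p v (h w))"
proof
  have D: "has_deriv_at M p (h w) (\<lambda>v. deriv_along M p v (h w))" for w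
    using diff[of w] by (auto intro: has_deriv_at_deriv_along)
  show "deriv_along M p v (h (a + b)) = deriv_along M p v (h a) + deriv_along M p v (h b)" for a b
    by (rule deriv_along_eqI, rule has_deriv_at_cong[OF M p W _ has_deriv_at_add[OF D D]])
      (simp add: linear_add[OF lin])
  show "deriv_along M p v (h (c *\<^sub>R a)) = c *\<^sub>R deriv_along M p v (h a)" for c a
    unfolding real_scaleR_def
    by (rule deriv_along_eqI, rule has_deriv_at_cong[OF M p W _ has_deriv_at_cmult[OF D]])
      (simp add: linear_scale[OF lin])
qed

lemma linear_deriv_along_direction: "has_deriv_at M p f L \<Longrightarrow> linear (\<lambda>v. deriv_along M p v f)"
  by (rule has_deriv_at_linear[OF has_deriv_at_deriv_along])

lemma bilinear_pointwise_diff: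
  fixes T S :: "'u::real_vector \<Rightarrow> 'v::real_vector \<Rightarrow> real"
  assumes "bilinear T" "bilinear S"
  shows "bilinear (\<lambda>u v. T u v - S u v)"
  using assms by (auto simp: bilinear_def intro: linear_compose_sub)

text \<open>What a manifold and its fibres share. Differentiability is asked of the forms \<open>g\<close>, \<open>\<phi>\<close> and \<open>\<eta>\<close>, as on a
  fibre these are pull-backs.\<close>

locale acm_structure =
  fixes M :: "('a, 'e::euclidean_space, 'x) acm_scheme" and D :: "'a \<Rightarrow> 'e \<Rightarrow> ('a \<Rightarrow> 'e) \<Rightarrow> 'e"
  assumes M: "smooth_manifold M"
    and acm: "p \<in> points M \<Longrightarrow> acm_space (met M p) (acm_phi M p) (acm_xi M p) (acm_eta M p)"
    and diff_g: "differentiable_form2 M (met M)"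
    and diff_\<phi>: "differentiable_form2 M (fundamental_form M)"
    and diff_\<eta>: "differentiable_form1 M (acm_eta M)"
    and levi_civita: "levi_civita M D"
begin

lemma fundamental_form_skew: "q \<in> points M \<Longrightarrow> fundamental_form M q u v = - fundamental_form M q v u"
  unfolding fundamental_form_def using acm_space.g_\<phi>_swap[OF acm] by blast

context
  fixes p assumes p: "p \<in> points M"
begin

interpretation acm_space "met M p" "acm_phi M p" "acm_xi M p" "acm_eta M p"
  by (rule acm[OF p])

abbreviation "ext \<equiv> extend_vf M p"
abbreviation "\<Gamma> v w \<equiv> D p v (ext w)"
abbreviation "nbhd \<equiv> fst (chart_at M p)"

lemma nbhd: "openin (mtop M) nbhd" "p \<in> nbhd" "nbhd \<subseteq> points M"
  using chart_openin[OF M chart_at_atlas[OF M p]] chart_at_mem[OF M p]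
    chart_subset_points[OF M chart_at_atlas[OF M p]] by auto

lemma \<Gamma>_symmetric: "\<Gamma> v w = \<Gamma> w v"
proof -
  have "D p (ext v p) (ext w) - D p (ext w p) (ext v) = lie_bracket M (ext v) (ext w) p"
    using levi_civita p extend_vf_smooth_near[OF M p] unfolding levi_civita_def by blast
  then show ?thesis
    using lie_bracket_extend_vf[OF M p] extend_vf_self[OF M p] by simp
qed

lemma bilinear_\<Gamma>: "bilinear \<Gamma>"
proof -
  have lin: "linear (\<lambda>v. \<Gamma> v w)" for w
  proof -
    have "affine_connection M D" using levi_civita unfolding levi_civita_def by (elim conjE)
    then have "\<forall>p\<in>points M. \<forall>Y. smooth_vf_near M p Y \<longrightarrow> linear (\<lambda>v. D p v Y)"
      unfolding affine_connection_def by (elim conjE)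
    then show ?thesis using p extend_vf_smooth_near[OF M p, of w] by simp
  qed
  moreover have "linear (\<Gamma> v)" for v using lin[of v] by (simp add: \<Gamma>_symmetric[of v])
  ultimately show ?thesis by (simp add: bilinear_def)
qed

lemma metric_derivative:
  "deriv_along M p u (\<lambda>q. met M q (ext v q) (ext w q)) = met M p (\<Gamma> u v) w + met M p v (\<Gamma> u w)"
proof -
  have "deriv_along M p u (\<lambda>q. met M q (ext v q) (ext w q))
      = met M p (\<Gamma> u v) (ext w p) + met M p (ext v p) (\<Gamma> u w)"
    using levi_civita p extend_vf_smooth_near[OF M p] unfolding levi_civita_def by blast
  then show ?thesis using extend_vf_self[OF M p] by simp
qed

abbreviation "D\<eta> \<equiv> nabla_form1 M D (acm_eta M) p"
abbreviation "D\<phi> \<equiv> nabla_form2 M D (fundamental_form M) p"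

lemma nabla_\<eta>: "D\<eta> v w = deriv_along M p v (\<lambda>q. acm_eta M q (ext w q)) - acm_eta M p (\<Gamma> v w)"
  by (simp add: nabla_form1_def Let_def)

lemma nabla_\<phi>: "D\<phi> u v w = deriv_along M p u (\<lambda>q. fundamental_form M q (ext v q) (ext w q))
    - fundamental_form M p (\<Gamma> u v) w - fundamental_form M p v (\<Gamma> u w)"
  by (simp add: nabla_form2_def Let_def)

lemma bilinear_nabla_\<eta>: "bilinear D\<eta>"
proof -
  have "linear (\<lambda>w. deriv_along M p v (\<lambda>q. acm_eta M q (ext w q)))" for v
  proof (rule linear_deriv_along_family[OF M p nbhd(1,2)])
    fix q assume q: "q \<in> nbhd"
    then have "linear (acm_eta M q)" using differentiable_form1D(1)[OF diff_\<eta>] nbhd(3) by blast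
    then show "linear (\<lambda>w. acm_eta M q (ext w q))"
      using linear_compose[OF linear_extend_vf[OF M p q]] by (simp add: o_def)
  qed (rule exI, rule differentiable_form1D(2)[OF diff_\<eta> p])
  moreover have "linear (\<lambda>v. deriv_along M p v (\<lambda>q. acm_eta M q (ext w q)))" for w
    by (rule linear_deriv_along_direction[OF differentiable_form1D(2)[OF diff_\<eta> p]])
  moreover have "bilinear (\<lambda>v w. acm_eta M p (\<Gamma> v w))"
    using bilinear_\<Gamma> linear_compose[OF _ linear_\<eta>] unfolding bilinear_def o_def by blast
  ultimately show ?thesis
    unfolding nabla_\<eta> by (intro bilinear_pointwise_diff) (simp_all add: bilinear_def)
qed

lemma bilinear_nabla_\<phi>_left: "bilinear (\<lambda>u v. D\<phi> u v w)"
proof -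
  have "linear (\<lambda>v. deriv_along M p u (\<lambda>q. fundamental_form M q (ext v q) (ext w q)))" for u
  proof (rule linear_deriv_along_family[OF M p nbhd(1,2)])
    fix q assume q: "q \<in> nbhd"
    show "linear (\<lambda>v. fundamental_form M q (ext v q) (ext w q))"
      using bilinear_coordinate_form2[OF M p diff_\<phi> q] by (simp add: bilinear_def)
  qed (rule exI, rule differentiable_form2D(2)[OF diff_\<phi> p])
  moreover have "linear (\<lambda>u. deriv_along M p u (\<lambda>q. fundamental_form M q (ext v q) (ext w q)))" for v
    by (rule linear_deriv_along_direction[OF differentiable_form2D(2)[OF diff_\<phi> p]])
  moreover have "bilinear (\<lambda>u v. fundamental_form M p (\<Gamma> u v) w)"
    using bilinear_\<Gamma> linear_compose[of _ "\<lambda>x. fundamental_form M p x w"] differentiable_form2D(1)[OF diff_\<phi> p]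
    unfolding bilinear_def o_def by blast
  moreover have "bilinear (\<lambda>u v. fundamental_form M p v (\<Gamma> u w))"
    using bilinear_\<Gamma> linear_compose[of "\<lambda>u. \<Gamma> u w" "fundamental_form M p _"] differentiable_form2D(1)[OF diff_\<phi> p]
    unfolding bilinear_def o_def by blast
  ultimately show ?thesis
    unfolding nabla_\<phi> by (intro bilinear_pointwise_diff) (simp_all add: bilinear_def)
qed

lemma deriv_fundamental_form_skew:
  "deriv_along M p u (\<lambda>q. fundamental_form M q (ext v q) (ext w q))
     = - deriv_along M p u (\<lambda>q. fundamental_form M q (ext w q) (ext v q))"
  by (rule deriv_along_eqI,
      rule has_deriv_at_cong[OF M p openin_points p _ has_deriv_at_minus[OF differentiable_form2D(2)[OF diff_\<phi> p]]])
    (simp add: fundamental_form_skew[of _ "ext w _"])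

lemma nabla_\<phi>_skew: "D\<phi> u v w = - D\<phi> u w v"
  using deriv_fundamental_form_skew[of u v w] fundamental_form_skew[OF p, of "\<Gamma> u v" w]
    fundamental_form_skew[OF p, of v "\<Gamma> u w"]
  by (simp add: nabla_\<phi>)

lemma bilinear_nabla_\<phi>_right: "bilinear (\<lambda>u v. D\<phi> u w v)"
proof -
  have "(\<lambda>u v. D\<phi> u w v) = (\<lambda>u v. - D\<phi> u v w)"
    by (intro ext) (rule nabla_\<phi>_skew)
  then show ?thesis
    using bilinear_nabla_\<phi>_left[of w] by (auto simp: bilinear_def intro: linear_compose_neg)
qed

lemma linear_codiff_\<phi>: "linear (codiff2 M D (fundamental_form M) p)"
proof -
  have "linear (D\<phi> u v)" for u v
    using bilinear_nabla_\<phi>_right by (simp add: bilinear_def)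
  then show ?thesis
    unfolding codiff2_def by (intro linear_compose_neg linear_compose_sum) auto
qed

text \<open>The Christoffel terms cancel in pairs, as the connection is torsion-free and \<open>\<phi>\<close> is skew.\<close>

lemma cyclic_nabla_\<phi>: "D\<phi> u v w + D\<phi> v w u + D\<phi> w u v = coord_ext_deriv2 M (fundamental_form M) p u v w"
  using fundamental_form_skew[OF p, of u "\<Gamma> v w"] fundamental_form_skew[OF p, of v "\<Gamma> w u"]
    fundamental_form_skew[OF p, of w "\<Gamma> u v"]
  by (simp add: nabla_\<phi> coord_ext_deriv2_def \<Gamma>_symmetric[of v u] \<Gamma>_symmetric[of w v] \<Gamma>_symmetric[of u w])

text \<open>With \<open>\<Xi>\<close> the coordinate field through \<open>\<xi>\<close>, the squared length of \<open>\<Xi> - \<xi>\<close> is expressed by \<open>g\<close> and \<open>\<eta>\<close>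
  and has a minimum at \<open>p\<close>. Its derivative there vanishes. In this way the derivative of the
  structure equations is taken without differentiating \<open>\<xi>\<close>.\<close>

lemma nabla_\<eta>_\<xi>: "D\<eta> u (acm_xi M p) = 0"
proof -
  let ?X = "ext (acm_xi M p)"
  let ?h = "\<lambda>q. met M q (?X q) (?X q) - 2 * acm_eta M q (?X q) + 1"
  have sq: "?h q = met M q (?X q - acm_xi M q) (?X q - acm_xi M q)" if "q \<in> points M" for q
  proof -
    interpret q: acm_space "met M q" "acm_phi M q" "acm_xi M q" "acm_eta M q" by (rule acm[OF that])
    show ?thesis by (simp add: q.g_simps q.g_\<xi> q.\<eta>_\<xi> q.\<eta>_simps)
  qed
  have min: "?h p \<le> ?h q" if "q \<in> points M" for q
  proof -
    interpret q: acm_space "met M q" "acm_phi M q" "acm_xi M q" "acm_eta M q" by (rule acm[OF that])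
    show ?thesis
      unfolding sq[OF that] using q.g_nonneg by (simp add: extend_vf_self[OF M p] g_\<xi> \<eta>_\<xi>)
  qed
  have "has_deriv_at M p ?h (\<lambda>u. deriv_along M p u (\<lambda>q. met M q (?X q) (?X q))
      - 2 * deriv_along M p u (\<lambda>q. acm_eta M q (?X q)) + 0)"
    by (intro has_deriv_at_add has_deriv_at_diff has_deriv_at_cmult has_deriv_at_const
        differentiable_form2D(2)[OF diff_g p] differentiable_form1D(2)[OF diff_\<eta> p])
  from has_deriv_at_minimum[OF M p openin_points p min this, of u]
  show ?thesis
    by (simp add: metric_derivative nabla_\<eta> g_\<xi>)
qed

text \<open>The same device for \<open>\<phi>\<close>: the function with a minimum is the squared length of \<open>\<phi> W - W'\<close>,
  where \<open>W\<close> and \<open>W'\<close> are the coordinate fields through \<open>w\<close> and \<open>\<phi> w\<close>.\<close>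

lemma nabla_\<phi>_\<phi>_self: "D\<phi> u (acm_phi M p w) w = - acm_eta M p w * D\<eta> u w"
proof -
  let ?W = "ext w" and ?V = "ext (acm_phi M p w)"
  let ?h = "\<lambda>q. met M q (?W q) (?W q) - acm_eta M q (?W q) * acm_eta M q (?W q)
    - 2 * fundamental_form M q (?V q) (?W q) + met M q (?V q) (?V q)"
  have sq: "?h q = met M q (acm_phi M q (?W q) - ?V q) (acm_phi M q (?W q) - ?V q)" if "q \<in> points M" for q
  proof -
    interpret q: acm_space "met M q" "acm_phi M q" "acm_xi M q" "acm_eta M q" by (rule acm[OF that])
    show ?thesis
      by (simp add: q.g_simps q.g_\<phi>_\<phi> fundamental_form_def q.g_commute[of "acm_phi M q (?W q)" "?V q"])
  qed
  have "?h p = 0" by (simp add: extend_vf_self[OF M p] fundamental_form_def g_\<phi>_\<phi>)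
  then have min: "?h p \<le> ?h q" if "q \<in> points M" for q
  proof -
    interpret q: acm_space "met M q" "acm_phi M q" "acm_xi M q" "acm_eta M q" by (rule acm[OF that])
    show ?thesis
      unfolding \<open>?h p = 0\<close> sq[OF that] using q.g_nonneg by simp
  qed
  have "has_deriv_at M p ?h (\<lambda>u. deriv_along M p u (\<lambda>q. met M q (?W q) (?W q))
      - (acm_eta M p (?W p) * deriv_along M p u (\<lambda>q. acm_eta M q (?W q))
         + deriv_along M p u (\<lambda>q. acm_eta M q (?W q)) * acm_eta M p (?W p))
      - 2 * deriv_along M p u (\<lambda>q. fundamental_form M q (?V q) (?W q))
      + deriv_along M p u (\<lambda>q. met M q (?V q) (?V q)))"
    by (rule has_deriv_at_add[OF has_deriv_at_diff[OF has_deriv_at_diff[OF differentiable_form2D(2)[OF diff_g p]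
          has_deriv_at_mult[OF M p differentiable_form1D(2)[OF diff_\<eta> p] differentiable_form1D(2)[OF diff_\<eta> p]]]
          has_deriv_at_cmult[OF differentiable_form2D(2)[OF diff_\<phi> p]]] differentiable_form2D(2)[OF diff_g p]])
  from has_deriv_at_minimum[OF M p openin_points p min this, of u]
  show ?thesis
    using g_commute[of w "\<Gamma> u w"] g_commute[of "acm_phi M p w" "\<Gamma> u (acm_phi M p w)"]
    by (simp add: metric_derivative nabla_\<eta> nabla_\<phi> fundamental_form_def g_\<phi>_\<phi> extend_vf_self[OF M p] algebra_simps)
qed

text \<open>Polarisation of the previous lemma. This is the derivative of \<open>\<phi>\<^sup>2 = - I + \<eta> \<otimes> \<xi>\<close> in terms of forms.\<close>

lemma nabla_\<phi>_\<phi>: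
  "D\<phi> u (acm_phi M p v) w + D\<phi> u (acm_phi M p w) v = - (D\<eta> u v * acm_eta M p w + acm_eta M p v * D\<eta> u w)"
proof -
  have P: "linear (\<lambda>v. D\<phi> u v w)" for w using bilinear_nabla_\<phi>_left by (simp add: bilinear_def)
  have P': "D\<phi> u x (v + w) = D\<phi> u x v + D\<phi> u x w" for x
    using nabla_\<phi>_skew[of u x] linear_add[OF P] by simp
  have E: "linear (D\<eta> u)" using bilinear_nabla_\<eta> by (simp add: bilinear_def)
  show ?thesis
    using nabla_\<phi>_\<phi>_self[of u "v + w"] nabla_\<phi>_\<phi>_self[of u v] nabla_\<phi>_\<phi>_self[of u w]
    by (simp add: P' linear_add[OF P] linear_add[OF E] \<phi>_simps \<eta>_simps algebra_simps)
qed

text \<open>The right hand side is \<open>d\<eta>(\<xi>, u)\<close>; it does not involve the connection.\<close>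

lemma nabla_\<xi>_\<eta>:
  "D\<eta> (acm_xi M p) u = deriv_along M p (acm_xi M p) (\<lambda>q. acm_eta M q (ext u q))
     - deriv_along M p u (\<lambda>q. acm_eta M q (ext (acm_xi M p) q))"
  using nabla_\<eta>_\<xi>[of u] by (simp add: nabla_\<eta> \<Gamma>_symmetric[of "acm_xi M p" u])

lemma frame_at: "orthonormal_basis (met M p) (frame_at M p)"
  unfolding frame_at_def using someI_ex[OF exists_orthonormal_basis] .

lemma linear_lee_form: "linear (lee_form M D p)"
proof -
  from linear_compose[OF linear_\<phi> linear_codiff_\<phi>]
  have "linear (\<lambda>u. codiff2 M D (fundamental_form M) p (acm_phi M p u))" by (simp add: o_def)
  moreover have "linear (D\<eta> (acm_xi M p))" using bilinear_nabla_\<eta> by (simp add: bilinear_def)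
  ultimately show ?thesis
    using linear_\<eta> unfolding lee_form_def Let_def by (auto simp: linear_iff algebra_simps add_divide_distrib)
qed

context
  fixes \<alpha> :: "'a \<Rightarrow> 'e \<Rightarrow> real" and m :: nat
  assumes dim: "DIM('e) = 2 * m + 1" and lin: "linear (\<alpha> p)"
    and eq: "\<And>u v w. coord_ext_deriv2 M (fundamental_form M) p u v w
          = - 2 * wedge12 \<alpha> (fundamental_form M) p u v w"
begin

lemma lee_contraction:
  "2 * (real m - 1) * \<alpha> p u + 2 * acm_eta M p u * \<alpha> p (acm_xi M p)
     = - codiff2 M D (fundamental_form M) p (acm_phi M p u) - D\<eta> (acm_xi M p) u
       + acm_eta M p u * codiff1 M D (acm_eta M) p"
proof -
  have "D\<phi> u v w + D\<phi> v w u + D\<phi> w u v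
     = - 2 * (\<alpha> p u * met M p v (acm_phi M p w) + \<alpha> p v * met M p w (acm_phi M p u) + \<alpha> p w * met M p u (acm_phi M p v))" for u v w
    unfolding cyclic_nabla_\<phi> eq by (simp add: wedge12_def fundamental_form_def)
  from contraction_of_fundamental_equation[OF frame_at bilinear_nabla_\<phi>_right nabla_\<phi>_skew bilinear_nabla_\<eta>
      nabla_\<eta>_\<xi> nabla_\<phi>_\<phi> lin this, of u]
  show ?thesis by (simp add: dim codiff1_def codiff2_def algebra_simps)
qed

lemma codiff_\<eta>: "codiff1 M D (acm_eta M) p = 2 * real m * \<alpha> p (acm_xi M p)"
  using lee_contraction[of "acm_xi M p"] linear_0[OF linear_codiff_\<phi>]
  by (simp add: \<phi>_\<xi> \<eta>_\<xi> nabla_\<eta>_\<xi> algebra_simps)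

text \<open>Evaluating the contraction at \<open>\<xi>\<close> gives \<open>\<alpha>(\<xi>)\<close>; substituting it back determines \<open>\<alpha>\<close>.\<close>

lemma lee_form_eq:
  assumes "m \<ge> 2"
  shows "lee_form M D p u = \<alpha> p u"
proof -
  define A where "A = codiff2 M D (fundamental_form M) p (acm_phi M p u) + D\<eta> (acm_xi M p) u"
  define k where "k = 2 * (real m - 1)"
  have "A = - k * (\<alpha> p u - acm_eta M p u * \<alpha> p (acm_xi M p))"
    using lee_contraction[of u] by (simp add: A_def k_def codiff_\<eta> algebra_simps)
  moreover have "k \<noteq> 0" using assms by (simp add: k_def)
  ultimately have "- 1 / k * A = \<alpha> p u - acm_eta M p u * \<alpha> p (acm_xi M p)" by simp
  moreover have "lee_form M D p u = - 1 / k * A + acm_eta M p u * \<alpha> p (acm_xi M p)"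
  proof -
    have "(DIM('e) - 1) div 2 = m" using dim by simp
    then show ?thesis
      using assms unfolding lee_form_def Let_def A_def k_def codiff_\<eta> by simp
  qed
  ultimately show ?thesis by simp
qed

end

end

end

section \<open>Structures on smooth manifolds\<close>

lemma differentiable_form1_cong:
  assumes M: "smooth_manifold M" and \<alpha>: "differentiable_form1 M \<alpha>"
    and eq: "\<And>q. q \<in> points M \<Longrightarrow> \<alpha>' q = \<alpha> q"
  shows "differentiable_form1 M \<alpha>'"
  unfolding differentiable_form1_def
proof (intro ballI conjI allI exI)
  fix p v assume p: "p \<in> points M"
  show "linear (\<alpha>' p)" using differentiable_form1D(1)[OF \<alpha> p] by (simp add: eq[OF p])
  show "has_deriv_at M p (\<lambda>q. \<alpha>' q (extend_vf M p v q)) (\<lambda>u. deriv_along M p u (\<lambda>q. \<alpha> q (extend_vf M p v q)))"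
    by (rule has_deriv_at_cong[OF M p openin_points p _ differentiable_form1D(2)[OF \<alpha> p]]) (simp add: eq)
qed

lemma has_deriv_at_form2_cong:
  assumes M: "smooth_manifold M" and p: "p \<in> points M" and \<beta>: "differentiable_form2 M \<beta>"
    and eq: "\<And>q u v. q \<in> points M \<Longrightarrow> \<beta>' q u v = \<beta> q u v"
  shows "has_deriv_at M p (\<lambda>q. \<beta>' q (extend_vf M p v q) (extend_vf M p w q))
    (\<lambda>u. deriv_along M p u (\<lambda>q. \<beta> q (extend_vf M p v q) (extend_vf M p w q)))"
  by (rule has_deriv_at_cong[OF M p openin_points p _ differentiable_form2D(2)[OF \<beta> p]]) (simp add: eq)

lemma differentiable_form2_cong:
  assumes M: "smooth_manifold M" and \<beta>: "differentiable_form2 M \<beta>"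
    and eq: "\<And>q u v. q \<in> points M \<Longrightarrow> \<beta>' q u v = \<beta> q u v"
  shows "differentiable_form2 M \<beta>'"
  unfolding differentiable_form2_def
proof (intro ballI conjI allI exI)
  fix p v w assume p: "p \<in> points M"
  have "\<beta>' p = \<beta> p" by (intro ext) (rule eq[OF p])
  then show "bilinear (\<beta>' p)" using differentiable_form2D(1)[OF \<beta> p] by simp
  show "has_deriv_at M p (\<lambda>q. \<beta>' q (extend_vf M p v q) (extend_vf M p w q))
    (\<lambda>u. deriv_along M p u (\<lambda>q. \<beta> q (extend_vf M p v q) (extend_vf M p w q)))"
    by (rule has_deriv_at_form2_cong[OF M p \<beta> eq])
qed

lemma coord_ext_deriv2_cong:
  assumes "smooth_manifold M" "p \<in> points M" "differentiable_form2 M \<beta>"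
    and "\<And>q u v. q \<in> points M \<Longrightarrow> \<beta>' q u v = \<beta> q u v"
  shows "coord_ext_deriv2 M \<beta>' p u v w = coord_ext_deriv2 M \<beta> p u v w"
proof -
  have "deriv_along M p a (\<lambda>q. \<beta>' q (extend_vf M p b q) (extend_vf M p c q))
      = deriv_along M p a (\<lambda>q. \<beta> q (extend_vf M p b q) (extend_vf M p c q))" for a b c
    by (rule deriv_along_eqI, rule has_deriv_at_form2_cong) (use assms in auto)
  then show ?thesis by (simp only: coord_ext_deriv2_def)
qed

lemma coord_ext_deriv2_zero:
  assumes M: "smooth_manifold M" and p: "p \<in> points M" and \<beta>: "differentiable_form2 M \<beta>"
  shows "coord_ext_deriv2 M \<beta> p 0 v w = 0"
proof -
  have "linear (\<lambda>u. deriv_along M p u (\<lambda>q. \<beta> q (extend_vf M p v q) (extend_vf M p w q)))"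
    by (rule linear_deriv_along_direction[OF differentiable_form2D(2)[OF \<beta> p]])
  then have 1: "deriv_along M p 0 (\<lambda>q. \<beta> q (extend_vf M p v q) (extend_vf M p w q)) = 0"
    by (rule linear_0)
  note nbhd = chart_openin[OF M chart_at_atlas[OF M p]] chart_at_mem[OF M p]
  have b: "bilinear (\<lambda>a b. \<beta> q (extend_vf M p a q) (extend_vf M p b q))" if "q \<in> fst (chart_at M p)" for q
    by (rule bilinear_coordinate_form2[OF M p \<beta> that])
  have 2: "deriv_along M p v (\<lambda>q. \<beta> q (extend_vf M p w q) (extend_vf M p 0 q)) = 0"
    by (rule deriv_along_eqI, rule has_deriv_at_cong[OF M p nbhd _ has_deriv_at_const])
      (use bilinear_rzero[OF b] in simp)
  have 3: "deriv_along M p w (\<lambda>q. \<beta> q (extend_vf M p 0 q) (extend_vf M p v q)) = 0"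
    by (rule deriv_along_eqI, rule has_deriv_at_cong[OF M p nbhd _ has_deriv_at_const])
      (use bilinear_lzero[OF b] in simp)
  show ?thesis unfolding coord_ext_deriv2_def 1 2 3 by simp
qed

lemma differentiable_form1_pullback:
  assumes M: "smooth_manifold M" and N: "smooth_manifold N" and f: "smooth_map M N f"
    and \<alpha>: "differentiable_form1 N \<alpha>"
  shows "differentiable_form1 M (\<lambda>q u. \<alpha> (f q) (differential M N f q u))"
  unfolding differentiable_form1_def
proof (intro ballI conjI allI)
  fix p v assume p: "p \<in> points M"
  show "linear (\<lambda>u. \<alpha> (f p) (differential M N f p u))"
    using linear_compose[OF linear_differential[OF M N f p] differentiable_form1D(1)[OF \<alpha> smooth_map_point[OF f p]]]
    by (simp add: o_def)
  show "\<exists>L. has_deriv_at M p (\<lambda>q. \<alpha> (f q) (differential M N f q (extend_vf M p v q))) L"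
    by (rule exI, rule has_deriv_at_pullback1[OF M N f p \<alpha>])
qed

lemma bilinear_compose_linear:
  assumes "bilinear \<beta>" "linear L"
  shows "bilinear (\<lambda>u v. \<beta> (L u) (L v))"
  using linear_compose[OF assms(2), of "\<beta> (L _)"] linear_compose[OF assms(2), of "\<lambda>u. \<beta> u (L _)"] assms(1)
  by (simp add: bilinear_def o_def)

lemma differentiable_form2_pullback:
  assumes M: "smooth_manifold M" and N: "smooth_manifold N" and f: "smooth_map M N f"
    and \<beta>: "differentiable_form2 N \<beta>"
  shows "differentiable_form2 M (\<lambda>q u v. \<beta> (f q) (differential M N f q u) (differential M N f q v))"
  unfolding differentiable_form2_def
proof (intro ballI conjI allI)
  fix p v w assume p: "p \<in> points M"
  show "bilinear (\<lambda>u v. \<beta> (f p) (differential M N f p u) (differential M N f p v))"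
    by (rule bilinear_compose_linear[OF differentiable_form2D(1)[OF \<beta> smooth_map_point[OF f p]]
          linear_differential[OF M N f p]])
  show "\<exists>L. has_deriv_at M p
    (\<lambda>q. \<beta> (f q) (differential M N f q (extend_vf M p v q)) (differential M N f q (extend_vf M p w q))) L"
    by (rule exI, rule has_deriv_at_pullback2[OF M N f p \<beta>])
qed

lemma riemannian_scalar_product:
  assumes M: "riemannian_manifold M" and p: "p \<in> points M"
  shows "scalar_product (met M p)"
proof
  have lin: "linear (met M p u)" and sym: "met M p u v = met M p v u"
    and pos: "u \<noteq> 0 \<Longrightarrow> met M p u u > 0" for u v
    using M p by (auto simp: riemannian_manifold_def)
  have "(\<lambda>u. met M p u v) = met M p v" for v by (intro ext) (rule sym)
  then show "bilinear (met M p)" using lin by (simp add: bilinear_def)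
  show "met M p u v = met M p v u" for u v by (rule sym)
  show "u \<noteq> 0 \<Longrightarrow> met M p u u > 0" for u by (rule pos)
qed

lemma riemannian_met_has_deriv_at:
  assumes M: "riemannian_manifold M" and p: "p \<in> points M"
    and W: "openin (mtop M) W" "p \<in> W" and X: "smooth_vf_on M W X" and Y: "smooth_vf_on M W Y"
  shows "\<exists>L. has_deriv_at M p (\<lambda>q. met M q (X q) (Y q)) L"
proof -
  have M': "smooth_manifold M" using M by (simp add: riemannian_manifold_def)
  have "smooth_fun_on M W (\<lambda>q. met M q (X q) (Y q))"
    using M W(1) X Y by (simp add: riemannian_manifold_def)
  then have "smooth_fun_near M p (\<lambda>q. met M q (X q) (Y q))"
    unfolding smooth_fun_near_def using W by (intro exI[of _ W]) simp
  then show ?thesis by (intro exI) (rule smooth_fun_has_deriv_at[OF M' p])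
qed

lemma differentiable_metric:
  assumes M: "riemannian_manifold M"
  shows "differentiable_form2 M (met M)"
  unfolding differentiable_form2_def
proof (intro ballI conjI allI)
  have M': "smooth_manifold M" using M by (simp add: riemannian_manifold_def)
  fix p v w assume p: "p \<in> points M"
  show "bilinear (met M p)" using riemannian_scalar_product[OF M p] by (rule scalar_product.bilinear_g)
  show "\<exists>L. has_deriv_at M p (\<lambda>q. met M q (extend_vf M p v q) (extend_vf M p w q)) L"
    by (rule riemannian_met_has_deriv_at[OF M p chart_openin[OF M' chart_at_atlas[OF M' p]] chart_at_mem[OF M' p]
          extend_vf_smooth_on[OF M' p] extend_vf_smooth_on[OF M' p]])
qed

lemma differentiable_metric_endo:
  assumes M: "riemannian_manifold M" and T: "smooth_endo M T"
  shows "differentiable_form2 M (\<lambda>q u v. met M q u (T q v))"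
  unfolding differentiable_form2_def
proof (intro ballI conjI allI)
  have M': "smooth_manifold M" using M by (simp add: riemannian_manifold_def)
  fix p v w assume p: "p \<in> points M"
  have "bilinear (met M p)" using riemannian_scalar_product[OF M p] by (rule scalar_product.bilinear_g)
  moreover have "linear (T p)" using T p by (simp add: smooth_endo_def)
  ultimately show "bilinear (\<lambda>u v. met M p u (T p v))"
    using linear_compose[of "T p" "met M p _"] by (simp add: bilinear_def o_def)
  let ?W = "fst (chart_at M p)"
  have W: "openin (mtop M) ?W" by (rule chart_openin[OF M' chart_at_atlas[OF M' p]])
  have "smooth_vf_on M ?W (\<lambda>q. T q (extend_vf M p w q))"
    using T W extend_vf_smooth_on[OF M' p] by (simp add: smooth_endo_def)
  then show "\<exists>L. has_deriv_at M p (\<lambda>q. met M q (extend_vf M p v q) (T q (extend_vf M p w q))) L"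
    by (rule riemannian_met_has_deriv_at[OF M p W chart_at_mem[OF M' p] extend_vf_smooth_on[OF M' p]])
qed

lemma differentiable_one_form:
  assumes M: "smooth_manifold M" and \<alpha>: "smooth_one_form M \<alpha>"
  shows "differentiable_form1 M \<alpha>"
  unfolding differentiable_form1_def
proof (intro ballI conjI allI)
  fix p v assume p: "p \<in> points M"
  show "linear (\<alpha> p)" using \<alpha> p by (simp add: smooth_one_form_def)
  let ?W = "fst (chart_at M p)"
  have W: "openin (mtop M) ?W" by (rule chart_openin[OF M chart_at_atlas[OF M p]])
  have "smooth_fun_on M ?W (\<lambda>q. \<alpha> q (extend_vf M p v q))"
    using \<alpha> W extend_vf_smooth_on[OF M p] by (simp add: smooth_one_form_def)
  then have "smooth_fun_near M p (\<lambda>q. \<alpha> q (extend_vf M p v q))"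
    unfolding smooth_fun_near_def using W chart_at_mem[OF M p] by (intro exI[of _ ?W]) simp
  then show "\<exists>L. has_deriv_at M p (\<lambda>q. \<alpha> q (extend_vf M p v q)) L"
    by (intro exI) (rule smooth_fun_has_deriv_at[OF M p])
qed

lemma acm_manifold_acm_structure:
  assumes M: "acm_manifold M" and D: "levi_civita M D"
  shows "acm_structure M D"
proof -
  have R: "riemannian_manifold M" using M by (simp add: acm_manifold_def)
  then have M': "smooth_manifold M" by (simp add: riemannian_manifold_def)
  have E: "smooth_endo M (acm_phi M)" and \<eta>: "smooth_one_form M (acm_eta M)"
    using M by (auto simp: acm_manifold_def)
  show ?thesis
  proof (rule acm_structure.intro)
    fix p assume p: "p \<in> points M"
    show "acm_space (met M p) (acm_phi M p) (acm_xi M p) (acm_eta M p)"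
    proof (intro acm_space.intro acm_space_axioms.intro)
      show "scalar_product (met M p)" by (rule riemannian_scalar_product[OF R p])
      show "linear (acm_phi M p)" using E p by (simp add: smooth_endo_def)
      show "linear (acm_eta M p)" using \<eta> p by (simp add: smooth_one_form_def)
    qed (use M p in \<open>auto simp: acm_manifold_def\<close>)
  next
    have "fundamental_form M = (\<lambda>q u v. met M q u (acm_phi M q v))"
      by (intro ext) (simp add: fundamental_form_def)
    then show "differentiable_form2 M (fundamental_form M)"
      using differentiable_metric_endo[OF R E] by simp
  qed (rule M' differentiable_metric[OF R] differentiable_one_form[OF M' \<eta>] D)+
qed

section \<open>Contact-complex Riemannian submersions\<close>

text \<open>The range of a linear section is a complement of the kernel.\<close>

lemma dim_kernel_surj:
  fixes L :: "'e::euclidean_space \<Rightarrow> 'f::euclidean_space"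
  assumes L: "linear L" "surj L"
  shows "dim {u. L u = 0} + DIM('f) = DIM('e)"
proof -
  obtain s where s: "linear s" "\<And>y. L (s y) = y"
    using linear_surjective_right_inverse[OF L] by (auto simp: fun_eq_iff)
  let ?K = "{u. L u = 0}"
  have "inj s" using s(2) by (metis injI)
  then have "dim (range s) = DIM('f)" using dim_image_eq[OF s(1), of UNIV] by simp
  moreover have "u = (u - s (L u)) + s (L u) \<and> u - s (L u) \<in> ?K" for u
    using s(2) by (simp add: linear_diff[OF L(1)])
  then have "{x + y |x y. x \<in> ?K \<and> y \<in> range s} = UNIV" by blast
  moreover have "?K \<inter> range s = {0}"
    using s linear_0[OF L(1)] linear_0[OF s(1)] by (auto simp: image_iff)
  moreover have "subspace ?K" by (rule linear_subspace_kernel[OF L(1)])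
  moreover have "subspace (range s)" by (rule linear_subspace_image[OF s(1) subspace_UNIV])
  ultimately show ?thesis using dim_sums_Int[of ?K "range s"] by simp
qed

text \<open>The situation in one tangent space, where \<open>L\<close> is the differential of the submersion and its kernel
  the vertical space.\<close>

locale contact_complex_space = acm_space g \<phi> \<xi> \<eta> + base: scalar_product h
  for g :: "'e::euclidean_space \<Rightarrow> 'e \<Rightarrow> real" and \<phi> \<xi> \<eta>
    and h :: "'f::euclidean_space \<Rightarrow> 'f \<Rightarrow> real" +
  fixes L :: "'e \<Rightarrow> 'f" and J :: "'f \<Rightarrow> 'f"
  assumes linear_L: "linear L" and surj_L: "surj L" and linear_J: "linear J"
    and J_J: "J (J x) = - x" and h_J_J: "h (J x) (J y) = h x y"
    and L_\<phi>: "L (\<phi> u) = J (L u)"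
    and isometry: "(\<And>s. L s = 0 \<Longrightarrow> g u s = 0) \<Longrightarrow> (\<And>s. L s = 0 \<Longrightarrow> g v s = 0) \<Longrightarrow> h (L u) (L v) = g u v"
begin

text \<open>This is the squared length of \<open>\<phi>\<close> applied to the vertical part of \<open>u\<close>. In contrast to that part, it is
  expressed by forms whose derivatives are known.\<close>

definition \<kappa> :: "'e \<Rightarrow> real" where
  "\<kappa> u = g u u - h (L u) (L u) - \<eta> u * \<eta> u"

lemma L_\<xi>: "L \<xi> = 0"
proof -
  have "J (L \<xi>) = 0" using L_\<phi>[of \<xi>] by (simp add: \<phi>_\<xi> linear_0[OF linear_L])
  then have "- L \<xi> = 0" using J_J[of "L \<xi>"] linear_0[OF linear_J] by metis
  then show ?thesis by simp
qed

lemma h_J_skew: "h x (J y) = - h y (J x)"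
  using h_J_J[of x "J y"] by (simp add: J_J base.g_simps base.g_commute[of "J x"])

lemma vertical_\<phi>: "L s = 0 \<Longrightarrow> L (\<phi> s) = 0"
  by (simp add: L_\<phi> linear_0[OF linear_J])

lemma horizontal_\<phi>:
  assumes "\<And>s. L s = 0 \<Longrightarrow> g u s = 0" "L s = 0"
  shows "g (\<phi> u) s = 0"
  using assms(1)[OF vertical_\<phi>[OF assms(2)]] g_\<phi>_skew[of u s] by simp

lemma decomposition:
  obtains a b where "u = a + b" "L a = 0" "\<And>s. L s = 0 \<Longrightarrow> g b s = 0"
  using orthogonal_decomposition[OF linear_subspace_kernel[OF linear_L], of u] by auto

text \<open>As \<open>\<phi>\<close> preserves vertical and horizontal vectors and \<open>L\<close> is isometric on the latter, the difference
  equals \<open>g a (\<phi> c) = g (\<phi> a) (\<phi> (\<phi> c))\<close> for the vertical parts \<open>a\<close> and \<open>c\<close>.\<close>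

lemma abs_fundamental_diff_le: "\<bar>g u (\<phi> w) - h (L u) (J (L w))\<bar> \<le> (\<kappa> u + \<kappa> w) / 2"
proof -
  have \<kappa>_vertical: "\<kappa> x = g (\<phi> a) (\<phi> a)"
    if x: "x = a + b" and a: "L a = 0" and b: "\<And>s. L s = 0 \<Longrightarrow> g b s = 0" for x a b
  proof -
    have "g b a = 0" "\<eta> b = 0" using b[OF a] b[OF L_\<xi>] by (auto simp: g_\<xi>)
    then show ?thesis
      using isometry[of b b] b g_commute[of a b]
      by (simp add: \<kappa>_def x linear_add[OF linear_L] a g_simps \<eta>_simps g_\<phi>_\<phi>)
  qed
  obtain a b where u: "u = a + b" "L a = 0" and b: "\<And>s. L s = 0 \<Longrightarrow> g b s = 0"
    using decomposition by blast
  obtain c d where w: "w = c + d" "L c = 0" and d: "\<And>s. L s = 0 \<Longrightarrow> g d s = 0"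
    using decomposition by blast
  have "g b (\<phi> c) = 0" using b[OF vertical_\<phi>[OF w(2)]] .
  moreover have "g a (\<phi> d) = 0" using horizontal_\<phi>[OF d u(2)] g_commute[of a "\<phi> d"] by simp
  moreover have "h (L u) (J (L w)) = g b (\<phi> d)"
  proof -
    have "h (L b) (L (\<phi> d)) = g b (\<phi> d)" using isometry[OF b horizontal_\<phi>[OF d]] .
    moreover have "L u = L b" "L w = L d"
      using u(2) w(2) unfolding u(1) w(1) linear_add[OF linear_L] by simp_all
    ultimately show ?thesis unfolding L_\<phi> by simp
  qed
  ultimately have "g u (\<phi> w) - h (L u) (J (L w)) = g a (\<phi> c)"
    by (simp add: u(1) w(1) \<phi>_simps g_simps)
  also have "\<dots> = g (\<phi> a) (\<phi> (\<phi> c))" by (simp add: g_\<phi>_\<phi>[of a] \<eta>_\<phi>)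
  finally have "\<bar>g u (\<phi> w) - h (L u) (J (L w))\<bar> \<le> (g (\<phi> a) (\<phi> a) + g (\<phi> (\<phi> c)) (\<phi> (\<phi> c))) / 2"
    using abs_g_le by simp
  also have "g (\<phi> (\<phi> c)) (\<phi> (\<phi> c)) = g (\<phi> c) (\<phi> c)" by (simp add: g_\<phi>_\<phi>[of "\<phi> c"] \<eta>_\<phi>)
  finally show ?thesis by (simp add: \<kappa>_vertical[OF u b] \<kappa>_vertical[OF w d])
qed

lemma \<kappa>_\<xi>: "\<kappa> \<xi> = 0"
  by (simp add: \<kappa>_def L_\<xi> g_\<xi> \<eta>_\<xi> base.g_simps)

lemma \<kappa>_horizontal: "(\<And>s. L s = 0 \<Longrightarrow> g b s = 0) \<Longrightarrow> \<kappa> b = 0"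
  using isometry[of b b] L_\<xi> by (simp add: \<kappa>_def flip: g_\<xi>(2))

text \<open>The pair is \<open>(\<phi> b, b)\<close> for a horizontal \<open>b \<noteq> 0\<close>.\<close>

lemma exists_horizontal_pair:
  obtains v w where "\<kappa> v = 0" "\<kappa> w = 0" "g v (\<phi> w) \<noteq> 0"
proof -
  obtain y :: 'f where "y \<noteq> 0" using nonzero_Basis by blast
  moreover obtain x where "L x = y" using surj_L by (metis surjD)
  moreover obtain a b where x: "x = a + b" "L a = 0" and b: "\<And>s. L s = 0 \<Longrightarrow> g b s = 0"
    using decomposition by blast
  ultimately have "b \<noteq> 0" using linear_0[OF linear_L] linear_add[OF linear_L] by auto
  moreover have "\<eta> b = 0" using b[OF L_\<xi>] by (simp add: g_\<xi>)
  ultimately have "g (\<phi> b) (\<phi> b) \<noteq> 0" using g_self_eq_0 by (simp add: g_\<phi>_\<phi>)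
  with \<kappa>_horizontal[OF horizontal_\<phi>[OF b]] \<kappa>_horizontal[OF b] show thesis by (rule that[of "\<phi> b" b])
qed

end

locale contact_complex_map = acm_structure M D
  for M :: "('a, 'e::euclidean_space, 'x) acm_scheme" and D +
  fixes N :: "('b, 'f::euclidean_space, 'y) hermitian_scheme" and f :: "'a \<Rightarrow> 'b"
  assumes submersion: "contact_complex_submersion M N f"
begin

lemma N: "riemannian_manifold N" "smooth_manifold N" "smooth_endo N (cplx N)"
  using submersion
  by (auto simp: contact_complex_submersion_def almost_hermitian_manifold_def riemannian_manifold_def)

lemma f: "smooth_map M N f"
  using submersion by (simp add: contact_complex_submersion_def riemannian_submersion_def)

abbreviation "df \<equiv> differential M N f"

definition base_form :: "'b \<Rightarrow> 'f \<Rightarrow> 'f \<Rightarrow> real" where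
  "base_form q u v = met N q u (cplx N q v)"

lemma differentiable_base_form: "differentiable_form2 N base_form"
  using differentiable_metric_endo[OF N(1,3)] by (simp add: base_form_def[abs_def])

lemma contact_complex_space:
  assumes p: "p \<in> points M"
  shows "contact_complex_space (met M p) (acm_phi M p) (acm_xi M p) (acm_eta M p)
    (met N (f p)) (df p) (cplx N (f p))"
proof -
  have fp: "f p \<in> points N" by (rule smooth_map_point[OF f p])
  show ?thesis
  proof (intro contact_complex_space.intro contact_complex_space_axioms.intro)
    show "acm_space (met M p) (acm_phi M p) (acm_xi M p) (acm_eta M p)" by (rule acm[OF p])
    show "scalar_product (met N (f p))" by (rule riemannian_scalar_product[OF N(1) fp])
    show "linear (df p)" by (rule linear_differential[OF M N(2) f p])
    show "linear (cplx N (f p))" using N(3) fp by (simp add: smooth_endo_def)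
    show "surj (df p)"
      using submersion p by (simp add: contact_complex_submersion_def riemannian_submersion_def)
    show "cplx N (f p) (cplx N (f p) x) = - x" for x
      using submersion fp by (simp add: contact_complex_submersion_def almost_hermitian_manifold_def)
    show "met N (f p) (cplx N (f p) x) (cplx N (f p) y) = met N (f p) x y" for x y
      using submersion fp by (simp add: contact_complex_submersion_def almost_hermitian_manifold_def)
    show "df p (acm_phi M p u) = cplx N (f p) (df p u)" for u
      using submersion p by (simp add: contact_complex_submersion_def)
    show "met N (f p) (df p u) (df p v) = met M p u v"
      if "\<And>s. df p s = 0 \<Longrightarrow> met M p u s = 0" "\<And>s. df p s = 0 \<Longrightarrow> met M p v s = 0" for u v
      using submersion p that by (simp add: contact_complex_submersion_def riemannian_submersion_def Let_def)
  qed
qed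

context
  fixes p assumes p: "p \<in> points M"
begin

interpretation contact_complex_space "met M p" "acm_phi M p" "acm_xi M p" "acm_eta M p"
  "met N (f p)" "df p" "cplx N (f p)"
  by (rule contact_complex_space[OF p])

text \<open>Where \<open>\<kappa> u\<close> and \<open>\<kappa> w\<close> vanish at \<open>p\<close>, adding the difference of the two forms to its bound, or subtracting
  it, gives a function with minimum \<open>0\<close> at \<open>p\<close>. Both derivatives vanish, hence so does that of the difference.\<close>

lemma deriv_fundamental_form_eq:
  assumes u: "\<kappa> u = 0" and w: "\<kappa> w = 0"
  shows "deriv_along M p v (\<lambda>q. fundamental_form M q (extend_vf M p u q) (extend_vf M p w q))
       = deriv_along M p v (\<lambda>q. base_form (f q) (df q (extend_vf M p u q)) (df q (extend_vf M p w q)))"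
proof -
  let ?U = "extend_vf M p u" and ?W = "extend_vf M p w"
  let ?F = "\<lambda>q. fundamental_form M q (?U q) (?W q)" and ?P = "\<lambda>q. base_form (f q) (df q (?U q)) (df q (?W q))"
  let ?k = "\<lambda>X q. met M q (X q) (X q) - met N (f q) (df q (X q)) (df q (X q)) - acm_eta M q (X q) * acm_eta M q (X q)"
  have "\<exists>K. has_deriv_at M p (?k (extend_vf M p x)) K" for x
    by (rule exI, rule has_deriv_at_diff[OF has_deriv_at_diff[OF differentiable_form2D(2)[OF diff_g p]
          has_deriv_at_pullback2[OF M N(2) f p differentiable_metric[OF N(1)]]]
          has_deriv_at_mult[OF M p differentiable_form1D(2)[OF diff_\<eta> p] differentiable_form1D(2)[OF diff_\<eta> p]]])
  then obtain K1 K2 where K: "has_deriv_at M p (?k ?U) K1" "has_deriv_at M p (?k ?W) K2" by blast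
  have F: "has_deriv_at M p ?F (\<lambda>v. deriv_along M p v ?F)"
    by (rule differentiable_form2D(2)[OF diff_\<phi> p])
  have P: "has_deriv_at M p ?P (\<lambda>v. deriv_along M p v ?P)"
    by (rule differentiable_form2D(2)[OF differentiable_form2_pullback[OF M N(2) f differentiable_base_form] p])
  have bound: "\<bar>?F q - ?P q\<bar> \<le> 1/2 * (?k ?U q + ?k ?W q)" if "q \<in> points M" for q
  proof -
    interpret q: contact_complex_space "met M q" "acm_phi M q" "acm_xi M q" "acm_eta M q"
      "met N (f q)" "df q" "cplx N (f q)"
      by (rule contact_complex_space[OF that])
    show ?thesis
      using q.abs_fundamental_diff_le[of "?U q" "?W q"] by (simp add: q.\<kappa>_def fundamental_form_def base_form_def)
  qed
  have zero: "?k ?U p = 0" "?k ?W p = 0"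
    using u w by (simp_all add: \<kappa>_def extend_vf_self[OF M p])
  then have zero': "?F p - ?P p = 0"
    using bound[OF p] by simp
  let ?h1 = "\<lambda>q. 1/2 * (?k ?U q + ?k ?W q) - (?F q - ?P q)"
  let ?h2 = "\<lambda>q. 1/2 * (?k ?U q + ?k ?W q) + (?F q - ?P q)"
  have "?h1 p = 0" "?h2 p = 0" unfolding zero zero' by simp_all
  then have min: "?h1 p \<le> ?h1 q" "?h2 p \<le> ?h2 q" if "q \<in> points M" for q
    using bound[OF that] unfolding \<open>?h1 p = 0\<close> \<open>?h2 p = 0\<close> by linarith+
  have "1/2 * (K1 v + K2 v) - (deriv_along M p v ?F - deriv_along M p v ?P) = 0"
    by (rule has_deriv_at_minimum[where f = ?h1, OF M p openin_points p min(1)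
          has_deriv_at_diff[OF has_deriv_at_cmult[OF has_deriv_at_add[OF K]] has_deriv_at_diff[OF F P]]])
  moreover have "1/2 * (K1 v + K2 v) + (deriv_along M p v ?F - deriv_along M p v ?P) = 0"
    by (rule has_deriv_at_minimum[where f = ?h2, OF M p openin_points p min(2)
          has_deriv_at_add[OF has_deriv_at_cmult[OF has_deriv_at_add[OF K]] has_deriv_at_diff[OF F P]]])
  ultimately show ?thesis by linarith
qed

text \<open>On these vectors \<open>d\<phi>\<close> agrees with the pull-back of a 3-form of the base, which vanishes as soon as one
  argument is vertical.\<close>

lemma ext_deriv_fundamental_form_\<xi>:
  assumes "\<kappa> v = 0" "\<kappa> w = 0"
  shows "coord_ext_deriv2 M (fundamental_form M) p (acm_xi M p) v w = 0"
proof -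
  have fp: "f p \<in> points N" by (rule smooth_map_point[OF f p])
  have "coord_ext_deriv2 M (fundamental_form M) p (acm_xi M p) v w
      = coord_ext_deriv2 M (\<lambda>q u v. base_form (f q) (df q u) (df q v)) p (acm_xi M p) v w"
    unfolding coord_ext_deriv2_def by (simp add: deriv_fundamental_form_eq assms \<kappa>_\<xi>)
  also have "\<dots> = coord_ext_deriv2 N base_form (f p) (df p (acm_xi M p)) (df p v) (df p w)"
    by (rule coord_ext_deriv2_pullback[OF M N(2) f p differentiable_base_form])
      (unfold base_form_def, rule h_J_skew)
  also have "\<dots> = 0"
    unfolding L_\<xi> by (rule coord_ext_deriv2_zero[OF N(2) fp differentiable_base_form])
  finally show ?thesis .
qed

lemma factor_of_fundamental_form_\<xi>:
  assumes eq: "\<And>u v w. coord_ext_deriv2 M (fundamental_form M) p u v w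
          = - 2 * wedge12 \<alpha> (fundamental_form M) p u v w"
  shows "\<alpha> p (acm_xi M p) = 0"
proof -
  obtain v w where vw: "\<kappa> v = 0" "\<kappa> w = 0" "met M p v (acm_phi M p w) \<noteq> 0"
    by (rule exists_horizontal_pair)
  have "wedge12 \<alpha> (fundamental_form M) p (acm_xi M p) v w = 0"
    using eq ext_deriv_fundamental_form_\<xi>[OF vw(1,2)] by simp
  then show ?thesis
    using vw(3) by (simp add: wedge12_def fundamental_form_def \<phi>_\<xi> g_\<xi> \<eta>_\<phi> g_simps)
qed

end

end

section \<open>Fibres\<close>

text \<open>By the chain rule, \<open>df \<circ> dj\<close> is the derivative of the coordinate expression of \<open>f \<circ> j\<close>, a constant.\<close>

lemma differential_fibre_zero:
  assumes F: "smooth_manifold F" and M: "smooth_manifold M" and N: "smooth_manifold N"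
    and j: "smooth_map F M j" and f: "smooth_map M N f" and p: "p \<in> points F"
    and const: "\<And>q. q \<in> points F \<Longrightarrow> f (j q) = c"
  shows "differential M N f (j p) (differential F M j p u) = 0"
proof -
  have jp: "j p \<in> points M" by (rule smooth_map_point[OF j p])
  let ?h = "coord_map F M j p" and ?k = "coord_map M N f (j p)"
  let ?S = "snd (chart_at F p) ` (fst (chart_at F p) \<inter> chart_preimage F M j p)"
  note preD = chart_preimageD[OF F M j p]
  have h_eq: "?h (snd (chart_at F p) q) = snd (chart_at M (j p)) (j q)" if "q \<in> fst (chart_at F p)" for q
    by (rule coord_map_eq[OF F M j p that])
  have "?h (coords_at F p) = coords_at M (j p)"
    unfolding coords_at_def by (rule h_eq[OF chart_at_mem[OF F p]])
  then have "((\<lambda>x. ?k (?h x)) has_derivative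
      (\<lambda>u. differential M N f (j p) (differential F M j p u))) (at (coords_at F p))"
    using coord_map_has_derivative[OF F M j p coords_at_mem_coord_domain[OF F M j p]]
      coord_map_has_derivative[OF M N f jp coords_at_mem_coord_domain[OF M N f jp]]
    by (simp add: has_derivative_compose differential_eq_coord_map)
  then have "((\<lambda>x. snd (chart_at N c) c) has_derivative
      (\<lambda>u. differential M N f (j p) (differential F M j p u))) (at (coords_at F p))"
  proof (rule has_derivative_transform_within_open[OF _ coord_domain_open[OF F M j p] coords_at_mem_coord_domain[OF F M j p]])
    fix x assume "x \<in> ?S"
    then obtain q where q: "x = snd (chart_at F p) q" "q \<in> fst (chart_at F p)" "q \<in> chart_preimage F M j p" by blast
    show "?k (?h x) = snd (chart_at N c) c"
      using preD[OF q(3)] q(1) h_eq[OF q(2)] coord_map_eq[OF M N f jp, of "j q"] const p by simp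
  qed
  from has_derivative_unique[OF this has_derivative_const] show ?thesis
    by (rule fun_cong)
qed

text \<open>Chart notions refer to the topology and the atlas only, so they do not distinguish the fibre
  from the fibre with its induced structure.\<close>

lemma induced_acm_simps:
  "mtop (induced_acm M F0) = mtop F0" "atlas (induced_acm M F0) = atlas F0"
  "points (induced_acm M F0) = points F0"
  by (simp_all add: induced_acm_def Let_def points_def)

lemma smooth_manifold_induced: "smooth_manifold (induced_acm M F0) = smooth_manifold F0"
  by (simp add: smooth_manifold_def induced_acm_simps)

lemma smooth_map_induced: "smooth_map (induced_acm M F0) N f = smooth_map F0 N f"
  by (simp add: smooth_map_def induced_acm_simps)

lemma differential_induced: "differential (induced_acm M F0) N f = differential F0 N f"
  by (simp add: differential_def[abs_def] chart_at_def coords_at_def induced_acm_simps)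

lemma embedded_submanifold_induced:
  assumes "embedded_submanifold F0 M"
  shows "smooth_manifold (induced_acm M F0)" "smooth_map (induced_acm M F0) M (\<lambda>p. p)"
    "p \<in> points F0 \<Longrightarrow> inj (differential F0 M (\<lambda>p. p) p)"
  using assms by (auto simp: embedded_submanifold_def smooth_manifold_induced smooth_map_induced)

context contact_complex_map
begin

context
  fixes F0 :: "('a, 'h::euclidean_space) mfd" and c :: 'b
  assumes fibre: "is_fibre M N f c F0" and dim: "DIM('e) = DIM('f) + DIM('h)"
begin

abbreviation "F \<equiv> induced_acm M F0"
abbreviation "\<iota> \<equiv> differential F0 M (\<lambda>p. p)"

lemma F: "smooth_manifold F" "smooth_map F M (\<lambda>p. p)" "p \<in> points F0 \<Longrightarrow> inj (\<iota> p)"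
  using fibre unfolding is_fibre_def by (auto intro: embedded_submanifold_induced)

lemma fibre_point: "p \<in> points F0 \<Longrightarrow> p \<in> points M" "p \<in> points F0 \<Longrightarrow> f p = c"
  using fibre by (auto simp: is_fibre_def)

lemma linear_\<iota>: "p \<in> points F0 \<Longrightarrow> linear (\<iota> p)"
  using linear_differential[OF F(1) M F(2)] by (simp add: induced_acm_simps differential_induced)

text \<open>The tangent space of the fibre lies in the kernel of \<open>df\<close>, and both have the same dimension.\<close>

lemma range_\<iota>:
  assumes p: "p \<in> points F0"
  shows "range (\<iota> p) = {u. df p u = 0}"
proof (rule subspace_dim_equal)
  interpret contact_complex_space "met M p" "acm_phi M p" "acm_xi M p" "acm_eta M p"
    "met N (f p)" "df p" "cplx N (f p)"
    by (rule contact_complex_space[OF fibre_point(1)[OF p]])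
  show "subspace (range (\<iota> p))" by (rule linear_subspace_image[OF linear_\<iota>[OF p] subspace_UNIV])
  show "subspace {u. df p u = 0}" by (rule linear_subspace_kernel[OF linear_L])
  have "df p (\<iota> p u) = 0" for u
    using differential_fibre_zero[OF F(1) M N(2) F(2) f, of p c u] p fibre_point(2)
    by (simp add: induced_acm_simps differential_induced)
  then show "range (\<iota> p) \<subseteq> {u. df p u = 0}" by auto
  have "dim (range (\<iota> p)) = DIM('h)"
    using dim_image_eq[OF linear_\<iota>[OF p], of UNIV] F(3)[OF p] by simp
  then show "dim {u. df p u = 0} \<le> dim (range (\<iota> p))"
    using dim_kernel_surj[OF linear_L surj_L] dim by simp
qed

text \<open>The induced \<open>\<phi>\<close> and \<open>\<xi>\<close> are well defined, as \<open>\<phi>\<close> preserves the kernel of \<open>df\<close>, which contains \<open>\<xi>\<close>.\<close>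

lemma \<iota>_phi_xi:
  assumes p: "p \<in> points F0"
  shows "\<iota> p (acm_phi F p u) = acm_phi M p (\<iota> p u)" "\<iota> p (acm_xi F p) = acm_xi M p"
proof -
  interpret contact_complex_space "met M p" "acm_phi M p" "acm_xi M p" "acm_eta M p"
    "met N (f p)" "df p" "cplx N (f p)"
    by (rule contact_complex_space[OF fibre_point(1)[OF p]])
  have the: "\<iota> p (THE w. \<iota> p w = x) = x" if "df p x = 0" for x
  proof -
    have "x \<in> range (\<iota> p)" unfolding range_\<iota>[OF p] using that by simp
    then obtain w where w: "\<iota> p w = x" by blast
    show ?thesis
      by (rule theI[of "\<lambda>w. \<iota> p w = x" w, OF w]) (rule injD[OF F(3)[OF p]], simp add: w)
  qed
  have "\<iota> p u \<in> {u. df p u = 0}" unfolding range_\<iota>[OF p, symmetric] by (rule rangeI)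
  then have "df p (\<iota> p u) = 0" by simp
  then show "\<iota> p (acm_phi F p u) = acm_phi M p (\<iota> p u)"
    using the[OF vertical_\<phi>] by (simp add: induced_acm_def Let_def)
  show "\<iota> p (acm_xi F p) = acm_xi M p"
    using the[OF L_\<xi>] by (simp add: induced_acm_def Let_def)
qed

lemma induced_met: "met F p u v = met M p (\<iota> p u) (\<iota> p v)"
  by (simp add: induced_acm_def Let_def)

lemma induced_eta: "acm_eta F p u = acm_eta M p (\<iota> p u)"
  by (simp add: induced_acm_def Let_def restrict_form1_def)

lemma induced_fundamental_form:
  "p \<in> points F0 \<Longrightarrow> fundamental_form F p u v = fundamental_form M p (\<iota> p u) (\<iota> p v)"
  by (simp add: fundamental_form_def induced_met \<iota>_phi_xi)

lemma induced_acm_space: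
  assumes p: "p \<in> points F0"
  shows "acm_space (met F p) (acm_phi F p) (acm_xi F p) (acm_eta F p)"
proof (intro acm_space.intro acm_space_axioms.intro scalar_product.intro)
  interpret acm_space "met M p" "acm_phi M p" "acm_xi M p" "acm_eta M p"
    by (rule acm[OF fibre_point(1)[OF p]])
  note \<iota>_lin = linear_\<iota>[OF p]
  note \<iota>_simps = linear_add[OF \<iota>_lin] linear_scale[OF \<iota>_lin] linear_neg[OF \<iota>_lin]
  have \<iota>_eqD: "u = v" if "\<iota> p u = \<iota> p v" for u v using F(3)[OF p] that by (rule injD)
  have "met F p = (\<lambda>u v. met M p (\<iota> p u) (\<iota> p v))" by (intro ext) (rule induced_met)
  then show "bilinear (met F p)" using bilinear_compose_linear[OF bilinear_g \<iota>_lin] by simp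
  show "met F p u v = met F p v u" for u v by (simp add: induced_met g_commute)
  show "met F p u u > 0" if "u \<noteq> 0" for u
  proof -
    have "\<iota> p u \<noteq> 0" using \<iota>_eqD[of u 0] that linear_0[OF \<iota>_lin] by auto
    then show ?thesis using g_pos by (simp add: induced_met)
  qed
  show "linear (acm_phi F p)"
    by (rule linearI; rule \<iota>_eqD) (simp_all add: \<iota>_phi_xi[OF p] \<iota>_simps \<phi>_simps)
  have "acm_eta F p = (\<lambda>u. acm_eta M p (\<iota> p u))" by (intro ext) (rule induced_eta)
  then show "linear (acm_eta F p)" using linear_compose[OF \<iota>_lin linear_\<eta>] by (simp add: o_def)
  show "acm_phi F p (acm_phi F p u) = - u + acm_eta F p u *\<^sub>R acm_xi F p" for u
    by (rule \<iota>_eqD) (simp only: \<iota>_phi_xi[OF p] \<iota>_simps \<phi>_\<phi> induced_eta)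
  show "acm_eta F p (acm_xi F p) = 1" by (simp add: induced_eta \<iota>_phi_xi[OF p] \<eta>_\<xi>)
  show "met F p (acm_phi F p u) (acm_phi F p v) = met F p u v - acm_eta F p u * acm_eta F p v" for u v
    by (simp add: induced_met induced_eta \<iota>_phi_xi[OF p] g_\<phi>_\<phi>)
qed

lemma induced_acm_structure:
  assumes "levi_civita F D\<^sub>F"
  shows "acm_structure F D\<^sub>F"
proof (rule acm_structure.intro)
  show "acm_space (met F p) (acm_phi F p) (acm_xi F p) (acm_eta F p)" if "p \<in> points F" for p
    using induced_acm_space that by (simp add: induced_acm_simps)
  have 2: "differentiable_form2 F (\<lambda>q u v. \<beta> q (\<iota> q u) (\<iota> q v))" if "differentiable_form2 M \<beta>" for \<beta>
    using differentiable_form2_pullback[OF F(1) M F(2) that] by (simp add: differential_induced)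
  show "differentiable_form2 F (met F)"
    by (rule differentiable_form2_cong[OF F(1) 2[OF diff_g]]) (rule induced_met)
  show "differentiable_form2 F (fundamental_form F)"
    by (rule differentiable_form2_cong[OF F(1) 2[OF diff_\<phi>]])
      (simp add: induced_acm_simps induced_fundamental_form)
  have "differentiable_form1 F (\<lambda>q u. acm_eta M q (\<iota> q u))"
    using differentiable_form1_pullback[OF F(1) M F(2) diff_\<eta>] by (simp add: differential_induced)
  then show "differentiable_form1 F (acm_eta F)"
    by (rule differentiable_form1_cong[OF F(1)]) (intro ext, rule induced_eta)
qed (rule F(1) assms)+

lemma coord_ext_deriv_induced_fundamental_form:
  assumes p: "p \<in> points F0"
  shows "coord_ext_deriv2 F (fundamental_form F) p u v w
       = coord_ext_deriv2 M (fundamental_form M) p (\<iota> p u) (\<iota> p v) (\<iota> p w)"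
proof -
  have pF: "p \<in> points F" using p by (simp add: induced_acm_simps)
  have "differentiable_form2 F (\<lambda>q u v. fundamental_form M q (\<iota> q u) (\<iota> q v))"
    using differentiable_form2_pullback[OF F(1) M F(2) diff_\<phi>] by (simp add: differential_induced)
  then have "coord_ext_deriv2 F (fundamental_form F) p u v w
      = coord_ext_deriv2 F (\<lambda>q u v. fundamental_form M q (\<iota> q u) (\<iota> q v)) p u v w"
    by (rule coord_ext_deriv2_cong[OF F(1) pF]) (simp add: induced_acm_simps induced_fundamental_form)
  also have "\<dots> = coord_ext_deriv2 M (fundamental_form M) p (\<iota> p u) (\<iota> p v) (\<iota> p w)"
    using coord_ext_deriv2_pullback[OF F(1) M F(2) pF diff_\<phi> fundamental_form_skew[OF fibre_point(1)[OF p]]]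
    by (simp add: differential_induced)
  finally show ?thesis .
qed

text \<open>Both sides are \<open>d\<eta>(\<xi>, u)\<close>, and the exterior derivative commutes with restriction to the fibre.\<close>

lemma nabla_\<xi>_\<eta>_induced:
  assumes D\<^sub>F: "levi_civita F D\<^sub>F" and p: "p \<in> points F0"
  shows "nabla_form1 F D\<^sub>F (acm_eta F) p (acm_xi F p) u
       = nabla_form1 M D (acm_eta M) p (acm_xi M p) (\<iota> p u)"
proof -
  have pF: "p \<in> points F" using p by (simp add: induced_acm_simps)
  have "deriv_along F p a (\<lambda>q. acm_eta F q (extend_vf F p b q))
     = deriv_along M p (\<iota> p a) (\<lambda>q. acm_eta M q (extend_vf M p (\<iota> p b) q))
       + acm_eta M p (coord_hessian F M (\<lambda>p. p) p a b)" for a b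
    using deriv_along_eqI[OF has_deriv_at_pullback1[OF F(1) M F(2) pF diff_\<eta>], of a b]
    by (simp add: differential_induced induced_eta)
  then show ?thesis
    unfolding acm_structure.nabla_\<xi>_\<eta>[OF induced_acm_structure[OF D\<^sub>F] pF]
      nabla_\<xi>_\<eta>[OF fibre_point(1)[OF p]]
    by (simp add: \<iota>_phi_xi[OF p] coord_hessian_symmetric[OF F(1) M F(2) pF, of "acm_xi F p" u])
qed

end

end

theorem proposition2p2:
  fixes M :: "('a, 'e::euclidean_space) acm"
    and M' :: "('b, 'f::euclidean_space) hermitian"
    and \<pi> :: "'a \<Rightarrow> 'b"
    and q :: 'b
    and F0 :: "('a, 'h::euclidean_space) mfd"
    and F :: "('a, 'h) acm"
    and D :: "'a \<Rightarrow> 'e \<Rightarrow> ('a \<Rightarrow> 'e) \<Rightarrow> 'e"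
    and D\<^sub>F :: "'a \<Rightarrow> 'h \<Rightarrow> ('a \<Rightarrow> 'h) \<Rightarrow> 'h"
    and m n r :: nat
  assumes "contact_complex_submersion M M' \<pi>"
    and "DIM('e) = 2 * m + 1" and "2 * m + 1 \<ge> 5"
    and "DIM('f) = 2 * n" and "2 * n \<ge> 2"
    and "DIM('h) = 2 * r + 1" and "2 * r + 1 \<ge> 3"
    and "m = n + r"
    and "is_fibre M M' \<pi> q F0"
    and "F = induced_acm M F0"
    and "levi_civita M D"
    and "levi_civita F D\<^sub>F"
    and "ext_deriv2_eq M (fundamental_form M)
           (\<lambda>p u v w. - 2 * wedge12 (lee_form M D) (fundamental_form M) p u v w)"
  shows "(\<forall>p\<in>points F. codiff1 F D\<^sub>F (acm_eta F) p = 0) \<and>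
    (r \<ge> 2 \<longrightarrow>
      ext_deriv2_eq F (fundamental_form F)
        (\<lambda>p u v w. - 2 * wedge12 (restrict_form1 F M (lee_form M D)) (fundamental_form F) p u v w) \<and>
      (\<forall>p\<in>points F. \<forall>u. restrict_form1 F M (lee_form M D) p u = lee_form F D\<^sub>F p u)) \<and>
    (r = 1 \<longrightarrow>
      (\<forall>p\<in>points F. \<forall>u. lee_form F D\<^sub>F p u
         = restrict_form1 F M (\<lambda>p. nabla_form1 M D (acm_eta M) p (acm_xi M p)) p u))"
proof -
  let ?\<omega> = "lee_form M D" and ?\<omega>F = "restrict_form1 F M (lee_form M D)"
  have F: "F = induced_acm M F0" by fact
  have LF: "levi_civita (induced_acm M F0) D\<^sub>F" using assms(12) F by simp
  have "acm_manifold M" using assms(1) by (simp add: contact_complex_submersion_def)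
  then interpret M: acm_structure M D using assms(11) by (rule acm_manifold_acm_structure)
  interpret M: contact_complex_map M D M' \<pi>
    by (intro contact_complex_map.intro contact_complex_map_axioms.intro M.acm_structure_axioms assms(1))
  have dim: "DIM('e) = DIM('f) + DIM('h)" using assms by simp
  note fib = assms(9) dim
  interpret F: acm_structure F D\<^sub>F
    unfolding F by (rule M.induced_acm_structure[OF fib LF])
  let ?\<iota> = "differential F0 M (\<lambda>p. p)"
  have pts: "points F = points F0" by (simp add: F induced_acm_simps)
  have \<omega>F: "?\<omega>F p u = ?\<omega> p (?\<iota> p u)" for p u
    by (simp add: restrict_form1_def F differential_induced)
  have dM: "coord_ext_deriv2 M (fundamental_form M) p u v w = - 2 * wedge12 ?\<omega> (fundamental_form M) p u v w"
    if p: "p \<in> points M" for p u v w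
  proof -
    have "ext_deriv2 M (fundamental_form M) (extend_vf M p u) (extend_vf M p v) (extend_vf M p w) p
      = - 2 * wedge12 ?\<omega> (fundamental_form M) p (extend_vf M p u p) (extend_vf M p v p) (extend_vf M p w p)"
      using assms(13) p extend_vf_smooth_near[OF M.M p] unfolding ext_deriv2_eq_def by blast
    then show ?thesis
      by (simp only: ext_deriv2_extend_vf[OF M.M p M.diff_\<phi>] extend_vf_self[OF M.M p])
  qed
  have dF: "coord_ext_deriv2 F (fundamental_form F) p u v w = - 2 * wedge12 ?\<omega>F (fundamental_form F) p u v w"
    if p: "p \<in> points F" for p u v w
  proof -
    have p0: "p \<in> points F0" using p pts by simp
    show ?thesis
      using dM[OF M.fibre_point(1)[OF fib p0]]
      by (simp add: F M.coord_ext_deriv_induced_fundamental_form[OF fib p0] wedge12_def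
          M.induced_fundamental_form[OF fib p0] \<omega>F[unfolded F])
  qed
  have lin: "linear (?\<omega>F p)" if p: "p \<in> points F" for p
  proof -
    have p0: "p \<in> points F0" using p pts by simp
    have "?\<omega>F p = (\<lambda>u. ?\<omega> p (?\<iota> p u))" by (intro ext) (rule \<omega>F)
    then show ?thesis
      using linear_compose[OF M.linear_\<iota>[OF fib p0] M.linear_lee_form[OF M.fibre_point(1)[OF fib p0]]]
      by (simp add: o_def)
  qed
  have codiff: "codiff1 F D\<^sub>F (acm_eta F) p = 0" if p: "p \<in> points F" for p
  proof -
    have p0: "p \<in> points F0" using p pts by simp
    have "?\<omega> p (acm_xi M p) = 0"
      by (rule M.factor_of_fundamental_form_\<xi>[where \<alpha> = ?\<omega>, OF M.fibre_point(1)[OF fib p0]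
            dM[OF M.fibre_point(1)[OF fib p0]]])
    moreover have "codiff1 F D\<^sub>F (acm_eta F) p = 2 * real r * ?\<omega>F p (acm_xi F p)"
      by (rule F.codiff_\<eta>[where \<alpha> = ?\<omega>F, OF p assms(6) lin[OF p] dF[OF p]])
    ultimately show ?thesis
      using M.\<iota>_phi_xi(2)[OF fib p0] by (simp add: \<omega>F[unfolded F] F)
  qed
  show ?thesis
  proof (intro conjI impI ballI allI)
    show "codiff1 F D\<^sub>F (acm_eta F) p = 0" if "p \<in> points F" for p by (rule codiff[OF that])
  next
    show "ext_deriv2_eq F (fundamental_form F) (\<lambda>p u v w. - 2 * wedge12 ?\<omega>F (fundamental_form F) p u v w)"
      unfolding ext_deriv2_eq_def
    proof (intro ballI allI impI)
      fix p X Y Z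
      assume p: "p \<in> points F" and XYZ: "smooth_vf_near F p X" "smooth_vf_near F p Y" "smooth_vf_near F p Z"
      show "ext_deriv2 F (fundamental_form F) X Y Z p = - 2 * wedge12 ?\<omega>F (fundamental_form F) p (X p) (Y p) (Z p)"
        by (subst ext_deriv2_eq_coord[OF F.M p F.diff_\<phi> F.fundamental_form_skew[OF p] XYZ]) (rule dF[OF p])
    qed
  next
    fix p u assume "r \<ge> 2" and p: "p \<in> points F"
    show "?\<omega>F p u = lee_form F D\<^sub>F p u"
      by (rule F.lee_form_eq[where \<alpha> = ?\<omega>F, OF p assms(6) lin[OF p] dF[OF p] \<open>r \<ge> 2\<close>, symmetric])
  next
    fix p u assume r: "r = 1" and p: "p \<in> points F"
    have p0: "p \<in> points F0" using p pts by simp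
    have "lee_form F D\<^sub>F p u = nabla_form1 F D\<^sub>F (acm_eta F) p (acm_xi F p) u"
      using codiff[OF p] r assms(6) by (simp add: lee_form_def Let_def)
    also have "\<dots> = nabla_form1 M D (acm_eta M) p (acm_xi M p) (?\<iota> p u)"
      unfolding F by (rule M.nabla_\<xi>_\<eta>_induced[OF fib LF p0])
    finally show "lee_form F D\<^sub>F p u
         = restrict_form1 F M (\<lambda>p. nabla_form1 M D (acm_eta M) p (acm_xi M p)) p u"
      by (simp add: restrict_form1_def F differential_induced)
  qed
qed

end
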